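(* Suppose $u:D\to\mathbb{R}$ satisfies $\Delta u=0$ in $D$ and there exists $f\in\mathcal{HK}$ such that (i) $u_r(\theta)\to f(\theta)$ as $r\to1$ for each $\theta\in[-\pi,\pi)$, (ii) $\|u_r\|=o(1/(1-r))$ as $r\to1$. Then $u=P[f]$.
   Context: $D$ is the open unit disc in $\mathbb{R}^2$; for $u:D\to\mathbb{R}$ write $u_r(\theta)=u(re^{i\theta})$. $\mathcal{HK}$ is the set of $2\pi$-periodic (everywhere finite, real-valued) functions $f:\mathbb{R}\to\mathbb{R}$ that are Henstock--Kurzweil integrable over a period, equivalently with finite Alexiewicz norm $\|f\|:=\sup_I|\int_I f|$, the supremum being over intervals $I\subset\mathbb{R}$ of length at most $2\pi$. The symbol $\|\cdot\|$ is the Alexiewicz norm. The Poisson kernel is $\Phi_r(\theta)=\frac{1-r^2}{2\pi(1-2r\cos\theta+r^2)}$ and the Poisson integral of $f$ is $P[f](re^{i\theta})=\int_{-\pi}^{\pi}f(\phi)\Phi_r(\phi-\theta)\,d\phi$ (a Henstock--Kurzweil integral). Limits $r\to1$ are from below. *)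

theory Defs
  imports "HOL-Analysis.Analysis" "HOL-Library.Landau_Symbols"
begin

definition partial_deriv :: "'a::euclidean_space \<Rightarrow> ('a \<Rightarrow> real) \<Rightarrow> 'a \<Rightarrow> real" where
  "partial_deriv b u z = deriv (\<lambda>t. u (z + t *\<^sub>R b)) 0"

(* Class C^k for open S: all partial derivatives of order at most k exist and are continuous. *)
primrec Ck_on :: "nat \<Rightarrow> 'a::euclidean_space set \<Rightarrow> ('a \<Rightarrow> real) \<Rightarrow> bool" where
  "Ck_on 0 S u \<longleftrightarrow> continuous_on S u"
| "Ck_on (Suc k) S u \<longleftrightarrow> continuous_on S u \<and>
     (\<forall>b\<in>Basis. (\<forall>z\<in>S. (\<lambda>t. u (z + t *\<^sub>R b)) differentiable (at 0)) \<and>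
                Ck_on k S (partial_deriv b u))"

definition laplacian :: "('a::euclidean_space \<Rightarrow> real) \<Rightarrow> 'a \<Rightarrow> real" where
  "laplacian u z = (\<Sum>b\<in>Basis. partial_deriv b (partial_deriv b u) z)"

definition harmonic_on :: "'a::euclidean_space set \<Rightarrow> ('a \<Rightarrow> real) \<Rightarrow> bool" where
  "harmonic_on S u \<longleftrightarrow> Ck_on 2 S u \<and> (\<forall>z\<in>S. laplacian u z = 0)"

(* integrable_on and integral are the Henstock-Kurzweil notions. *)
definition HK :: "(real \<Rightarrow> real) set" where
  "HK = {f. (\<forall>x. f (x + 2 * pi) = f x) \<and> f integrable_on {-pi..pi}}"

(* For f in HK the set of values is bounded, so the real-valued supremum is the genuine one.
   The boundedness of I is stated because diameter is only meaningful for bounded sets. *)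
definition alexiewicz_norm :: "(real \<Rightarrow> real) \<Rightarrow> real" where
  "alexiewicz_norm f =
     (SUP I\<in>{I. is_interval I \<and> bounded I \<and> diameter I \<le> 2 * pi}. \<bar>integral I f\<bar>)"

definition poisson_kernel :: "real \<Rightarrow> real \<Rightarrow> real" where
  "poisson_kernel r \<theta> = (1 - r\<^sup>2) / (2 * pi * (1 - 2 * r * cos \<theta> + r\<^sup>2))"

definition poisson_integral :: "(real \<Rightarrow> real) \<Rightarrow> complex \<Rightarrow> real" where
  "poisson_integral f z =
     integral {-pi..pi} (\<lambda>\<phi>. f \<phi> * poisson_kernel (cmod z) (\<phi> - Arg z))"

(* The value does not depend on the choice of the polar angle. *)
lemma poisson_integral_rcis:
  assumes "0 \<le> r"
  shows "poisson_integral f (rcis r \<theta>) =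
           integral {-pi..pi} (\<lambda>\<phi>. f \<phi> * poisson_kernel r (\<phi> - \<theta>))"
proof -
  have "poisson_kernel r (\<phi> - Arg (rcis r \<theta>)) = poisson_kernel r (\<phi> - \<theta>)" for \<phi>
  proof (cases "r = 0")
    case True
    then show ?thesis by (simp add: poisson_kernel_def)
  next
    case False
    then have "cis (Arg (rcis r \<theta>)) = cis \<theta>"
      using assms by (simp add: cis_Arg sgn_eq rcis_def norm_mult)
    then have "cos (Arg (rcis r \<theta>)) = cos \<theta>" "sin (Arg (rcis r \<theta>)) = sin \<theta>"
      by (auto simp: complex_eq_iff)
    then show ?thesis by (simp add: poisson_kernel_def cos_diff)
  qed
  then show ?thesis
    using assms by (simp add: poisson_integral_def)
qed

end

theory Submission
  imports Defs "HOL-Complex_Analysis.Complex_Analysis"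
begin

text \<open>
  Perron's method reduces the claim to a one-sided statement in which \<open>f\<close> no longer appears. For
  $\epsilon > 0$ there is an increasing \<open>g\<close> with $0 \le g \le \epsilon$ such that \<open>M = F + g\<close>, with \<open>F\<close> an
  indefinite integral of \<open>f\<close>, is a major function of \<open>f\<close>. The Poisson-Stieltjes integral of \<open>M\<close> is
  harmonic, is $O(1/(1-r))$, has radial lower limits at least \<open>f\<close> everywhere, and differs from \<open>P[f]\<close>
  by at most $4\epsilon/(1-r)$. Hence its difference with \<open>u\<close> has nonnegative radial lower limits
  and, by the growth hypothesis on the Alexiewicz norms and Poisson's formula, is bounded below by
  $-o((1-r)^{-2})$. A harmonic function with these two properties is nonnegative: after passing to the
  half-plane by the exponential map, this follows from Baire's theorem and a Phragmen-Lindelof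
  argument at right-angled corners, for which $|z|^{-2}$ is the critical growth. So $u \le P[f]$, and
  the same argument for \<open>- u\<close> and \<open>- f\<close> gives equality.
\<close>

section \<open>Harmonic functions as real parts of holomorphic functions\<close>

text \<open>The obstacle is that all hypotheses are pointwise, while \<open>P[f]\<close> is only
  known to have radial limit \<open>f\<close> where \<open>F\<close> has derivative
  \<open>f\<close>, that is, almost everywhere. A major function removes the exceptional set: its
  difference quotients over short intervals around any point \<open>t\<close> are at least
  \<open>f t\<close>. The price is that only lower limits survive. The order (1-r)^-2 is a product:
  Poisson's formula on an intermediate circle, integrated by parts, pairs the Alexiewicz norm, which
  is o(1/(1-r)), with the angular derivative of the kernel, whose L1 norm is O(1/(1-r)). The order
  is sharp. Im (z/(1-z)^2), up to a factor the derivative of the Poisson kernel, is a nonzero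
  harmonic function with all radial limits 0 and Alexiewicz norms 2r/(1-r^2). So the little o has to
  be carried through to the corner estimates. Radial limits are attained at rates that depend on the
  angle; Baire's theorem supplies the uniformity, but only on a small piece of the exceptional set.
  The exponential map turns radii into vertical lines, so that the comparison regions are triangles
  and boxes with explicit comparison functions.\<close>

lemma mixed_difference_mean_value:
  fixes v vx vxy :: "real \<Rightarrow> real \<Rightarrow> real"
  assumes h: "0 < h" "h < r"
    and dx: "\<And>x y. \<bar>x - a\<bar> < r \<Longrightarrow> \<bar>y - b\<bar> < r \<Longrightarrow> ((\<lambda>x. v x y) has_real_derivative vx x y) (at x)"
    and dxy: "\<And>x y. \<bar>x - a\<bar> < r \<Longrightarrow> \<bar>y - b\<bar> < r \<Longrightarrow> ((\<lambda>y. vx x y) has_real_derivative vxy x y) (at y)"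
  shows "\<exists>x y. \<bar>x - a\<bar> < h \<and> \<bar>y - b\<bar> < h \<and>
    v (a + h) (b + h) - v (a + h) b - v a (b + h) + v a b = h * h * vxy x y"
proof -
  have "\<exists>x>a. x < a + h \<and> (v (a + h) (b + h) - v (a + h) b) - (v a (b + h) - v a b)
      = (a + h - a) * (vx x (b + h) - vx x b)"
    using h by (intro MVT2) (auto intro!: derivative_eq_intros dx)
  then obtain x where x: "a < x" "x < a + h"
    "(v (a + h) (b + h) - v (a + h) b) - (v a (b + h) - v a b) = h * (vx x (b + h) - vx x b)" by auto
  have "\<exists>y>b. y < b + h \<and> vx x (b + h) - vx x b = (b + h - b) * vxy x y"
    using h x by (intro MVT2) (auto intro!: dxy)
  then obtain y where y: "b < y" "y < b + h" "vx x (b + h) - vx x b = h * vxy x y" by auto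
  have "v (a + h) (b + h) - v (a + h) b - v a (b + h) + v a b = h * (h * vxy x y)"
    using x(3) y(3) by simp
  then show ?thesis using x y by (intro exI[of _ x] exI[of _ y]) (auto simp: mult.assoc)
qed

text \<open>The second difference over a square of side h is symmetric in the two variables.
  Applying the mean value theorem twice, in either order, makes it h^2 times one or the other mixed
  partial at points near (a, b); continuity at (a, b) then forces equality.\<close>

lemma mixed_partials_commute:
  fixes v vx vy vxy vyx :: "real \<Rightarrow> real \<Rightarrow> real"
  assumes r: "r > 0"
    and dx: "\<And>x y. \<bar>x - a\<bar> < r \<Longrightarrow> \<bar>y - b\<bar> < r \<Longrightarrow> ((\<lambda>x. v x y) has_real_derivative vx x y) (at x)"
    and dy: "\<And>x y. \<bar>x - a\<bar> < r \<Longrightarrow> \<bar>y - b\<bar> < r \<Longrightarrow> ((\<lambda>y. v x y) has_real_derivative vy x y) (at y)"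
    and dxy: "\<And>x y. \<bar>x - a\<bar> < r \<Longrightarrow> \<bar>y - b\<bar> < r \<Longrightarrow> ((\<lambda>y. vx x y) has_real_derivative vxy x y) (at y)"
    and dyx: "\<And>x y. \<bar>x - a\<bar> < r \<Longrightarrow> \<bar>y - b\<bar> < r \<Longrightarrow> ((\<lambda>x. vy x y) has_real_derivative vyx x y) (at x)"
    and cxy: "\<And>e. e > 0 \<Longrightarrow> \<exists>d>0. \<forall>x y. \<bar>x - a\<bar> < d \<longrightarrow> \<bar>y - b\<bar> < d \<longrightarrow> \<bar>vxy x y - vxy a b\<bar> < e"
    and cyx: "\<And>e. e > 0 \<Longrightarrow> \<exists>d>0. \<forall>x y. \<bar>x - a\<bar> < d \<longrightarrow> \<bar>y - b\<bar> < d \<longrightarrow> \<bar>vyx x y - vyx a b\<bar> < e"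
  shows "vxy a b = vyx a b"
proof (rule ccontr)
  assume "vxy a b \<noteq> vyx a b"
  then have e: "\<bar>vxy a b - vyx a b\<bar> / 2 > 0" by simp
  obtain d1 where d1: "d1 > 0" "\<And>x y. \<bar>x - a\<bar> < d1 \<Longrightarrow> \<bar>y - b\<bar> < d1 \<Longrightarrow> \<bar>vxy x y - vxy a b\<bar> < \<bar>vxy a b - vyx a b\<bar> / 2"
    using cxy[OF e] by blast
  obtain d2 where d2: "d2 > 0" "\<And>x y. \<bar>x - a\<bar> < d2 \<Longrightarrow> \<bar>y - b\<bar> < d2 \<Longrightarrow> \<bar>vyx x y - vyx a b\<bar> < \<bar>vxy a b - vyx a b\<bar> / 2"
    using cyx[OF e] by blast
  define h where "h = min (r / 2) (min d1 d2)"
  have h: "0 < h" "h < r" "h \<le> d1" "h \<le> d2" using r d1(1) d2(1) by (auto simp: h_def min_def)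
  obtain x y where xy: "\<bar>x - a\<bar> < h" "\<bar>y - b\<bar> < h"
    "v (a + h) (b + h) - v (a + h) b - v a (b + h) + v a b = h * h * vxy x y"
    using mixed_difference_mean_value[where v = v and vx = vx and vxy = vxy, OF h(1,2) dx dxy] by blast
  obtain y' x' where xy': "\<bar>y' - b\<bar> < h" "\<bar>x' - a\<bar> < h"
    "v (a + h) (b + h) - v a (b + h) - v (a + h) b + v a b = h * h * vyx x' y'"
    using mixed_difference_mean_value[where v = "\<lambda>y x. v x y" and vx = "\<lambda>y x. vy x y" and vxy = "\<lambda>y x. vyx x y", OF h(1,2) dy dyx] by blast
  have "h * h * vxy x y = h * h * vyx x' y'" using xy(3) xy'(3) by linarith
  then have "vxy x y = vyx x' y'" using h(1) by simp
  moreover have "\<bar>vxy x y - vxy a b\<bar> < \<bar>vxy a b - vyx a b\<bar> / 2" using xy h by (intro d1(2)) auto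
  moreover have "\<bar>vyx x' y' - vyx a b\<bar> < \<bar>vxy a b - vyx a b\<bar> / 2" using xy' h by (intro d2(2)) auto
  ultimately show False by (simp add: abs_if split: if_splits)
qed

section \<open>From partial derivatives to a holomorphic function\<close>

lemma has_real_derivative_partial_deriv:
  assumes "(\<lambda>t. u (z + t *\<^sub>R b)) differentiable (at 0)"
  shows "((\<lambda>s. u (z + (s - s0) *\<^sub>R b)) has_real_derivative partial_deriv b u z) (at s0)"
proof -
  have "((\<lambda>t. u (z + t *\<^sub>R b)) has_real_derivative partial_deriv b u z) (at (s0 - s0))"
    using assms unfolding partial_deriv_def by (simp add: DERIV_deriv_iff_real_differentiable)
  moreover have "((\<lambda>s. s - s0) has_real_derivative 1) (at s0)" by (auto intro!: derivative_eq_intros)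
  ultimately have "((\<lambda>s. u (z + (s - s0) *\<^sub>R b)) has_real_derivative partial_deriv b u z * 1) (at s0)"
    by (rule DERIV_chain2)
  then show ?thesis by simp
qed

lemma complex_line_derivs:
  assumes "\<And>b. b \<in> Basis \<Longrightarrow> (\<lambda>t. u (Complex x y + t *\<^sub>R b)) differentiable (at 0)"
  shows "((\<lambda>x. u (Complex x y)) has_real_derivative partial_deriv 1 u (Complex x y)) (at x)"
    and "((\<lambda>y. u (Complex x y)) has_real_derivative partial_deriv \<i> u (Complex x y)) (at y)"
proof -
  have "Complex x y + (s - x) *\<^sub>R 1 = Complex s y" "Complex x y + (s - y) *\<^sub>R \<i> = Complex x s" for s
    by (simp_all add: complex_eq_iff)
  then show "((\<lambda>x. u (Complex x y)) has_real_derivative partial_deriv 1 u (Complex x y)) (at x)"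
    and "((\<lambda>y. u (Complex x y)) has_real_derivative partial_deriv \<i> u (Complex x y)) (at y)"
    using has_real_derivative_partial_deriv[OF assms[of 1], of x]
      has_real_derivative_partial_deriv[OF assms[of \<i>], of y]
    by (simp_all add: Basis_complex_def)
qed

lemma square_in_open:
  fixes S :: "complex set"
  assumes "open S" "z \<in> S"
  obtains r where "r > 0" "\<And>x y. \<bar>x - Re z\<bar> < r \<Longrightarrow> \<bar>y - Im z\<bar> < r \<Longrightarrow> Complex x y \<in> S"
proof -
  obtain e where e: "e > 0" "ball z e \<subseteq> S" using assms openE by blast
  show thesis
  proof (rule that[of "e / 2"])
    fix x y assume xy: "\<bar>x - Re z\<bar> < e / 2" "\<bar>y - Im z\<bar> < e / 2"
    have "dist z (Complex x y) \<le> \<bar>Re z - x\<bar> + \<bar>Im z - y\<bar>"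
      using cmod_le[of "z - Complex x y"] by (simp add: dist_norm)
    then have "dist z (Complex x y) < e" using xy by linarith
    then show "Complex x y \<in> S" using e(2) by auto
  qed (use e in simp)
qed

lemma has_derivative_of_continuous_partials:
  fixes u :: "complex \<Rightarrow> real"
  assumes S: "open S" and z: "z \<in> S"
    and diff: "\<And>b z. b \<in> Basis \<Longrightarrow> z \<in> S \<Longrightarrow> (\<lambda>t. u (z + t *\<^sub>R b)) differentiable (at 0)"
    and cont: "continuous_on S (partial_deriv \<i> u)"
  shows "(u has_derivative (\<lambda>h. partial_deriv 1 u z * Re h + partial_deriv \<i> u z * Im h)) (at z)"
proof -
  obtain r where r: "r > 0" "\<And>x y. \<bar>x - Re z\<bar> < r \<Longrightarrow> \<bar>y - Im z\<bar> < r \<Longrightarrow> Complex x y \<in> S"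
    using square_in_open[OF S z] by blast
  define X where "X = ball (Re z) r"
  define Y where "Y = ball (Im z) r"
  have inS: "Complex x y \<in> S" if "x \<in> X" "y \<in> Y" for x y
    using that r(2) by (auto simp: X_def Y_def dist_real_def abs_minus_commute)
  have zXY: "Re z \<in> X" "Im z \<in> Y" using r(1) by (auto simp: X_def Y_def)
  have "((\<lambda>(x, y). u (Complex x y)) has_derivative
     (\<lambda>(tx, ty). partial_deriv 1 u (Complex (Re z) (Im z)) * tx
        + blinfun_mult_right (partial_deriv \<i> u (Complex (Re z) (Im z))) ty)) (at (Re z, Im z) within X \<times> Y)"
  proof (rule has_derivative_partialsI)
    show "((\<lambda>x. u (Complex x (Im z))) has_derivative (*) (partial_deriv 1 u (Complex (Re z) (Im z)))) (at (Re z) within X)"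
      using complex_line_derivs(1)[of u "Re z" "Im z"] diff z
      by (auto simp: has_field_derivative_def intro: has_derivative_at_withinI)
    fix x y assume "x \<in> X" "y \<in> Y"
    then show "((\<lambda>y. u (Complex x y)) has_derivative blinfun_mult_right (partial_deriv \<i> u (Complex x y))) (at y within Y)"
      using complex_line_derivs(2)[of u x y] diff inS
      by (auto simp: has_field_derivative_def intro: has_derivative_at_withinI)
  next
    have "continuous_on (X \<times> Y) (\<lambda>p. partial_deriv \<i> u (Complex (fst p) (snd p)))"
    proof (rule continuous_on_compose2[OF cont])
      show "continuous_on (X \<times> Y) (\<lambda>p. Complex (fst p) (snd p))"
        unfolding Complex_eq by (intro continuous_intros)
    qed (auto intro: inS)
    \<comment> \<open>\<open>has_derivative_partialsI\<close> asks for continuity of the second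
      partial as a bounded linear map, in the operator norm.\<close>
    then have "continuous_on (X \<times> Y) (\<lambda>p. blinfun_mult_right (partial_deriv \<i> u (Complex (fst p) (snd p))))"
      by (rule bounded_linear.continuous_on[OF bounded_linear_blinfun_mult_right])
    then show "continuous (at (Re z, Im z) within X \<times> Y) (\<lambda>(x, y). blinfun_mult_right (partial_deriv \<i> u (Complex x y)))"
      using zXY by (simp add: continuous_on_eq_continuous_within case_prod_beta')
  qed (auto simp: Y_def r)
  then have "((\<lambda>(x, y). u (Complex x y)) has_derivative
     (\<lambda>(tx, ty). partial_deriv 1 u z * tx + partial_deriv \<i> u z * ty)) (at (Re z, Im z))"
    using at_within_open[of "(Re z, Im z)" "X \<times> Y"] zXY by (simp add: X_def Y_def open_Times)
  then have "((\<lambda>w. (\<lambda>(x, y). u (Complex x y)) (Re w, Im w)) has_derivative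
     (\<lambda>h. (\<lambda>(tx, ty). partial_deriv 1 u z * tx + partial_deriv \<i> u z * ty) (Re h, Im h))) (at z)"
    by (rule has_derivative_compose[rotated]) (auto intro!: derivative_eq_intros)
  then show ?thesis by simp
qed

lemma mixed_partial_derivs_commute:
  fixes u :: "complex \<Rightarrow> real"
  assumes S: "open S" and z: "z \<in> S" and C2: "Ck_on 2 S u"
  shows "partial_deriv \<i> (partial_deriv 1 u) z = partial_deriv 1 (partial_deriv \<i> u) z"
proof -
  have B: "(1::complex) \<in> Basis" "\<i> \<in> Basis" by (auto simp: Basis_complex_def)
  have D1: "\<And>b z. b \<in> Basis \<Longrightarrow> z \<in> S \<Longrightarrow> (\<lambda>t. u (z + t *\<^sub>R b)) differentiable (at 0)"
    and D2: "\<And>c b z. c \<in> Basis \<Longrightarrow> b \<in> Basis \<Longrightarrow> z \<in> S \<Longrightarrow> (\<lambda>t. partial_deriv c u (z + t *\<^sub>R b)) differentiable (at 0)"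
    and C: "\<And>c b. c \<in> Basis \<Longrightarrow> b \<in> Basis \<Longrightarrow> continuous_on S (partial_deriv b (partial_deriv c u))"
    using C2 by (auto simp: numeral_2_eq_2)
  obtain r where r: "r > 0" "\<And>x y. \<bar>x - Re z\<bar> < r \<Longrightarrow> \<bar>y - Im z\<bar> < r \<Longrightarrow> Complex x y \<in> S"
    using square_in_open[OF S z] by blast
  have near: "\<exists>d>0. \<forall>x y. \<bar>x - Re z\<bar> < d \<longrightarrow> \<bar>y - Im z\<bar> < d \<longrightarrow> \<bar>w (Complex x y) - w (Complex (Re z) (Im z))\<bar> < e"
    if w: "continuous_on S w" and e: "e > 0" for w :: "complex \<Rightarrow> real" and e
  proof -
    have "open (S \<inter> w -` ball (w z) e)" by (intro continuous_open_preimage w S) auto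
    moreover have "z \<in> S \<inter> w -` ball (w z) e" using z e by simp
    ultimately obtain d where "d > 0" "\<And>x y. \<bar>x - Re z\<bar> < d \<Longrightarrow> \<bar>y - Im z\<bar> < d \<Longrightarrow> Complex x y \<in> S \<inter> w -` ball (w z) e"
      using square_in_open by metis
    then show ?thesis by (intro exI[of _ d]) (auto simp: dist_real_def abs_minus_commute)
  qed
  have "(\<lambda>x y. partial_deriv \<i> (partial_deriv 1 u) (Complex x y)) (Re z) (Im z)
      = (\<lambda>x y. partial_deriv 1 (partial_deriv \<i> u) (Complex x y)) (Re z) (Im z)"
  proof (rule mixed_partials_commute[where r = r and v = "\<lambda>x y. u (Complex x y)"
        and vx = "\<lambda>x y. partial_deriv 1 u (Complex x y)" and vy = "\<lambda>x y. partial_deriv \<i> u (Complex x y)"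
        and vxy = "\<lambda>x y. partial_deriv \<i> (partial_deriv 1 u) (Complex x y)"
        and vyx = "\<lambda>x y. partial_deriv 1 (partial_deriv \<i> u) (Complex x y)"])
    fix x y assume "\<bar>x - Re z\<bar> < r" "\<bar>y - Im z\<bar> < r"
    then have inS: "Complex x y \<in> S" by (rule r(2))
    show "((\<lambda>x. u (Complex x y)) has_real_derivative partial_deriv 1 u (Complex x y)) (at x)"
      "((\<lambda>y. u (Complex x y)) has_real_derivative partial_deriv \<i> u (Complex x y)) (at y)"
      using complex_line_derivs[of u x y] D1 inS by auto
    show "((\<lambda>y. partial_deriv 1 u (Complex x y)) has_real_derivative partial_deriv \<i> (partial_deriv 1 u) (Complex x y)) (at y)"
      using complex_line_derivs(2)[of "partial_deriv 1 u" x y] D2 B inS by auto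
    show "((\<lambda>x. partial_deriv \<i> u (Complex x y)) has_real_derivative partial_deriv 1 (partial_deriv \<i> u) (Complex x y)) (at x)"
      using complex_line_derivs(1)[of "partial_deriv \<i> u" x y] D2 B inS by auto
  qed (use r(1) near C B in auto)
  then show ?thesis by simp
qed

text \<open>The function u_x - i u_y satisfies the Cauchy-Riemann equations: one is Laplace's
  equation, the other the symmetry of the mixed partials. A ball is convex, so it has a primitive
  there, and the real part of the primitive has the same gradient as \<open>u\<close>.\<close>

lemma harmonic_on_ball_eq_Re_holomorphic:
  assumes u: "harmonic_on (ball a r) u"
  obtains G where "G holomorphic_on ball a r" "\<And>z. z \<in> ball a r \<Longrightarrow> u z = Re (G z)"
proof -
  define S where "S = ball a r"
  have S: "open S" "convex S" by (auto simp: S_def)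
  have C2: "Ck_on 2 S u" and lap: "\<And>z. z \<in> S \<Longrightarrow> laplacian u z = 0" using u by (auto simp: harmonic_on_def S_def)
  have B: "(1::complex) \<in> Basis" "\<i> \<in> Basis" by (auto simp: Basis_complex_def)
  define ux where "ux = partial_deriv 1 u"
  define uy where "uy = partial_deriv \<i> u"
  have D1: "\<And>b z. b \<in> Basis \<Longrightarrow> z \<in> S \<Longrightarrow> (\<lambda>t. u (z + t *\<^sub>R b)) differentiable (at 0)"
    and D2: "\<And>c b z. c \<in> Basis \<Longrightarrow> b \<in> Basis \<Longrightarrow> z \<in> S \<Longrightarrow> (\<lambda>t. partial_deriv c u (z + t *\<^sub>R b)) differentiable (at 0)"
    and C1: "\<And>c. c \<in> Basis \<Longrightarrow> continuous_on S (partial_deriv c u)"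
    and C2': "\<And>c b. c \<in> Basis \<Longrightarrow> b \<in> Basis \<Longrightarrow> continuous_on S (partial_deriv b (partial_deriv c u))"
    using C2 by (auto simp: numeral_2_eq_2)
  define g where "g = (\<lambda>z. of_real (ux z) - \<i> * of_real (uy z))"
  have "g holomorphic_on S"
    unfolding holomorphic_on_open[OF S(1)]
  proof
    fix z assume z: "z \<in> S"
    define p q where "p = partial_deriv 1 ux z" and "q = partial_deriv \<i> ux z"
    have sym: "partial_deriv 1 uy z = q"
      using mixed_partial_derivs_commute[OF S(1) z C2] by (simp add: q_def ux_def uy_def)
    have "partial_deriv 1 ux z + partial_deriv \<i> uy z = 0"
      using lap[OF z] by (simp add: laplacian_def Basis_complex_def ux_def uy_def)
    then have uyy: "partial_deriv \<i> uy z = - p" by (simp add: p_def)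
    have dux: "(ux has_derivative (\<lambda>h. p * Re h + q * Im h)) (at z)"
      unfolding p_def q_def ux_def using D2 C2' B z
      by (intro has_derivative_of_continuous_partials[OF S(1)]) auto
    have "(uy has_derivative (\<lambda>h. partial_deriv 1 uy z * Re h + partial_deriv \<i> uy z * Im h)) (at z)"
      unfolding uy_def using D2 C2' B z
      by (intro has_derivative_of_continuous_partials[OF S(1)]) auto
    then have duy: "(uy has_derivative (\<lambda>h. q * Re h + (- p) * Im h)) (at z)" unfolding sym uyy .
    have "(g has_derivative (\<lambda>h. of_real (p * Re h + q * Im h) - \<i> * of_real (q * Re h + (- p) * Im h))) (at z)"
      unfolding g_def by (intro has_derivative_diff has_derivative_mult_right has_derivative_of_real dux duy)
    moreover have "(\<lambda>h. of_real (p * Re h + q * Im h) - \<i> * of_real (q * Re h + (- p) * Im h)) = (*) (Complex p (- q))"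
      by (auto simp: complex_eq_iff)
    ultimately have "(g has_field_derivative Complex p (- q)) (at z)" by (simp add: has_field_derivative_def)
    then show "\<exists>f'. (g has_field_derivative f') (at z)" ..
  qed
  then obtain G where G: "\<And>z. z \<in> S \<Longrightarrow> (G has_field_derivative g z) (at z within S)"
    using holomorphic_convex_primitive'[OF S(2,1)] by blast
  have "\<exists>c. \<forall>z\<in>S. u z - Re (G z) = c"
  proof (rule has_derivative_zero_constant[OF S(2)])
    fix z assume z: "z \<in> S"
    have "(u has_derivative (\<lambda>h. ux z * Re h + uy z * Im h)) (at z within S)"
      unfolding ux_def uy_def using D1 C1 B z
      by (intro has_derivative_at_withinI[OF has_derivative_of_continuous_partials[OF S(1)]]) auto
    moreover have "(G has_derivative (*) (g z)) (at z within S)"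
      using G[OF z] by (simp add: has_field_derivative_def)
    then have "((\<lambda>z. Re (G z)) has_derivative (\<lambda>h. Re (g z * h))) (at z within S)"
      by (rule has_derivative_Re)
    ultimately have "((\<lambda>z. u z - Re (G z)) has_derivative (\<lambda>h. ux z * Re h + uy z * Im h - Re (g z * h))) (at z within S)"
      by (rule has_derivative_diff)
    moreover have "(\<lambda>h. ux z * Re h + uy z * Im h - Re (g z * h)) = (\<lambda>h. 0)"
      by (auto simp: g_def)
    ultimately show "((\<lambda>z. u z - Re (G z)) has_derivative (\<lambda>h. 0)) (at z within S)" by simp
  qed
  then obtain c where c: "\<And>z. z \<in> S \<Longrightarrow> u z - Re (G z) = c" by blast
  show thesis
  proof (rule that[of "\<lambda>z. G z + of_real c"])
    have "G holomorphic_on S" using G by (auto simp: holomorphic_on_def field_differentiable_def)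
    then show "(\<lambda>z. G z + of_real c) holomorphic_on ball a r" unfolding S_def by (intro holomorphic_intros)
    show "u z = Re (G z + of_real c)" if "z \<in> ball a r" for z
      using c[of z] that by (simp add: S_def)
  qed
qed

section \<open>Minimum principles\<close>

lemma eventually_Re_ge_if_isCont:
  assumes "isCont F \<zeta>" "Re (F \<zeta>) \<ge> 0" "e > 0"
  shows "\<forall>\<^sub>F z in at \<zeta> within S. - e \<le> Re (F z)"
proof -
  have "((\<lambda>z. Re (F z)) \<longlongrightarrow> Re (F \<zeta>)) (at \<zeta> within S)"
    using continuous_at_imp_continuous_at_within[OF assms(1)]
    by (intro tendsto_intros) (simp add: continuous_within)
  then have "\<forall>\<^sub>F z in at \<zeta> within S. - e < Re (F z)"
    using assms(2,3) by (intro order_tendstoD(1)) auto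
  then show ?thesis by eventually_elim simp
qed

text \<open>\<open>F\<close> need not extend to the frontier, so the maximum principle is applied on
  the sublevel set \<open>T\<close>. By the frontier condition with e/2, no frontier point of
  \<open>S\<close> is a limit of points of \<open>T\<close>; hence \<open>T\<close> is compact in
  \<open>S\<close>, and \<open>- Re (F z)\<close> is at most \<open>e\<close> on its
  frontier.\<close>

lemma Re_min_principle:
  assumes hol: "F holomorphic_on S" and S: "open S" "bounded S"
    and fr: "\<And>\<zeta> e. \<zeta> \<in> frontier S \<Longrightarrow> e > 0 \<Longrightarrow> \<forall>\<^sub>F z in at \<zeta> within S. - e \<le> Re (F z)"
    and z0: "z0 \<in> S"
  shows "0 \<le> Re (F z0)"
proof (rule ccontr)
  assume neg: "\<not> 0 \<le> Re (F z0)"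
  \<comment> \<open>Half of the depth at \<open>z0\<close>: the maximum principle gives
    \<open>- Re (F z0)\<close> at most \<open>e\<close>, whereas it equals 2e.\<close>
  define e where "e = - Re (F z0) / 2"
  have e: "e > 0" using neg by (simp add: e_def)
  define T where "T = {z\<in>S. Re (F z) \<le> - e}"
  have contF: "continuous_on S F"
    using hol by (rule holomorphic_on_imp_continuous_on)
  have TS: "T \<subseteq> S" by (auto simp: T_def)
  have clT: "closure T \<subseteq> T"
  proof
    fix \<zeta> assume \<zeta>: "\<zeta> \<in> closure T"
    show "\<zeta> \<in> T"
    proof (cases "\<zeta> \<in> S")
      case True
      have "closedin (top_of_set S) (S \<inter> (\<lambda>z. Re (F z)) -` {..-e})"
        by (intro continuous_closedin_preimage continuous_intros contF)
      then obtain C where C: "closed C" "S \<inter> (\<lambda>z. Re (F z)) -` {..-e} = S \<inter> C"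
        unfolding closedin_closed by blast
      have "T = S \<inter> C" using C(2) by (auto simp: T_def)
      then have "\<zeta> \<in> C" using \<zeta> C(1)
        by (metis closure_minimal inf_le2 subsetD)
      then show ?thesis using True \<open>T = S \<inter> C\<close> by auto
    next
      case False
      have "\<zeta> \<in> closure S" using \<zeta> TS closure_mono by blast
      then have "\<zeta> \<in> frontier S" using False S(1) by (simp add: frontier_def interior_open)
      then have "\<forall>\<^sub>F z in at \<zeta> within S. - (e/2) \<le> Re (F z)" using fr e by simp
      then obtain d where d: "d > 0" "\<And>z. z \<in> S \<Longrightarrow> z \<noteq> \<zeta> \<Longrightarrow> dist z \<zeta> < d \<Longrightarrow> - (e/2) \<le> Re (F z)"
        unfolding eventually_at by auto
      obtain z where "z \<in> T" "dist z \<zeta> < d"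
        using \<zeta> d(1) by (auto simp: closure_approachable)
      then show ?thesis using d(2)[of z] False e by (auto simp: T_def)
    qed
  qed
  have "Re (- F z0) \<le> e"
  proof (rule maximum_real_frontier[of "\<lambda>z. - F z" T])
    show "(\<lambda>z. - F z) holomorphic_on interior T"
      using hol TS interior_subset by (blast intro: holomorphic_on_subset holomorphic_intros)
    show "continuous_on (closure T) (\<lambda>z. - F z)"
      using contF clT TS by (blast intro: continuous_on_subset continuous_intros)
    show "bounded T" using S(2) TS bounded_subset by blast
    show "z0 \<in> T" using z0 e by (simp add: T_def e_def)
    fix z assume z: "z \<in> frontier T"
    then have zT: "z \<in> T" using clT by (auto simp: frontier_def)
    show "Re (- F z) \<le> e"
    proof (rule ccontr)
      assume "\<not> Re (- F z) \<le> e"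
      then have "z \<in> S \<inter> (\<lambda>z. Re (F z)) -` {..<-e}" using zT TS by auto
      moreover have "open (S \<inter> (\<lambda>z. Re (F z)) -` {..<-e})"
        by (intro continuous_open_preimage continuous_intros contF S)
      moreover have "S \<inter> (\<lambda>z. Re (F z)) -` {..<-e} \<subseteq> T" by (auto simp: T_def)
      ultimately have "z \<in> interior T" by (meson interiorI)
      then show False using z by (simp add: frontier_def)
    qed
  qed
  then show False using e by (simp add: e_def)
qed

lemma Re_inverse_square:
  "Re (1 / w^2) = ((Re w)^2 - (Im w)^2) / ((Re w)^2 + (Im w)^2)^2"
proof -
  have "Re (1 / w^2) = Re (w^2) / (cmod (w^2))^2"
    by (simp add: Re_divide cmod_power2)
  also have "(cmod (w^2))^2 = ((Re w)^2 + (Im w)^2)^2"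
    by (simp add: norm_power cmod_power2 flip: power_mult)
  also have "Re (w^2) = (Re w)^2 - (Im w)^2" by (simp add: power2_eq_square)
  finally show ?thesis .
qed

section \<open>Explicit comparison functions on a triangle and a box\<close>

text \<open>On the isosceles triangle over $[x_1-t,x_1+t]$ with base angles of tangent $1/2$, the inverse
  squares centred at the two base vertices have positive real part comparable to $y^{-2}$ on the
  slanted sides, since those angles are below $\pi/4$. So the non-integrable majorant
  $\sigma y^{-2}$ still gives a bound at interior points.\<close>
lemma bottom_growth_bound:
  fixes F :: "complex \<Rightarrow> complex" and x1 t \<sigma> :: real
  assumes hol: "F holomorphic_on {z. Im z > 0}" and t: "t > 0" and s: "\<sigma> \<ge> 0"
    and growth: "\<And>z. 0 < Im z \<Longrightarrow> Im z < t \<Longrightarrow> - \<sigma> / (Im z)^2 \<le> Re (F z)"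
    and bot: "\<And>x e. \<bar>x - x1\<bar> \<le> t \<Longrightarrow> e > 0 \<Longrightarrow>
               \<forall>\<^sub>F z in at (of_real x) within {z. Im z > 0}. - e \<le> Re (F z)"
    and z1: "Re z1 = x1" "0 < Im z1" "2 * Im z1 < t"
  shows "- (18 * \<sigma> / t^2) \<le> Re (F z1)"
proof -
  define T where "T = {z. 0 < Im z \<and> \<bar>Re z - x1\<bar> + 2 * Im z < t}"
  define V :: "complex \<Rightarrow> complex" where
    "V = (\<lambda>z. 1 / (z - of_real (x1 - t))^2 + 1 / (of_real (x1 + t) - z)^2)"
  \<comment> \<open>On a slanted side at height y, one of the two squared numbers is (2y + iy)^2 or
    its conjugate. Its inverse has real part 3/(25 y^2), and 9 is the least integer factor that
    lifts this to y^-2.\<close>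
  define K where "K = (\<lambda>z. F z + of_real (9 * \<sigma>) * V z)"
  have V1: "0 \<le> Re (1 / (z - of_real (x1 - t))^2)" "0 \<le> Re (1 / (of_real (x1 + t) - z)^2)"
    if "0 \<le> Im z" "\<bar>Re z - x1\<bar> + 2 * Im z \<le> t" for z
  proof -
    have "(Im z)^2 \<le> (Re z - (x1 - t))^2" "(Im z)^2 \<le> (x1 + t - Re z)^2"
      using that by (auto intro!: power_mono)
    then show "0 \<le> Re (1 / (z - of_real (x1 - t))^2)" "0 \<le> Re (1 / (of_real (x1 + t) - z)^2)"
      unfolding Re_inverse_square by auto
  qed
  have V0: "0 \<le> Re (V z)" if "0 \<le> Im z" "\<bar>Re z - x1\<bar> + 2 * Im z \<le> t" for z
    using V1[OF that] by (simp add: V_def)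
  have side: "1 / (Im z)^2 \<le> 9 * Re (V z)" if "0 < Im z" "\<bar>Re z - x1\<bar> + 2 * Im z = t" for z
  proof -
    have calc: "((2 * y)^2 - y^2) / ((2 * y)^2 + y^2)^2 = 3 / 25 / y^2" if "y > 0" for y :: real
      using that by (simp add: power2_eq_square field_simps)
    have "3/25 / (Im z)^2 \<le> Re (V z)"
    proof (cases "Re z \<ge> x1")
      case True
      then have "Re (of_real (x1 + t) - z) = 2 * Im z" using that by auto
      then have "Re (1 / (of_real (x1 + t) - z)^2) = 3/25 / (Im z)^2"
        unfolding Re_inverse_square using calc[OF that(1)] by simp
      then show ?thesis using V1(1)[of z] that by (simp add: V_def)
    next
      case False
      then have "Re (z - of_real (x1 - t)) = 2 * Im z" using that by auto
      then have "Re (1 / (z - of_real (x1 - t))^2) = 3/25 / (Im z)^2"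
        unfolding Re_inverse_square using calc[OF that(1)] by simp
      then show ?thesis using V1(2)[of z] that by (simp add: V_def)
    qed
    moreover have "1 / (Im z)^2 > 0" using that by simp
    ultimately show ?thesis by (simp add: field_simps)
  qed
  have UH: "open {z. Im z > 0}" by (simp add: open_halfspace_Im_gt)
  have openT: "open T" unfolding T_def
    by (intro open_Collect_conj open_Collect_less continuous_intros)
  have ne: "z \<noteq> of_real (x1 - t)" "z \<noteq> of_real (x1 + t)" if "0 < Im z" for z
    using that by auto
  have holK: "K holomorphic_on {z. Im z > 0}"
    unfolding K_def V_def using ne by (intro holomorphic_intros hol) auto
  have clT: "closure T \<subseteq> {z. 0 \<le> Im z \<and> \<bar>Re z - x1\<bar> + 2 * Im z \<le> t}"
    by (rule closure_minimal) (auto simp: T_def intro!: closed_Collect_conj closed_Collect_le continuous_intros)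
  have "0 \<le> Re (K z1)"
  proof (rule Re_min_principle[of K T])
    show "K holomorphic_on T"
      by (rule holomorphic_on_subset[OF holK]) (auto simp: T_def)
    show "bounded T"
    proof (rule boundedI)
      fix z assume "z \<in> T"
      then have "\<bar>Re z\<bar> \<le> \<bar>x1\<bar> + t" "\<bar>Im z\<bar> \<le> t" by (auto simp: T_def)
      then show "norm z \<le> \<bar>x1\<bar> + 2 * t" using cmod_le[of z] by linarith
    qed
    show "z1 \<in> T" using z1 by (simp add: T_def)
    fix \<zeta> and e :: real assume \<zeta>: "\<zeta> \<in> frontier T" and e: "e > 0"
    have \<zeta>1: "0 \<le> Im \<zeta>" "\<bar>Re \<zeta> - x1\<bar> + 2 * Im \<zeta> \<le> t" "\<zeta> \<notin> T"
      using \<zeta> clT openT by (auto simp: frontier_def interior_open)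
    show "\<forall>\<^sub>F z in at \<zeta> within T. - e \<le> Re (K z)"
    proof (cases "Im \<zeta> = 0")
      case True
      then have \<zeta>r: "\<zeta> = of_real (Re \<zeta>)" by (simp add: complex_eq_iff)
      \<comment> \<open>On the base, including both vertices where \<open>V\<close> is singular, it
        is enough that \<open>Re (V z)\<close> is nonnegative inside \<open>T\<close>.\<close>
      have "\<forall>\<^sub>F z in at (of_real (Re \<zeta>)) within {z. Im z > 0}. - e \<le> Re (F z)"
        using bot[OF _ e] \<zeta>1 True by simp
      then have "\<forall>\<^sub>F z in at \<zeta> within T. - e \<le> Re (F z)"
        unfolding \<zeta>r[symmetric]
        by (rule filter_leD[OF at_le, rotated]) (auto simp: T_def)
      moreover have "\<forall>\<^sub>F z in at \<zeta> within T. z \<in> T" by (simp add: eventually_at_filter)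
      ultimately show ?thesis
      proof eventually_elim
        case (elim z)
        then have "0 \<le> 9 * \<sigma> * Re (V z)" using V0[of z] s by (auto simp: T_def)
        then show ?case using elim by (simp add: K_def)
      qed
    next
      case False
      then have im: "Im \<zeta> > 0" using \<zeta>1 by simp
      then have eq: "\<bar>Re \<zeta> - x1\<bar> + 2 * Im \<zeta> = t" using \<zeta>1 by (auto simp: T_def)
      have "- \<sigma> / (Im \<zeta>)^2 \<le> Re (F \<zeta>)" using growth[of \<zeta>] im eq by auto
      moreover have "\<sigma> * (1 / (Im \<zeta>)^2) \<le> \<sigma> * (9 * Re (V \<zeta>))"
        using side[OF im eq] s by (intro mult_left_mono)
      ultimately have "0 \<le> Re (K \<zeta>)" by (simp add: K_def)
      moreover have "isCont K \<zeta>"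
        using holK UH im by (metis continuous_on_eq_continuous_at holomorphic_on_imp_continuous_on mem_Collect_eq)
      ultimately show ?thesis using e by (intro eventually_Re_ge_if_isCont)
    qed
  qed (fact openT)
  then have "- (9 * \<sigma> * Re (V z1)) \<le> Re (F z1)" by (simp add: K_def)
  \<comment> \<open>Above the midpoint both vertices are at horizontal distance \<open>t\<close>, so
    each summand is at most 1/t^2; this gives 18 = 9 * 2.\<close>
  moreover have "Re (V z1) \<le> 2 / t^2"
  proof -
    have "(t^2 - (Im z1)^2) / (t^2 + (Im z1)^2)^2 \<le> t^2 / (t^2)^2"
      using t z1 by (intro frac_le power_mono) auto
    also have "\<dots> = 1 / t^2" by (simp add: power2_eq_square)
    finally have le: "(t^2 - (Im z1)^2) / (t^2 + (Im z1)^2)^2 \<le> 1 / t^2" .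
    have "Re (V z1) = 2 * ((t^2 - (Im z1)^2) / (t^2 + (Im z1)^2)^2)"
      unfolding V_def plus_complex.sel Re_inverse_square using z1 by simp
    also have "\<dots> \<le> 2 * (1 / t^2)" using le by (rule mult_left_mono) simp
    finally show ?thesis by simp
  qed
  then have "9 * \<sigma> * Re (V z1) \<le> 9 * \<sigma> * (2 / t^2)"
    using s by (intro mult_left_mono) auto
  ultimately show ?thesis by simp
qed

lemma Im_power2: "Im (w^2) = 2 * Re w * Im w"
  by (simp add: power2_eq_square)

lemma Re_imaginary_pole:
  "Re (\<i> / (w + \<i> * of_real s)) = (Im w + s) / (cmod (w + \<i> * of_real s))^2"
  by (simp add: Re_divide cmod_power2)

text \<open>A Phragmen-Lindelof principle. The growth bound is first turned into $o(|z-p|^{-2})$ near each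
  bottom corner $p$, the critical order for a right angle. Then the quarter discs of radius $\rho$
  around the corners are cut off, and the poles just below the images of the corners under the squaring
  maps \<open>Wa\<close>, \<open>Wb\<close> serve as comparison functions whose values at a fixed point stay bounded as
  $\rho \to 0$.\<close>
lemma Re_nonneg_on_box:
  fixes F :: "complex \<Rightarrow> complex" and a b \<eta> :: real
  assumes hol: "F holomorphic_on {z. Im z > 0}" and ab: "a < b" and \<eta>: "0 < \<eta>"
    and growth: "\<And>\<epsilon>. \<epsilon> > 0 \<Longrightarrow> \<exists>y0>0. \<forall>z. 0 < Im z \<longrightarrow> Im z < y0 \<longrightarrow> - \<epsilon> / (Im z)^2 \<le> Re (F z)"
    and bot: "\<And>x e. a < x \<Longrightarrow> x < b \<Longrightarrow> e > 0 \<Longrightarrow>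
               \<forall>\<^sub>F z in at (of_real x) within {z. Im z > 0}. - e \<le> Re (F z)"
    and sides: "\<And>z. Re z = a \<or> Re z = b \<Longrightarrow> 0 < Im z \<Longrightarrow> Im z \<le> \<eta> \<Longrightarrow> 0 \<le> Re (F z)"
    and top: "\<And>z. a \<le> Re z \<Longrightarrow> Re z \<le> b \<Longrightarrow> Im z = \<eta> \<Longrightarrow> 0 \<le> Re (F z)"
    and z1: "a < Re z1" "Re z1 < b" "0 < Im z1" "Im z1 < \<eta>"
  shows "0 \<le> Re (F z1)"
proof -
  have corner: "\<exists>d>0. \<forall>z. a < Re z \<longrightarrow> Re z < b \<longrightarrow> 0 < Im z \<longrightarrow> cmod (z - of_real p) \<le> d \<longrightarrow>
                  - (\<tau> / (cmod (z - of_real p))^2) \<le> Re (F z)"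
    if p: "p = a \<or> p = b" and \<tau>: "\<tau> > 0" for p \<tau>
  proof -
    \<comment> \<open>With y = Im z and |z - p|^2 = s^2 + y^2, low points (4y < s) need 72 * 17/16 =
      76.5 and the others need 17; 80 covers both.\<close>
    define \<sigma> where "\<sigma> = \<tau> / 80"
    have \<sigma>: "\<sigma> > 0" using \<tau> by (simp add: \<sigma>_def)
    obtain y0 where y0: "y0 > 0" "\<And>z. 0 < Im z \<Longrightarrow> Im z < y0 \<Longrightarrow> - \<sigma> / (Im z)^2 \<le> Re (F z)"
      using growth[OF \<sigma>] by blast
    \<comment> \<open>The second bound keeps the opposite corner at horizontal distance at least
      \<open>s\<close>, so the interval of radius s/2 about Re z stays inside (a, b).\<close>
    define d where "d = min (y0 / 2) ((b - a) / 2)"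
    have d: "d > 0" "d < y0" "d \<le> (b - a) / 2"
      using y0(1) ab by (auto simp: d_def min_def field_simps)
    show ?thesis
    proof (intro exI[of _ d] conjI allI impI)
      fix z assume z: "a < Re z" "Re z < b" "0 < Im z" "cmod (z - of_real p) \<le> d"
      define s where "s = \<bar>Re z - p\<bar>"
      have s: "s > 0" using z p by (auto simp: s_def)
      have sd: "s \<le> d" "Im z \<le> d"
        using abs_Re_le_cmod[of "z - of_real p"] abs_Im_le_cmod[of "z - of_real p"] z by (auto simp: s_def)
      have n: "(cmod (z - of_real p))^2 = s^2 + (Im z)^2" by (simp add: cmod_power2 s_def)
      have n0: "s^2 + (Im z)^2 > 0" using s by (simp add: add_pos_nonneg)
      show "- (\<tau> / (cmod (z - of_real p))^2) \<le> Re (F z)"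
      \<comment> \<open>The threshold is the condition \<open>2 * Im z1 < t\<close> of
        \<open>bottom_growth_bound\<close> for t = s/2. At higher points Im z is comparable to |z -
        p|, and the growth hypothesis applies directly.\<close>
      proof (cases "4 * Im z < s")
        case True
        have "- (18 * \<sigma> / (s/2)^2) \<le> Re (F z)"
        proof (rule bottom_growth_bound[OF hol])
          fix x e :: real assume x: "\<bar>x - Re z\<bar> \<le> s/2" "e > 0"
          have "Re z - s/2 \<le> x" "x \<le> Re z + s/2" using x(1) by linarith+
          moreover have "s = Re z - a \<or> s = b - Re z" using z p by (auto simp: s_def)
          moreover have "s \<le> (b - a) / 2" using sd(1) d(3) by simp
          ultimately have "a < x \<and> x < b"
          proof (elim disjE)
            assume "s = Re z - a" "Re z - s/2 \<le> x" "x \<le> Re z + s/2" "s \<le> (b - a) / 2"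
            then show ?thesis using s by (simp add: field_simps)
          next
            assume "s = b - Re z" "Re z - s/2 \<le> x" "x \<le> Re z + s/2" "s \<le> (b - a) / 2"
            then show ?thesis using s by (simp add: field_simps)
          qed
          then show "\<forall>\<^sub>F z in at (of_real x) within {z. Im z > 0}. - e \<le> Re (F z)"
            using bot x(2) by blast
        qed (use s \<sigma> sd d y0 z True in auto)
        moreover have "18 * \<sigma> / (s/2)^2 \<le> \<tau> / (s^2 + (Im z)^2)"
        proof -
          have "(Im z)^2 \<le> (s/4)^2" using True z by (intro power_mono) auto
          then have "16 * (Im z)^2 \<le> s^2" by (simp add: power_divide)
          then have "72 * (s^2 + (Im z)^2) \<le> 80 * s^2" using zero_le_power2[of "Im z"] unfolding distrib_left by linarith
          then have "72 / s^2 \<le> 80 / (s^2 + (Im z)^2)"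
            using s n0 by (simp add: field_simps)
          then have "\<sigma> * (72 / s^2) \<le> \<sigma> * (80 / (s^2 + (Im z)^2))"
            using \<sigma> by (intro mult_left_mono) auto
          then show ?thesis by (simp add: \<sigma>_def power_divide)
        qed
        ultimately show ?thesis unfolding n by linarith
      next
        case False
        have "- \<sigma> / (Im z)^2 \<le> Re (F z)" using y0(2)[of z] z sd d by auto
        moreover have "\<sigma> / (Im z)^2 \<le> \<tau> / (s^2 + (Im z)^2)"
        proof -
          have "s^2 \<le> (4 * Im z)^2" using False s by (intro power_mono) auto
          then have "s^2 \<le> 16 * (Im z)^2" by (simp add: power_mult_distrib)
          then have "s^2 + (Im z)^2 \<le> 80 * (Im z)^2" using zero_le_power2[of "Im z"] by linarith
          then have "1 / (Im z)^2 \<le> 80 / (s^2 + (Im z)^2)"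
            using z(3) n0 by (simp add: field_simps)
          then have "\<sigma> * (1 / (Im z)^2) \<le> \<sigma> * (80 / (s^2 + (Im z)^2))"
            using \<sigma> by (intro mult_left_mono) auto
          then show ?thesis by (simp add: \<sigma>_def)
        qed
        ultimately show ?thesis unfolding n by linarith
      qed
    qed (use d in auto)
  qed
  define Wa where "Wa = (\<lambda>z::complex. (z - of_real a)^2)"
  \<comment> \<open>Seen from \<open>b\<close> the box lies in the second quadrant, which squaring
    sends to the lower half-plane; hence the sign.\<close>
  define Wb where "Wb = (\<lambda>z::complex. - ((z - of_real b)^2))"
  have ImWa: "0 \<le> Im (Wa z)" if "a \<le> Re z" "0 \<le> Im z" for z
    using that by (simp add: Wa_def Im_power2)
  have ImWb: "0 \<le> Im (Wb z)" if "Re z \<le> b" "0 \<le> Im z" for z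
    using that by (simp add: Wb_def Im_power2 mult_nonpos_nonneg)
  define Ka where "Ka = 1 / Im (Wa z1)"
  define Kb where "Kb = 1 / Im (Wb z1)"
  have pa: "0 < Im (Wa z1)" "0 < Im (Wb z1)"
    using z1 by (auto simp: Wa_def Wb_def Im_power2 mult_neg_pos)
  have main: "- (4 * \<tau> * (Ka + Kb)) \<le> Re (F z1)" if \<tau>: "\<tau> > 0" for \<tau>
  proof -
    obtain da where da: "da > 0" "\<And>z. a < Re z \<Longrightarrow> Re z < b \<Longrightarrow> 0 < Im z \<Longrightarrow>
        cmod (z - of_real a) \<le> da \<Longrightarrow> - (\<tau> / (cmod (z - of_real a))^2) \<le> Re (F z)"
      using corner[OF _ \<tau>, of a] by blast
    obtain db where db: "db > 0" "\<And>z. a < Re z \<Longrightarrow> Re z < b \<Longrightarrow> 0 < Im z \<Longrightarrow>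
        cmod (z - of_real b) \<le> db \<Longrightarrow> - (\<tau> / (cmod (z - of_real b))^2) \<le> Re (F z)"
      using corner[OF _ \<tau>, of b] by blast
    \<comment> \<open>The last bound leaves \<open>z1\<close> outside both discs that are cut off,
      whose centres are real.\<close>
    define \<rho> where "\<rho> = min (min da db) (Im z1 / 2)"
    have \<rho>: "\<rho> > 0" "\<rho> \<le> da" "\<rho> \<le> db" "\<rho> < Im z1" using da db z1 by (auto simp: \<rho>_def)
    define Q where "Q = (\<lambda>w. \<i> / (w + \<i> * of_real (\<rho>^2)))"
    have Q0: "0 \<le> Re (Q w)" if "0 \<le> Im w" for w
      unfolding Q_def Re_imaginary_pole using that by simp
    have Qbig: "1 / (4 * \<rho>^2) \<le> Re (Q w)" if "0 \<le> Im w" "cmod w = \<rho>^2" for w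
    proof -
      have "cmod (w + \<i> * of_real (\<rho>^2)) \<le> cmod w + cmod (\<i> * of_real (\<rho>^2))" by (rule norm_triangle_ineq)
      also have "\<dots> = 2 * \<rho>^2" using that by (simp add: norm_mult norm_power)
      finally have le: "(cmod (w + \<i> * of_real (\<rho>^2)))^2 \<le> (2 * \<rho>^2)^2" by (intro power_mono) auto
      have "w + \<i> * of_real (\<rho>^2) \<noteq> 0"
      proof
        assume "w + \<i> * of_real (\<rho>^2) = 0"
        then have "Im (w + \<i> * of_real (\<rho>^2)) = 0" by simp
        then show False using that(1) \<rho>(1) by (simp add: power2_eq_square) (metis add_nonneg_pos less_irrefl mult_pos_pos)
      qed
      then have "\<rho>^2 / (2 * \<rho>^2)^2 \<le> (Im w + \<rho>^2) / (cmod (w + \<i> * of_real (\<rho>^2)))^2"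
        using that(1) le by (intro frac_le) auto
      then show ?thesis using \<rho>(1) unfolding Q_def Re_imaginary_pole by (simp add: power2_eq_square field_simps)
    qed
    have Qle: "Re (Q w) \<le> 1 / Im w" if "0 < Im w" for w
    proof -
      have i: "Im w \<le> cmod (w + \<i> * of_real (\<rho>^2))"
        using abs_Im_le_cmod[of "w + \<i> * of_real (\<rho>^2)"] by (simp, smt (verit) zero_le_power2)
      have "Re (Q w) \<le> cmod (Q w)" by (rule complex_Re_le_cmod)
      also have "\<dots> = 1 / cmod (w + \<i> * of_real (\<rho>^2))" by (simp add: Q_def norm_divide)
      also have "\<dots> \<le> 1 / Im w" using i that by (intro frac_le) auto
      finally show ?thesis .
    qed
    have Qne: "w + \<i> * of_real (\<rho>^2) \<noteq> 0" if "0 \<le> Im w" for w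
    proof
      assume "w + \<i> * of_real (\<rho>^2) = 0"
      then have "Im (w + \<i> * of_real (\<rho>^2)) = 0" by simp
      moreover have "\<rho>^2 > 0" using \<rho> by simp
      ultimately show False using that by simp
    qed
    \<comment> \<open>The arc of radius \<rho> about a corner is sent to |w| = \<rho>^2, where
      \<open>Re (Q w)\<close> is at least 1/(4 \<rho>^2); the factor 4 \<tau> turns this into the
      corner bound \<tau>/\<rho>^2. At \<open>z1\<close> the bound \<open>Qle\<close> by 1/Im w is
      independent of \<rho>.\<close>
    define K where "K = (\<lambda>z. F z + of_real (4 * \<tau>) * (Q (Wa z) + Q (Wb z)))"
    define \<Omega> where "\<Omega> = {z. a < Re z \<and> Re z < b \<and> 0 < Im z \<and> Im z < \<eta> \<and>
        \<rho> < cmod (z - of_real a) \<and> \<rho> < cmod (z - of_real b)}"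
    have op: "open \<Omega>" unfolding \<Omega>_def
      by (intro open_Collect_conj open_Collect_less continuous_intros)
    have cl: "closure \<Omega> \<subseteq> {z. a \<le> Re z \<and> Re z \<le> b \<and> 0 \<le> Im z \<and> Im z \<le> \<eta> \<and>
        \<rho> \<le> cmod (z - of_real a) \<and> \<rho> \<le> cmod (z - of_real b)}"
      by (rule closure_minimal) (auto simp: \<Omega>_def intro!: closed_Collect_conj closed_Collect_le continuous_intros)
    have "0 \<le> Re (K z1)"
    proof (rule Re_min_principle[of K \<Omega>])
      show "K holomorphic_on \<Omega>"
        unfolding K_def Q_def Wa_def Wb_def
      proof (intro holomorphic_intros holomorphic_on_subset[OF hol])
        show "\<And>z. z \<in> \<Omega> \<Longrightarrow> (z - of_real a)\<^sup>2 + \<i> * of_real (\<rho>\<^sup>2) \<noteq> 0"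
          using Qne[OF ImWa] unfolding Wa_def \<Omega>_def mem_Collect_eq by (meson less_imp_le)
        show "\<And>z. z \<in> \<Omega> \<Longrightarrow> - (z - of_real b)\<^sup>2 + \<i> * of_real (\<rho>\<^sup>2) \<noteq> 0"
          using Qne[OF ImWb] unfolding Wb_def \<Omega>_def mem_Collect_eq by (meson less_imp_le)
      qed (auto simp: \<Omega>_def)
      show "bounded \<Omega>"
      proof (rule boundedI)
        fix z assume "z \<in> \<Omega>"
        then have "\<bar>Re z\<bar> \<le> \<bar>a\<bar> + \<bar>b\<bar>" "\<bar>Im z\<bar> \<le> \<eta>" by (auto simp: \<Omega>_def)
        then show "norm z \<le> \<bar>a\<bar> + \<bar>b\<bar> + \<eta>" using cmod_le[of z] by linarith
      qed
      show "z1 \<in> \<Omega>"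
        using z1 \<rho> abs_Im_le_cmod[of "z1 - of_real a"] abs_Im_le_cmod[of "z1 - of_real b"] by (auto simp: \<Omega>_def)
      fix \<zeta> and e :: real assume \<zeta>: "\<zeta> \<in> frontier \<Omega>" and e: "e > 0"
      have \<zeta>1: "a \<le> Re \<zeta>" "Re \<zeta> \<le> b" "0 \<le> Im \<zeta>" "Im \<zeta> \<le> \<eta>"
         "\<rho> \<le> cmod (\<zeta> - of_real a)" "\<rho> \<le> cmod (\<zeta> - of_real b)" "\<zeta> \<notin> \<Omega>"
        using \<zeta> cl op by (auto simp: frontier_def interior_open)
      have Qpos: "0 \<le> Re (Q (Wa z))" "0 \<le> Re (Q (Wb z))" if "a \<le> Re z" "Re z \<le> b" "0 \<le> Im z" for z
        using that by (auto intro!: Q0 ImWa ImWb)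
      show "\<forall>\<^sub>F z in at \<zeta> within \<Omega>. - e \<le> Re (K z)"
      proof (cases "Im \<zeta> = 0")
        case True
        then have \<zeta>r: "\<zeta> = of_real (Re \<zeta>)" by (simp add: complex_eq_iff)
        have "Re \<zeta> \<noteq> a" "Re \<zeta> \<noteq> b" using \<zeta>1(5,6) \<rho>(1) \<zeta>r by auto
        then have "\<forall>\<^sub>F z in at (of_real (Re \<zeta>)) within {z. Im z > 0}. - e \<le> Re (F z)"
          using bot[OF _ _ e] \<zeta>1 by simp
        then have "\<forall>\<^sub>F z in at \<zeta> within \<Omega>. - e \<le> Re (F z)"
          unfolding \<zeta>r[symmetric]
          by (rule filter_leD[OF at_le, rotated]) (auto simp: \<Omega>_def)
        moreover have "\<forall>\<^sub>F z in at \<zeta> within \<Omega>. z \<in> \<Omega>" by (simp add: eventually_at_filter)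
        ultimately show ?thesis
        proof eventually_elim
          case (elim z)
          then have "0 \<le> 4 * \<tau> * (Re (Q (Wa z)) + Re (Q (Wb z)))"
            using Qpos[of z] \<tau> by (auto simp: \<Omega>_def)
          then show ?case using elim by (simp add: K_def)
        qed
      next
        case False
        then have im: "Im \<zeta> > 0" using \<zeta>1 by simp
        have cF: "isCont F \<zeta>"
          using hol im open_halfspace_Im_gt[of 0]
          by (metis continuous_on_eq_continuous_at holomorphic_on_imp_continuous_on mem_Collect_eq)
        have "isCont K \<zeta>"
          unfolding K_def Q_def Wa_def Wb_def
          using Qne[OF ImWa] Qne[OF ImWb] \<zeta>1
          by (intro continuous_intros cF) (auto simp: Wa_def Wb_def)
        moreover have "0 \<le> Re (K \<zeta>)"
        proof -
          have KQ: "Re (K \<zeta>) = Re (F \<zeta>) + 4 * \<tau> * (Re (Q (Wa \<zeta>)) + Re (Q (Wb \<zeta>)))"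
            by (simp add: K_def)
          have Qp: "0 \<le> Re (Q (Wa \<zeta>))" "0 \<le> Re (Q (Wb \<zeta>))" using Qpos \<zeta>1 by auto
          have arc: "4 * \<tau> * Re (Q w) \<ge> \<tau> / \<rho>^2" if "0 \<le> Im w" "cmod w = \<rho>^2" for w
          proof -
            have "4 * \<tau> * (1 / (4 * \<rho>^2)) \<le> 4 * \<tau> * Re (Q w)"
              using Qbig[OF that] \<tau> by (intro mult_left_mono) auto
            then show ?thesis by simp
          qed
          consider "Re \<zeta> = a \<or> Re \<zeta> = b" | "Im \<zeta> = \<eta>"
            | "a < Re \<zeta>" "Re \<zeta> < b" "cmod (\<zeta> - of_real a) = \<rho>"
            | "a < Re \<zeta>" "Re \<zeta> < b" "cmod (\<zeta> - of_real b) = \<rho>"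
            using \<zeta>1 im by (fastforce simp: \<Omega>_def)
          then show ?thesis
          proof cases
            case 1 then show ?thesis using sides[OF _ im \<zeta>1(4)] KQ Qp \<tau> by simp
          next
            case 2 then show ?thesis using top \<zeta>1 KQ Qp \<tau> by simp
          next
            case 3
            then have "- (\<tau> / \<rho>^2) \<le> Re (F \<zeta>)" using da(2)[of \<zeta>] im \<rho> by simp
            moreover have "\<tau> / \<rho>^2 \<le> 4 * \<tau> * Re (Q (Wa \<zeta>))"
              using 3 ImWa \<zeta>1 by (intro arc) (auto simp: Wa_def norm_power)
            moreover have "0 \<le> 4 * \<tau> * Re (Q (Wb \<zeta>))" using Qp \<tau> by simp
            ultimately show ?thesis unfolding KQ by (simp add: distrib_left)
          next
            case 4
            then have "- (\<tau> / \<rho>^2) \<le> Re (F \<zeta>)" using db(2)[of \<zeta>] im \<rho> by simp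
            moreover have "\<tau> / \<rho>^2 \<le> 4 * \<tau> * Re (Q (Wb \<zeta>))"
              using 4 ImWb \<zeta>1 by (intro arc) (auto simp: Wb_def norm_power)
            moreover have "0 \<le> 4 * \<tau> * Re (Q (Wa \<zeta>))" using Qp \<tau> by simp
            ultimately show ?thesis unfolding KQ by (simp add: distrib_left)
          qed
        qed
        ultimately show ?thesis using e by (intro eventually_Re_ge_if_isCont)
      qed
    qed (fact op)
    moreover have "4 * \<tau> * (Re (Q (Wa z1)) + Re (Q (Wb z1))) \<le> 4 * \<tau> * (Ka + Kb)"
      unfolding Ka_def Kb_def using pa \<tau> by (intro mult_left_mono add_mono Qle) auto
    ultimately show ?thesis by (simp add: K_def)
  qed
  have K: "Ka + Kb > 0" using pa by (simp add: Ka_def Kb_def add_pos_pos)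
  show ?thesis
  proof (rule ccontr)
    assume neg: "\<not> 0 \<le> Re (F z1)"
    \<comment> \<open>Chosen so that the lower bound from \<open>main\<close> is
      \<open>Re (F z1) / 2\<close>, which is impossible for a negative value.\<close>
    define \<tau> where "\<tau> = - Re (F z1) / (8 * (Ka + Kb))"
    have "\<tau> > 0" using neg K by (simp add: \<tau>_def divide_neg_pos)
    then have "- (4 * \<tau> * (Ka + Kb)) \<le> Re (F z1)" by (rule main)
    moreover have "4 * \<tau> * (Ka + Kb) = - Re (F z1) / 2"
      unfolding \<tau>_def using K by (simp del: distrib_left_numeral)
    ultimately have "Re (F z1) / 2 \<le> Re (F z1)" by simp
    then show False using neg by simp
  qed
qed

section \<open>From vertical to unrestricted lower limits\<close>

lemma bounded_below_on_compact:
  fixes F :: "complex \<Rightarrow> complex"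
  assumes "continuous_on S F" "compact S"
  obtains B where "B \<ge> 0" "\<And>z. z \<in> S \<Longrightarrow> - B \<le> Re (F z)"
proof -
  have "bounded (F ` S)"
    using assms by (intro compact_imp_bounded compact_continuous_image)
  then obtain B where B: "\<And>z. z \<in> S \<Longrightarrow> norm (F z) \<le> B"
    unfolding bounded_iff by auto
  have "- \<bar>B\<bar> \<le> Re (F z)" if "z \<in> S" for z
    using B[OF that] abs_Re_le_cmod[of "F z"] by linarith
  then show thesis by (intro that[of "\<bar>B\<bar>"]) auto
qed

text \<open>The lower limit controls the segment close to the real axis, compactness the rest. This
  serves the two vertical sides of a box whose feet may lie outside the exceptional set.\<close>

lemma vertical_bounded_below:
  fixes F :: "complex \<Rightarrow> complex"
  assumes cont: "continuous_on {z. Im z > 0} F" and c: "c \<ge> 0"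
    and ev: "\<forall>\<^sub>F z in at (of_real x) within {z. Im z > 0}. - c \<le> Re (F z)"
  obtains B where "B \<ge> 0" "\<And>z. Re z = x \<Longrightarrow> 0 < Im z \<Longrightarrow> Im z \<le> \<eta> \<Longrightarrow> - B \<le> Re (F z)"
proof -
  obtain d where d: "d > 0" "\<And>z. Im z > 0 \<Longrightarrow> z \<noteq> of_real x \<Longrightarrow> dist z (of_real x) < d \<Longrightarrow> - c \<le> Re (F z)"
    using ev unfolding eventually_at by auto
  define S where "S = cbox (Complex x (d/2)) (Complex x \<eta>)"
  have "continuous_on S F"
    by (rule continuous_on_subset[OF cont]) (use d in \<open>auto simp: S_def in_cbox_complex_iff\<close>)
  then obtain B where B: "B \<ge> 0" "\<And>z. z \<in> S \<Longrightarrow> - B \<le> Re (F z)"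
    using bounded_below_on_compact[of S F] by (auto simp: S_def)
  show thesis
  proof (rule that[of "max B c"])
    fix z assume z: "Re z = x" "0 < Im z" "Im z \<le> \<eta>"
    show "- max B c \<le> Re (F z)"
    proof (cases "Im z < d/2")
      case True
      have "dist z (of_real x) = Im z" using z by (simp add: dist_norm cmod_def)
      then have "- c \<le> Re (F z)" using d z True by (intro d(2)) auto
      then show ?thesis by simp
    next
      case False
      then have "z \<in> S" using z by (simp add: S_def in_cbox_complex_iff)
      then show ?thesis using B(2)[of z] by simp
    qed
  qed (use B in auto)
qed

text \<open>\<open>E\<close> is the complement of the largest open set on which the unrestricted lower limit is at least
  $-\epsilon$. By Baire, some relatively open piece of \<open>E\<close> carries a uniform lower bound $-\epsilon$ on
  vertical segments. On each gap of \<open>E\<close> the previous lemma compares \<open>F\<close> with the harmonic function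
  \<open>Re (L z)\<close>, which is at most $-\epsilon$ with equality only at the centre \<open>x0\<close>; so the piece would
  not belong to \<open>E\<close>.\<close>
proposition unrestricted_liminf_nonneg:
  fixes F :: "complex \<Rightarrow> complex"
  assumes hol: "F holomorphic_on {z. Im z > 0}"
    and growth: "\<And>\<epsilon>. \<epsilon> > 0 \<Longrightarrow> \<exists>y0>0. \<forall>z. 0 < Im z \<longrightarrow> Im z < y0 \<longrightarrow> - \<epsilon> / (Im z)^2 \<le> Re (F z)"
    and vertical: "\<And>x \<epsilon>. \<epsilon> > 0 \<Longrightarrow> \<exists>y0>0. \<forall>y. 0 < y \<longrightarrow> y < y0 \<longrightarrow> - \<epsilon> \<le> Re (F (Complex x y))"
    and e: "e > 0"
  shows "\<forall>\<^sub>F z in at (of_real x) within {z. Im z > 0}. - e \<le> Re (F z)"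
proof -
  define \<epsilon> where "\<epsilon> = e / 2"
  have \<epsilon>: "\<epsilon> > 0" "\<epsilon> < e" using e by (auto simp: \<epsilon>_def)
  define good where "good = (\<lambda>x. \<forall>e>\<epsilon>. \<forall>\<^sub>F z in at (complex_of_real x) within {z. Im z > 0}. - e \<le> Re (F z))"
  \<comment> \<open>Passing to the interior makes \<open>E\<close> closed, hence a Baire space, and
    makes every point of a gap of \<open>E\<close> good.\<close>
  define E where "E = - interior {x. good x}"
  have clE: "closed E" unfolding E_def by (intro closed_Compl open_interior)
  have notE: "good x" if "x \<notin> E" for x
    using that interior_subset by (auto simp: E_def)
  have contF: "continuous_on {z. Im z > 0} F"
    using hol by (rule holomorphic_on_imp_continuous_on)
  \<comment> \<open>The vertical hypothesis says that these sets exhaust \<open>E\<close>; the weak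
    inequality at each fixed height makes them closed.\<close>
  define A where "A = (\<lambda>n. {x \<in> E. \<forall>y. 0 < y \<longrightarrow> y \<le> 1 / real (Suc n) \<longrightarrow> - \<epsilon> \<le> Re (F (Complex x y))})"
  have clA: "closed (A n)" for n
  proof -
    have "closed {x. - \<epsilon> \<le> Re (F (Complex x y))}" if "y > 0" for y
    proof -
      have "continuous_on UNIV (\<lambda>x. F (Complex x y))"
        by (rule continuous_on_compose2[OF contF]) (use that in \<open>auto intro!: continuous_intros simp: Complex_eq\<close>)
      then show ?thesis by (intro closed_Collect_le continuous_intros)
    qed
    then have "closed (\<Inter>y\<in>{0<..1 / real (Suc n)}. {x. - \<epsilon> \<le> Re (F (Complex x y))})"
      by (intro closed_INT ballI) auto
    then have "closed (E \<inter> (\<Inter>y\<in>{0<..1 / real (Suc n)}. {x. - \<epsilon> \<le> Re (F (Complex x y))}))"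
      using clE by (rule closed_Int[rotated])
    also have "E \<inter> (\<Inter>y\<in>{0<..1 / real (Suc n)}. {x. - \<epsilon> \<le> Re (F (Complex x y))}) = A n"
      by (auto simp: A_def)
    finally show ?thesis .
  qed
  have cover: "\<exists>n. x \<in> A n" if "x \<in> E" for x
  proof -
    obtain y0 where y0: "y0 > 0" "\<And>y. 0 < y \<Longrightarrow> y < y0 \<Longrightarrow> - \<epsilon> \<le> Re (F (Complex x y))"
      using vertical[OF \<epsilon>(1)] by blast
    obtain n where "1 / real (Suc n) < y0" using y0(1) nat_approx_posE by metis
    then have "x \<in> A n" using that y0(2) by (auto simp: A_def)
    then show ?thesis ..
  qed
  have "E = {}"
  proof (rule ccontr)
    assume ne: "E \<noteq> {}"
    \<comment> \<open>Otherwise the sets \<open>E - A n\<close> would be relatively open and dense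
      in \<open>E\<close>, with empty intersection.\<close>
    have "\<exists>n. \<not> E \<subseteq> closure (E - A n)"
    proof (rule ccontr)
      assume "\<not> ?thesis"
      then have "E \<subseteq> closure (\<Inter>(range (\<lambda>n. E - A n)))"
      proof (intro Baire clE)
        fix T assume "T \<in> range (\<lambda>n. E - A n)"
        then obtain n where T: "T = E - A n" by blast
        have "openin (top_of_set E) (E \<inter> - A n)"
          using clA by (intro openin_open_Int open_Compl)
        then show "openin (top_of_set E) T \<and> E \<subseteq> closure T"
          using \<open>\<not> (\<exists>n. \<not> E \<subseteq> closure (E - A n))\<close> T by (auto simp: Diff_eq)
      qed auto
      moreover have "\<Inter>(range (\<lambda>n. E - A n)) = {}" using cover by blast
      ultimately show False using ne by (metis closure_empty subset_empty)
    qed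
    then obtain n xs where xs: "xs \<in> E" "xs \<notin> closure (E - A n)" by blast
    then obtain r where r: "r > 0" "\<And>x. x \<in> E \<Longrightarrow> \<bar>x - xs\<bar> < r \<Longrightarrow> x \<in> A n"
      unfolding closure_approachable by (auto simp: dist_real_def)
    define \<eta> where "\<eta> = 1 / real (Suc n)"
    have \<eta>: "0 < \<eta>" "\<eta> \<le> 1" by (auto simp: \<eta>_def)
    have onE: "- \<epsilon> \<le> Re (F z)" if "Re z \<in> E" "\<bar>Re z - xs\<bar> < r" "0 < Im z" "Im z \<le> \<eta>" for z
    proof -
      have "Re z \<in> A n" using r(2) that by blast
      then have "- \<epsilon> \<le> Re (F (Complex (Re z) (Im z)))"
        using that(3,4) unfolding A_def \<eta>_def by blast
      then show ?thesis by simp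
    qed
    have "good x0" if x0: "\<bar>x0 - xs\<bar> < r" for x0
    proof (cases "x0 \<in> E")
      case False then show ?thesis by (rule notE)
    next
      case True
      define \<rho> where "\<rho> = (r - \<bar>x0 - xs\<bar>) / 2"
      have \<rho>: "\<rho> > 0" using x0 by (simp add: \<rho>_def)
      have near: "\<bar>x - xs\<bar> < r" if "\<bar>x - x0\<bar> \<le> \<rho>" for x
        using that x0 unfolding \<rho>_def by (simp add: field_simps abs_if split: if_splits)
      \<comment> \<open>The feet of the sides are not chosen in \<open>E\<close>, so only some bound
        -B is available on them, not -\<epsilon>; the comparison function has to drop that
        far.\<close>
      have side: "\<exists>B\<ge>0. \<forall>z. Re z = x \<longrightarrow> 0 < Im z \<longrightarrow> Im z \<le> \<eta> \<longrightarrow> - B \<le> Re (F z)"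
        if x: "\<bar>x - x0\<bar> \<le> \<rho>" for x
      proof (cases "x \<in> E")
        case True
        then show ?thesis using onE near[OF x] \<epsilon> by (intro exI[of _ \<epsilon>]) auto
      next
        case False
        then have "\<forall>\<^sub>F z in at (complex_of_real x) within {z. Im z > 0}. - e \<le> Re (F z)"
          using notE \<epsilon> by (simp add: good_def)
        then show ?thesis
          using vertical_bounded_below[OF contF, of e x \<eta>] e by (metis less_imp_le)
      qed
      obtain B1 where B1: "B1 \<ge> 0" "\<And>z. Re z = x0 - \<rho> \<Longrightarrow> 0 < Im z \<Longrightarrow> Im z \<le> \<eta> \<Longrightarrow> - B1 \<le> Re (F z)"
        using side[of "x0 - \<rho>"] \<rho> by auto
      obtain B2 where B2: "B2 \<ge> 0" "\<And>z. Re z = x0 + \<rho> \<Longrightarrow> 0 < Im z \<Longrightarrow> Im z \<le> \<eta> \<Longrightarrow> - B2 \<le> Re (F z)"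
        using side[of "x0 + \<rho>"] \<rho> by auto
      obtain B3 where B3: "B3 \<ge> 0" "\<And>z. z \<in> cbox (Complex (x0 - \<rho>) \<eta>) (Complex (x0 + \<rho>) \<eta>) \<Longrightarrow> - B3 \<le> Re (F z)"
      proof (rule bounded_below_on_compact)
        show "continuous_on (cbox (Complex (x0 - \<rho>) \<eta>) (Complex (x0 + \<rho>) \<eta>)) F"
          by (rule continuous_on_subset[OF contF]) (use \<eta> in \<open>auto simp: in_cbox_complex_iff\<close>)
      qed auto
      define B where "B = B1 + B2 + B3"
      have B: "B \<ge> 0" "B1 \<le> B" "B2 \<le> B" "B3 \<le> B" using B1(1) B2(1) B3(1) by (auto simp: B_def)
      define p q where "p = B / \<eta>" and "q = B / \<rho>^2"
      have pq: "p \<ge> 0" "q \<ge> 0" "p * \<eta> = B" "q * \<rho>^2 = B" using B \<eta> \<rho> by (auto simp: p_def q_def)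
      \<comment> \<open>The term q((x-x0)^2 - y^2) is the harmonic substitute for q(x-x0)^2, and
        adding q y repairs the sign of -y^2 for heights up to 1. Here q \<rho>^2 = B pushes
        \<open>Re (L z)\<close> below -B on the sides, and p \<eta> = B does so on the top.\<close>
      define L where "L = (\<lambda>z. - of_real \<epsilon> + of_real (p + q) * (\<i> * z) - of_real q * (z - of_real x0)^2)"
      have ReL: "Re (L z) = - \<epsilon> - p * Im z - q * ((Re z - x0)^2 + (Im z - (Im z)^2))" for z
        by (simp add: L_def power2_eq_square algebra_simps)
      have Imsq: "(Im z)^2 \<le> Im z" if "0 \<le> Im z" "Im z \<le> 1" for z
        using that by (simp add: power2_eq_square mult_left_le)
      have Lle: "Re (L z) \<le> - \<epsilon>" if "0 \<le> Im z" "Im z \<le> 1" for z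
      proof -
        have "0 \<le> p * Im z" "0 \<le> q * ((Re z - x0)^2 + (Im z - (Im z)^2))"
          using pq that Imsq[OF that] by auto
        then show ?thesis unfolding ReL by linarith
      qed
      have holL: "L holomorphic_on S" for S unfolding L_def by (intro holomorphic_intros)
      have sidesL: "- B \<ge> Re (L z)" if "\<bar>Re z - x0\<bar> = \<rho>" "0 \<le> Im z" "Im z \<le> 1" for z
      proof -
        have "(Re z - x0)^2 = \<rho>^2" using that(1) by (metis power2_abs)
        then have "q * \<rho>^2 \<le> q * ((Re z - x0)^2 + (Im z - (Im z)^2))"
          using pq Imsq[OF that(2,3)] by (intro mult_left_mono) auto
        moreover have "0 \<le> p * Im z" using pq that by auto
        ultimately show ?thesis unfolding ReL using \<epsilon> pq(4) by linarith
      qed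
      have topL: "- B \<ge> Re (L z)" if "Im z = \<eta>" for z
      proof -
        have "0 \<le> q * ((Re z - x0)^2 + (Im z - (Im z)^2))"
          using pq that \<eta> Imsq[of z] by auto
        then show ?thesis unfolding ReL using \<epsilon> pq(3) that by simp
      qed
      have ge: "Re (L z) \<le> Re (F z)" if z: "\<bar>Re z - x0\<bar> < \<rho>" "0 < Im z" "Im z < \<eta>" for z
      proof (cases "Re z \<in> E")
        case True
        then have "- \<epsilon> \<le> Re (F z)" using onE near z by auto
        then show ?thesis using Lle[of z] z \<eta> by simp
      next
        case False
        \<comment> \<open>With the two side abscissae added, Re z has a nearest point of
          \<open>C\<close> on either side. Above such a point the bound is -\<epsilon> if it belongs
          to \<open>E\<close>, and -B otherwise.\<close>
        define C where "C = E \<union> {x0 - \<rho>, x0 + \<rho>}"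
        have clC: "closed C" unfolding C_def using clE by (intro closed_Un) auto
        have zC: "Re z \<notin> C" using False z by (auto simp: C_def)
        have "compact (C \<inter> {x0 - \<rho>..Re z})" using clC by (rule closed_Int_compact) simp
        moreover have "C \<inter> {x0 - \<rho>..Re z} \<noteq> {}" using z by (auto simp: C_def)
        ultimately obtain a where a: "a \<in> C \<inter> {x0 - \<rho>..Re z}" "\<And>x. x \<in> C \<inter> {x0 - \<rho>..Re z} \<Longrightarrow> x \<le> a"
          using compact_attains_sup[of "C \<inter> {x0 - \<rho>..Re z}"] by blast
        have "compact (C \<inter> {Re z..x0 + \<rho>})" using clC by (rule closed_Int_compact) simp
        moreover have "C \<inter> {Re z..x0 + \<rho>} \<noteq> {}" using z by (auto simp: C_def)
        ultimately obtain b where b: "b \<in> C \<inter> {Re z..x0 + \<rho>}" "\<And>x. x \<in> C \<inter> {Re z..x0 + \<rho>} \<Longrightarrow> b \<le> x"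
          using compact_attains_inf[of "C \<inter> {Re z..x0 + \<rho>}"] by blast
        have ab: "a < Re z" "Re z < b" "x0 - \<rho> \<le> a" "b \<le> x0 + \<rho>" using a b zC by (auto simp: order.strict_iff_order)
        have gap: "x \<notin> E" if "a < x" "x < b" for x
          using a(2)[of x] b(2)[of x] that ab linear[of x "Re z"] by (auto simp: C_def)
        have "0 \<le> Re (F z - L z)"
        proof (rule Re_nonneg_on_box[where F = "\<lambda>z. F z - L z" and a = a and b = b and \<eta> = \<eta>])
          show "(\<lambda>z. F z - L z) holomorphic_on {z. 0 < Im z}" by (intro holomorphic_intros hol holL)
          show "a < b" using ab by simp
        next
          fix \<epsilon>' :: real assume "\<epsilon>' > 0"
          then obtain y0 where y0: "y0 > 0" "\<And>z. 0 < Im z \<Longrightarrow> Im z < y0 \<Longrightarrow> - \<epsilon>' / (Im z)^2 \<le> Re (F z)"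
            using growth by blast
          have "- \<epsilon>' / (Im z)^2 \<le> Re (F z - L z)" if "0 < Im z" "Im z < min y0 1" for z
            using y0(2)[of z] Lle[of z] \<epsilon> that by simp
          then show "\<exists>y0>0. \<forall>z. 0 < Im z \<longrightarrow> Im z < y0 \<longrightarrow> - \<epsilon>' / (Im z)^2 \<le> Re (F z - L z)"
            using y0(1) by (intro exI[of _ "min y0 1"]) auto
        next
          fix x e' :: real assume x: "a < x" "x < b" "e' > 0"
          have "good x" using notE gap x by blast
          have "\<forall>\<^sub>F z in at (complex_of_real x) within {z. Im z > 0}. - (\<epsilon> + e') \<le> Re (F z)"
            using \<open>good x\<close>[unfolded good_def, rule_format, of "\<epsilon> + e'"] x by simp
          moreover have "\<forall>\<^sub>F z in at (complex_of_real x) within {z. Im z > 0}. 0 < Im z \<and> Im z < 1"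
            unfolding eventually_at
          proof (intro exI[of _ 1] conjI ballI impI)
            fix z assume "z \<in> {z. 0 < Im z}" "z \<noteq> complex_of_real x \<and> dist z (complex_of_real x) < 1"
            then show "0 < Im z" "Im z < 1"
              using abs_Im_le_cmod[of "z - of_real x"] by (auto simp: dist_norm)
          qed simp
          ultimately show "\<forall>\<^sub>F z in at (complex_of_real x) within {z. Im z > 0}. - e' \<le> Re (F z - L z)"
          proof eventually_elim
            case (elim z)
            then show ?case using Lle[of z] by simp
          qed
        next
          fix z assume z': "Re z = a \<or> Re z = b" "0 < Im z" "Im z \<le> \<eta>"
          show "0 \<le> Re (F z - L z)"
          proof (cases "Re z \<in> E")
            case True
            moreover have "\<bar>Re z - x0\<bar> \<le> \<rho>" using z' ab z by auto
            ultimately have "- \<epsilon> \<le> Re (F z)" using onE near z' by auto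
            then show ?thesis using Lle[of z] z' \<eta> by simp
          next
            case False
            then have R: "Re z = x0 - \<rho> \<or> Re z = x0 + \<rho>" using z' a(1) b(1) by (auto simp: C_def)
            then have "- B \<le> Re (F z)" using B1(2)[of z] B2(2)[of z] B z' by auto
            moreover have "Re (L z) \<le> - B" using R z' \<rho> \<eta> by (intro sidesL) auto
            ultimately show ?thesis by simp
          qed
        next
          fix z assume z': "a \<le> Re z" "Re z \<le> b" "Im z = \<eta>"
          then have "- B3 \<le> Re (F z)" using ab by (intro B3(2)) (auto simp: in_cbox_complex_iff)
          then show "0 \<le> Re (F z - L z)" using topL[OF z'(3)] B by simp
        qed (use ab z \<eta> in auto)
        then show ?thesis by simp
      qed
      show ?thesis unfolding good_def
      proof (intro allI impI)
        fix e' assume e': "\<epsilon> < e'"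
        have "isCont L (of_real x0)" unfolding L_def by (intro continuous_intros)
        then have "((\<lambda>z. Re (L z)) \<longlongrightarrow> Re (L (of_real x0))) (at (of_real x0) within {z. Im z > 0})"
          by (intro tendsto_intros) (metis continuous_at_imp_continuous_at_within continuous_within)
        then have "\<forall>\<^sub>F z in at (of_real x0) within {z. Im z > 0}. - e' < Re (L z)"
          using e' by (intro order_tendstoD(1)) (auto simp: ReL)
        moreover have "\<forall>\<^sub>F z in at (complex_of_real x0) within {z. Im z > 0}. 0 < Im z \<and> Im z < \<eta> \<and> \<bar>Re z - x0\<bar> < \<rho>"
          unfolding eventually_at
        proof (intro exI[of _ "min \<eta> \<rho>"] conjI ballI impI)
          fix z assume "z \<in> {z. 0 < Im z}" "z \<noteq> complex_of_real x0 \<and> dist z (complex_of_real x0) < min \<eta> \<rho>"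
          then show "0 < Im z" "Im z < \<eta>" "\<bar>Re z - x0\<bar> < \<rho>"
            using abs_Im_le_cmod[of "z - of_real x0"] abs_Re_le_cmod[of "z - of_real x0"] by (auto simp: dist_norm)
        qed (use \<eta> \<rho> in auto)
        ultimately show "\<forall>\<^sub>F z in at (complex_of_real x0) within {z. 0 < Im z}. - e' \<le> Re (F z)"
        proof eventually_elim
          case (elim z)
          then show ?case using ge[of z] by simp
        qed
      qed
    qed
    then have "ball xs r \<subseteq> {x. good x}" by (auto simp: dist_real_def abs_minus_commute)
    then have "xs \<in> interior {x. good x}" using r(1) by (meson centre_in_ball interior_maximal open_ball subsetD)
    then show False using xs(1) by (simp add: E_def)
  qed
  then have "good x" using notE by simp
  then show ?thesis using \<epsilon> by (simp add: good_def)
qed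

section \<open>Major functions and integration by parts for the Henstock-Kurzweil integral\<close>

text \<open>\<open>g x\<close> is the supremum of the Henstock sums over fine partial divisions of $[a,x]$. Adding
  \<open>g\<close> to, or subtracting it from, an indefinite integral of \<open>f\<close> gives Perron's major and minor
  functions.\<close>
lemma HK_monotone_error_function:
  fixes f :: "real \<Rightarrow> real"
  assumes f: "f integrable_on {a..b}" and e: "e > 0"
  obtains g where "mono_on {a..b} g" "\<And>x. x \<in> {a..b} \<Longrightarrow> 0 \<le> g x \<and> g x \<le> e"
    "\<And>t. t \<in> {a..b} \<Longrightarrow> \<exists>d>0. \<forall>x y. a \<le> x \<longrightarrow> x \<le> t \<longrightarrow> t \<le> y \<longrightarrow> y \<le> b \<longrightarrow> t - d < x \<longrightarrow> y < t + d \<longrightarrow>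
        \<bar>(y - x) * f t - integral {x..y} f\<bar> \<le> g y - g x"
proof -
  \<comment> \<open>Henstock's lemma bounds the sum of absolute errors over every fine partial
    division by \<open>e\<close>; this is the upper bound for \<open>g\<close>.\<close>
  obtain \<gamma> where \<gamma>: "gauge \<gamma>"
    and hen: "\<And>p. \<lbrakk>p tagged_partial_division_of (cbox a b); \<gamma> fine p\<rbrakk> \<Longrightarrow>
             sum (\<lambda>(x,k). norm (measure lborel k *\<^sub>R f x - integral k f)) p < e"
    using Henstock_lemma[of f a b e] f e by auto
  define V where "V = (\<lambda>p. sum (\<lambda>(x,k). norm (measure lborel k *\<^sub>R f x - integral k f)) p)"
  define P where "P = (\<lambda>x. {p. p tagged_partial_division_of (cbox a x) \<and> \<gamma> fine p})"
  define g where "g = (\<lambda>x. Sup (V ` P x))"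
  have Pmono: "P x \<subseteq> P y" if "x \<le> y" for x y
  proof
    fix p assume p: "p \<in> P x"
    have "cbox a x \<subseteq> cbox a y" using that by auto
    then show "p \<in> P y" using p unfolding P_def tagged_partial_division_of_def by blast
  qed
  have empty: "{} \<in> P x" for x
    by (simp add: P_def tagged_partial_division_of_def fine_def)
  have Vle: "V p \<le> e" if "p \<in> P x" "x \<le> b" for p x
  proof -
    have "p \<in> P b" using that Pmono by blast
    then show ?thesis using hen[of p] by (simp add: P_def V_def)
  qed
  have bdd: "bdd_above (V ` P x)" if "x \<le> b" for x
    using Vle that by (intro bdd_aboveI2[of _ _ e]) auto
  have gmono: "g x \<le> g y" if "x \<le> y" "y \<le> b" for x y
    unfolding g_def using that empty Pmono[OF that(1)] bdd
    by (intro cSup_subset_mono) auto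
  have g0: "0 \<le> g x" if "x \<le> b" for x
  proof -
    have "V {} \<le> g x" unfolding g_def using empty bdd that by (intro cSup_upper) auto
    then show ?thesis by (simp add: V_def)
  qed
  have ge: "g x \<le> e" if "x \<le> b" for x
    unfolding g_def using Vle that empty by (intro cSup_least) auto
  have step: "\<bar>(y - x) * f t - integral {x..y} f\<bar> \<le> g y - g x"
    if xy: "a \<le> x" "x \<le> t" "t \<le> y" "y \<le> b" and fine: "{x..y} \<subseteq> \<gamma> t" for x y t
  \<comment> \<open>A degenerate tagged interval could already belong to the division, so that
    adjoining it would add nothing.\<close>
  proof (cases "x = y")
    case True then show ?thesis by simp
  next
    case False
    then have lt: "x < y" using xy by simp
    let ?T = "\<bar>(y - x) * f t - integral {x..y} f\<bar>"
    \<comment> \<open>Adjoining the interval [x, y] with tag \<open>t\<close> to a fine partial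
      division of [a, x] gives one of [a, y], so the supremum grows by at least the error of that
      interval.\<close>
    have "V p \<le> g y - ?T" if p: "p \<in> P x" for p
    proof -
      have pp: "p tagged_partial_division_of (cbox a x)" "\<gamma> fine p" using p by (auto simp: P_def)
      note D = tagged_partial_division_ofD[OF pp(1)]
      have new: "(t, {x..y}) \<notin> p"
      proof
        assume "(t, {x..y}) \<in> p"
        then have "{x..y} \<subseteq> cbox a x" by (rule D(3))
        moreover have "y \<in> {x..y}" using lt by simp
        ultimately have "y \<in> cbox a x" by blast
        then show False using lt by simp
      qed
      have dis: "interior {x..y} \<inter> interior K = {}" if "(s, K) \<in> p" for s K
      proof -
        have "interior K \<subseteq> interior {a..x}" using D(3)[OF that] by (intro interior_mono) simp
        then show ?thesis by auto
      qed
      have "insert (t, {x..y}) p tagged_partial_division_of (cbox a y)"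
        unfolding tagged_partial_division_of_def
      proof (intro conjI allI impI)
        show "finite (insert (t, {x..y}) p)" using D(1) by simp
        fix s K assume sK: "(s, K) \<in> insert (t, {x..y}) p"
        show "s \<in> K" using sK D(2) xy by auto
        have "cbox a x \<subseteq> cbox a y" "{x..y} \<subseteq> cbox a y" using xy by auto
        then show "K \<subseteq> cbox a y" using sK D(3)[of s K] by blast
        show "\<exists>c d. K = cbox c d" using sK D(4)[of s K] by (auto intro: exI[of _ x] exI[of _ y])
      next
        fix s1 K1 s2 K2
        assume "(s1, K1) \<in> insert (t, {x..y}) p \<and> (s2, K2) \<in> insert (t, {x..y}) p \<and> (s1, K1) \<noteq> (s2, K2)"
        then show "interior K1 \<inter> interior K2 = {}"
          using D(5)[of s1 K1 s2 K2] dis[of s1 K1] dis[of s2 K2] by blast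
      qed
      moreover have "\<gamma> fine insert (t, {x..y}) p" using pp(2) fine by (auto simp: fine_def)
      ultimately have "insert (t, {x..y}) p \<in> P y" by (simp add: P_def)
      then have "V (insert (t, {x..y}) p) \<le> g y" unfolding g_def using bdd xy by (intro cSup_upper) auto
      moreover have "V (insert (t, {x..y}) p) = ?T + V p"
        using new D(1) lt by (simp add: V_def)
      ultimately show ?thesis by simp
    qed
    then have "Sup (V ` P x) \<le> g y - ?T" using empty by (intro cSup_least) auto
    then show ?thesis by (simp add: g_def)
  qed
  show thesis
  proof (rule that[of g])
    show "mono_on {a..b} g" using gmono by (auto intro!: mono_onI)
    show "0 \<le> g x \<and> g x \<le> e" if "x \<in> {a..b}" for x using g0 ge that by auto
    fix t assume "t \<in> {a..b}"
    obtain d where d: "d > 0" "ball t d \<subseteq> \<gamma> t"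
      using \<gamma> unfolding gauge_def by (meson openE)
    have "{x..y} \<subseteq> \<gamma> t" if "t - d < x" "y < t + d" for x y
      using d(2) that by (intro order_trans[OF _ d(2)]) (auto simp: dist_real_def)
    then show "\<exists>d>0. \<forall>x y. a \<le> x \<longrightarrow> x \<le> t \<longrightarrow> t \<le> y \<longrightarrow> y \<le> b \<longrightarrow> t - d < x \<longrightarrow> y < t + d \<longrightarrow>
        \<bar>(y - x) * f t - integral {x..y} f\<bar> \<le> g y - g x"
      using step d(1) by blast
  qed
qed

text \<open>The second mean value theorem on short intervals shows that the defect \<open>\<Psi>\<close> has derivative
  zero everywhere, although the indefinite integral of \<open>f\<close> is differentiable only almost everywhere.\<close>
lemma HK_integration_by_parts_mono:
  fixes f \<phi> \<phi>' :: "real \<Rightarrow> real"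
  assumes f: "f integrable_on {a..b}" and ab: "a \<le> b"
    and der: "\<And>x. x \<in> {a..b} \<Longrightarrow> (\<phi> has_real_derivative \<phi>' x) (at x within {a..b})"
    and cont: "continuous_on {a..b} \<phi>'" and pos: "\<And>x. x \<in> {a..b} \<Longrightarrow> 0 \<le> \<phi>' x"
  shows "((\<lambda>x. f x * \<phi> x) has_integral
    (integral {a..b} f * \<phi> b - integral {a..b} (\<lambda>x. integral {a..x} f * \<phi>' x))) {a..b}"
proof -
  define F where "F = (\<lambda>x. integral {a..x} f)"
  have contF: "continuous_on {a..b} F"
    unfolding F_def using f by (rule indefinite_integral_continuous_1)
  have intF: "(\<lambda>x. F x * \<phi>' x) integrable_on {a..b}"
    by (intro integrable_continuous_interval continuous_intros contF cont)
  have ftc: "(\<phi>' has_integral (\<phi> y - \<phi> x)) {x..y}" if "a \<le> x" "x \<le> y" "y \<le> b" for x y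
  proof (rule fundamental_theorem_of_calculus)
    fix z assume "z \<in> {x..y}"
    then show "(\<phi> has_vector_derivative \<phi>' z) (at z within {x..y})"
      using der[of z] that has_field_derivative_subset[of \<phi> "\<phi>' z" z "{a..b}" "{x..y}"]
      by (auto simp: has_real_derivative_iff_has_vector_derivative)
  qed (use that in auto)
  have mono: "\<phi> x \<le> \<phi> y" if "a \<le> x" "x \<le> y" "y \<le> b" for x y
  proof -
    have "0 \<le> \<phi> y - \<phi> x" by (rule has_integral_nonneg[OF ftc[OF that]]) (use that pos in auto)
    then show ?thesis by simp
  qed
  \<comment> \<open>This also supplies the integrability of the product, which continuity of the
    second factor does not ensure for Henstock-Kurzweil integrals.\<close>
  have smv: "\<exists>c\<in>{x..y}. ((\<lambda>z. f z * \<phi> z) has_integral (\<phi> x * (F c - F x) + \<phi> y * (F y - F c))) {x..y}"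
    if xy: "a \<le> x" "x \<le> y" "y \<le> b" for x y
  proof -
    have "f integrable_on {x..y}" using f by (rule integrable_on_subinterval) (use xy in auto)
    moreover have "\<phi> u \<le> \<phi> v" if "x \<le> u" "u \<le> v" "v \<le> y" for u v
      using mono[of u v] that xy by simp
    ultimately obtain c where c: "c \<in> {x..y}" and
      hi: "((\<lambda>z. \<phi> z * f z) has_integral (\<phi> x * integral {x..c} f + \<phi> y * integral {c..y} f)) {x..y}"
      using second_mean_value_theorem_full[of f x y \<phi>] xy by blast
    have "F x + integral {x..c} f = F c" "F c + integral {c..y} f = F y"
      unfolding F_def using c xy f
      by (intro Henstock_Kurzweil_Integration.integral_combine; auto intro: integrable_on_subinterval)+
    then have "integral {x..c} f = F c - F x" "integral {c..y} f = F y - F c" by auto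
    then show ?thesis using hi c by (auto simp: mult.commute)
  qed
  have int\<phi>: "(\<lambda>x. f x * \<phi> x) integrable_on {a..b}"
    using smv[of a b] ab by (auto simp: integrable_on_def)
  define I where "I = (\<lambda>x. integral {a..x} (\<lambda>x. f x * \<phi> x))"
  define J where "J = (\<lambda>x. integral {a..x} (\<lambda>x. F x * \<phi>' x))"
  define \<Psi> where "\<Psi> = (\<lambda>x. F x * \<phi> x - I x - J x)"
  obtain B where B: "B > 0" "\<And>x. x \<in> {a..b} \<Longrightarrow> \<phi>' x \<le> B"
  proof -
    have "bounded (\<phi>' ` {a..b})" by (intro compact_imp_bounded compact_continuous_image cont) simp
    then obtain B where "\<forall>x\<in>{a..b}. \<bar>\<phi>' x\<bar> \<le> B" unfolding bounded_iff by auto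
    then have "\<phi>' x \<le> \<bar>B\<bar> + 1" if "x \<in> {a..b}" for x using that by fastforce
    then show thesis by (intro that[of "\<bar>B\<bar> + 1"]) auto
  qed
  \<comment> \<open>With \<open>c\<close> from the second mean value theorem, the increment of
    \<Psi> is the integral of \<open>(F c - F z) * \<phi>' z\<close> over [x, y], hence at most the
    oscillation of \<open>F\<close> times \<open>B\<close> times the length.\<close>
  have small: "\<bar>\<Psi> y - \<Psi> x\<bar> \<le> \<epsilon> * (y - x)"
    if xy: "a \<le> x" "x \<le> y" "y \<le> b" and osc: "\<And>u v. u \<in> {x..y} \<Longrightarrow> v \<in> {x..y} \<Longrightarrow> \<bar>F u - F v\<bar> \<le> \<epsilon> / B" for x y \<epsilon>
  proof -
    obtain c where c: "c \<in> {x..y}"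
      and hi: "((\<lambda>z. f z * \<phi> z) has_integral (\<phi> x * (F c - F x) + \<phi> y * (F y - F c))) {x..y}"
      using smv[OF xy] by blast
    have I: "I y - I x = \<phi> x * (F c - F x) + \<phi> y * (F y - F c)"
      using Henstock_Kurzweil_Integration.integral_combine[of a x y "\<lambda>z. f z * \<phi> z"] xy integral_unique[OF hi]
        integrable_on_subinterval[OF int\<phi>, of a y]
      by (auto simp: I_def)
    have hJ: "((\<lambda>z. F z * \<phi>' z) has_integral (J y - J x)) {x..y}"
      using Henstock_Kurzweil_Integration.integral_combine[of a x y "\<lambda>z. F z * \<phi>' z"] xy
        integrable_on_subinterval[OF intF, of a y] integrable_on_subinterval[OF intF, of x y]
      by (auto simp: J_def has_integral_iff)
    have "((\<lambda>z. F c * \<phi>' z - F z * \<phi>' z) has_integral (F c * (\<phi> y - \<phi> x) - (J y - J x))) {x..y}"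
      by (intro has_integral_diff has_integral_mult_right ftc hJ xy)
    moreover have "F c * (\<phi> y - \<phi> x) - (J y - J x) = \<Psi> y - \<Psi> x"
      using I by (simp add: \<Psi>_def algebra_simps)
    ultimately have h: "((\<lambda>z. (F c - F z) * \<phi>' z) has_integral (\<Psi> y - \<Psi> x)) {x..y}"
      by (simp add: left_diff_distrib)
    have "norm (\<Psi> y - \<Psi> x) \<le> \<epsilon> * measure lborel (cbox x y)"
    proof (rule has_integral_bound)
      have "0 \<le> \<epsilon> / B" using osc[of x x] xy by simp
      then show "0 \<le> \<epsilon>" using B(1) by (simp add: zero_le_divide_iff)
      show "((\<lambda>z. (F c - F z) * \<phi>' z) has_integral (\<Psi> y - \<Psi> x)) (cbox x y)" using h by simp
      fix z assume z: "z \<in> cbox x y"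
      have "\<bar>F c - F z\<bar> * \<bar>\<phi>' z\<bar> \<le> (\<epsilon> / B) * B"
        using osc[OF c, of z] z xy B pos[of z] by (intro mult_mono) auto
      then show "norm ((F c - F z) * \<phi>' z) \<le> \<epsilon>" using B(1) by (simp add: abs_mult)
    qed
    then show ?thesis using xy by simp
  qed
  have "(\<Psi> has_real_derivative 0) (at x within {a..b})" if x: "x \<in> {a..b}" for x
    unfolding has_field_derivative_iff
  proof (rule tendstoI)
    fix \<epsilon> :: real assume \<epsilon>: "\<epsilon> > 0"
    have "\<epsilon> / 4 / B > 0" using \<epsilon> B by simp
    then obtain d where d: "d > 0" "\<And>y. y \<in> {a..b} \<Longrightarrow> dist y x < d \<Longrightarrow> dist (F y) (F x) < \<epsilon> / 4 / B"
      using contF x unfolding continuous_on_iff by blast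
    have quot: "\<bar>\<Psi> y - \<Psi> x\<bar> \<le> \<epsilon> / 2 * \<bar>y - x\<bar>" if y: "y \<in> {a..b}" "dist y x < d" for y
    proof -
      have near: "\<bar>F u - F v\<bar> \<le> \<epsilon> / 2 / B" if "u \<in> {min x y..max x y}" "v \<in> {min x y..max x y}" for u v
      proof -
        have uv: "u \<in> {a..b}" "v \<in> {a..b}" using that x y(1) by (auto simp: min_def max_def split: if_splits)
        moreover have "dist u x < d" "dist v x < d"
          using that y(2) by (auto simp: dist_real_def min_def max_def split: if_splits)
        ultimately have "dist (F u) (F x) < \<epsilon> / 4 / B" "dist (F v) (F x) < \<epsilon> / 4 / B" using d(2) by auto
        moreover have "\<epsilon> / 4 / B + \<epsilon> / 4 / B = \<epsilon> / 2 / B" by simp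
        ultimately show ?thesis unfolding dist_real_def by linarith
      qed
      show ?thesis
      proof (cases "x \<le> y")
        case True
        then show ?thesis using small[of x y "\<epsilon> / 2"] near x y(1) by auto
      next
        case False
        then show ?thesis using small[of y x "\<epsilon> / 2"] near x y(1) by (auto simp: abs_minus_commute)
      qed
    qed
    show "\<forall>\<^sub>F y in at x within {a..b}. dist ((\<Psi> y - \<Psi> x) / (y - x)) 0 < \<epsilon>"
      unfolding eventually_at
    proof (intro exI[of _ d] conjI ballI impI)
      fix y assume y: "y \<in> {a..b}" "y \<noteq> x \<and> dist y x < d"
      have "\<bar>\<Psi> y - \<Psi> x\<bar> / \<bar>y - x\<bar> \<le> \<epsilon> / 2" using quot[of y] y by (simp add: divide_le_eq)
      then have "\<bar>\<Psi> y - \<Psi> x\<bar> / \<bar>y - x\<bar> < \<epsilon>" using \<epsilon> by linarith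
      then show "dist ((\<Psi> y - \<Psi> x) / (y - x)) 0 < \<epsilon>" by (simp add: dist_real_def)
    qed (use d in simp)
  qed
  then have "\<exists>c. \<forall>x\<in>{a..b}. \<Psi> x = c" by (intro has_field_derivative_zero_constant) auto
  then have "\<Psi> a = \<Psi> b" using ab by auto
  moreover have "\<Psi> a = 0" by (simp add: \<Psi>_def F_def I_def J_def)
  ultimately have "I b = F b * \<phi> b - J b" by (simp add: \<Psi>_def)
  then show ?thesis using int\<phi> by (simp add: has_integral_iff I_def F_def J_def)
qed

text \<open>If B bounds the derivative of \<phi>, then \<phi> + B x is increasing, and so is B x;
  the formula is linear in \<phi>, so the two monotone cases are subtracted.\<close>

lemma HK_integration_by_parts:
  fixes f \<phi> \<phi>' :: "real \<Rightarrow> real"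
  assumes f: "f integrable_on {a..b}" and ab: "a \<le> b"
    and der: "\<And>x. x \<in> {a..b} \<Longrightarrow> (\<phi> has_real_derivative \<phi>' x) (at x within {a..b})"
    and cont: "continuous_on {a..b} \<phi>'"
  shows "((\<lambda>x. f x * \<phi> x) has_integral
    (integral {a..b} f * \<phi> b - integral {a..b} (\<lambda>x. integral {a..x} f * \<phi>' x))) {a..b}"
proof -
  obtain B where B: "\<And>x. x \<in> {a..b} \<Longrightarrow> \<bar>\<phi>' x\<bar> \<le> B" "B \<ge> 0"
  proof -
    have "bounded (\<phi>' ` {a..b})" by (intro compact_imp_bounded compact_continuous_image cont) simp
    then obtain B where B: "\<forall>x\<in>{a..b}. \<bar>\<phi>' x\<bar> \<le> B" unfolding bounded_iff by auto
    then have "B \<ge> 0" using ab abs_ge_zero[of "\<phi>' a"] by force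
    then show thesis using B that by blast
  qed
  have contF: "continuous_on {a..b} (\<lambda>x. integral {a..x} f)"
    using f by (rule indefinite_integral_continuous_1)
  have h1: "((\<lambda>x. f x * (\<phi> x + B * x)) has_integral
    (integral {a..b} f * (\<phi> b + B * b) - integral {a..b} (\<lambda>x. integral {a..x} f * (\<phi>' x + B)))) {a..b}"
  proof (rule HK_integration_by_parts_mono[OF f ab])
    show "0 \<le> \<phi>' x + B" if "x \<in> {a..b}" for x using B(1)[OF that] by linarith
  qed (auto intro!: derivative_eq_intros der continuous_intros cont)
  have h2: "((\<lambda>x. f x * (B * x)) has_integral
    (integral {a..b} f * (B * b) - integral {a..b} (\<lambda>x. integral {a..x} f * B))) {a..b}"
    by (rule HK_integration_by_parts_mono[OF f ab]) (use B in \<open>auto intro!: derivative_eq_intros continuous_intros\<close>)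
  have "integral {a..b} (\<lambda>x. integral {a..x} f * (\<phi>' x + B)) =
      integral {a..b} (\<lambda>x. integral {a..x} f * \<phi>' x) + integral {a..b} (\<lambda>x. integral {a..x} f * B)"
    unfolding distrib_left
    by (intro integral_add integrable_continuous_interval continuous_intros contF cont)
  then show ?thesis using has_integral_diff[OF h1 h2] by (simp add: algebra_simps)
qed

section \<open>The Poisson-Stieltjes integral\<close>

text \<open>The Poisson kernel as a function of the point \<open>z\<close>, so that it is visibly
  the real part of a function holomorphic in \<open>z\<close>; \<open>disc_kernel_rcis\<close> links
  it with \<open>poisson_kernel\<close>.\<close>

definition disc_kernel :: "complex \<Rightarrow> real \<Rightarrow> real" where
  "disc_kernel z \<phi> = (1 - (cmod z)^2) / (2 * pi * (cmod (cis \<phi> - z))^2)"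

text \<open>The derivative of \<open>disc_kernel z\<close> in the angle, written so that it can be
  expanded in powers of \<open>z\<close>.\<close>

definition disc_kernel_deriv :: "complex \<Rightarrow> real \<Rightarrow> real" where
  "disc_kernel_deriv z \<phi> = Im (z * cis \<phi> / (cis \<phi> - z)^2) / pi"

text \<open>The Poisson integral of the Stieltjes measure $dM$, integrated by parts.\<close>
definition poisson_stieltjes :: "(real \<Rightarrow> real) \<Rightarrow> complex \<Rightarrow> real" where
  "poisson_stieltjes M z = (M pi - M (- pi)) * disc_kernel z pi
     - integral {-pi..pi} (\<lambda>\<phi>. M \<phi> * disc_kernel_deriv z \<phi>)"

section \<open>The kernel, its derivative and Poisson's formula\<close>

lemma cis_neq_disc: "cmod z < 1 \<Longrightarrow> cis \<phi> - z \<noteq> 0"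
  by (metis eq_iff_diff_eq_0 less_irrefl norm_cis)

lemma disc_kernel_eq_Re: "disc_kernel z \<phi> = Re ((cis \<phi> + z) / (cis \<phi> - z)) / (2 * pi)"
proof -
  have "Re ((cis \<phi> + z) * cnj (cis \<phi> - z)) = (cmod (cis \<phi>))^2 - (cmod z)^2"
    unfolding cmod_power2 by (simp add: algebra_simps power2_eq_square)
  then have "Re ((cis \<phi> + z) / (cis \<phi> - z)) = (1 - (cmod z)^2) / (cmod (cis \<phi> - z))^2"
    by (simp add: complex_div_cnj[of "cis \<phi> + z"] del: complex_cnj_diff)
  then show ?thesis by (simp add: disc_kernel_def)
qed

lemma disc_kernel_nonneg: "cmod z < 1 \<Longrightarrow> 0 \<le> disc_kernel z \<phi>"
  by (auto simp: disc_kernel_def abs_square_le_1 intro!: divide_nonneg_nonneg)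

lemma disc_kernel_minus_pi: "disc_kernel z (- pi) = disc_kernel z pi"
  by (simp add: disc_kernel_def cis.ctr)

lemma disc_kernel_deriv:
  assumes "cmod z < 1"
  shows "(disc_kernel z has_real_derivative disc_kernel_deriv z \<phi>) (at \<phi> within S)"
proof -
  have ne: "cis \<phi> - z \<noteq> 0" using assms by (rule cis_neq_disc)
  have "((\<lambda>w. (exp (\<i> * w) + z) / (exp (\<i> * w) - z)) has_field_derivative
      (\<i> * exp (\<i> * of_real \<phi>) * (exp (\<i> * of_real \<phi>) - z) - (exp (\<i> * of_real \<phi>) + z) * (\<i> * exp (\<i> * of_real \<phi>)))
       / (exp (\<i> * of_real \<phi>) - z)^2) (at (of_real \<phi>))"
    using ne by (auto intro!: derivative_eq_intros simp: cis_conv_exp power2_eq_square)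
  also have "(\<i> * exp (\<i> * of_real \<phi>) * (exp (\<i> * of_real \<phi>) - z) - (exp (\<i> * of_real \<phi>) + z) * (\<i> * exp (\<i> * of_real \<phi>)))
       / (exp (\<i> * of_real \<phi>) - z)^2 = - 2 * \<i> * (z * cis \<phi> / (cis \<phi> - z)^2)"
    by (simp add: cis_conv_exp algebra_simps)
  finally have "((\<lambda>t. (cis t + z) / (cis t - z)) has_vector_derivative - 2 * \<i> * (z * cis \<phi> / (cis \<phi> - z)^2)) (at \<phi> within S)"
    unfolding cis_conv_exp by (rule has_vector_derivative_real_field)
  then have "((\<lambda>t. Re ((cis t + z) / (cis t - z)) / (2 * pi)) has_vector_derivative
       Re (- 2 * \<i> * (z * cis \<phi> / (cis \<phi> - z)^2)) / (2 * pi)) (at \<phi> within S)"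
    by (intro has_vector_derivative_divide bounded_linear.has_vector_derivative[OF bounded_linear_Re])
  moreover have "Re (- 2 * \<i> * X) / (2 * pi) = Im X / pi" for X by simp
  note this[of "z * cis \<phi> / (cis \<phi> - z)^2", folded disc_kernel_deriv_def]
  ultimately show ?thesis
    by (simp add: has_real_derivative_iff_has_vector_derivative disc_kernel_eq_Re[abs_def])
qed

lemma continuous_on_disc_kernel: "cmod z < 1 \<Longrightarrow> continuous_on S (disc_kernel z)"
  by (meson DERIV_continuous_on disc_kernel_deriv)

lemma continuous_on_disc_kernel_deriv:
  assumes "cmod z < 1" shows "continuous_on S (disc_kernel_deriv z)"
  unfolding disc_kernel_deriv_def
  using cis_neq_disc[OF assms] by (intro continuous_intros) auto

text \<open>Both functions have the denominator |cis \<phi> - z|^2. As the kernel has integral 1,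
  its derivative has L1 norm at most 2/(1-|z|^2).\<close>

lemma abs_disc_kernel_deriv_le:
  assumes "cmod z < 1"
  shows "\<bar>disc_kernel_deriv z \<phi>\<bar> \<le> 2 / (1 - (cmod z)^2) * disc_kernel z \<phi>"
proof -
  have p: "1 - (cmod z)^2 > 0" using assms by (simp add: abs_square_less_1)
  have "\<bar>disc_kernel_deriv z \<phi>\<bar> \<le> cmod (z * cis \<phi> / (cis \<phi> - z)^2) / pi"
    unfolding disc_kernel_deriv_def using abs_Im_le_cmod by (simp add: divide_right_mono)
  also have "\<dots> = cmod z / (cmod (cis \<phi> - z))^2 / pi"
    by (simp add: norm_divide norm_mult norm_power)
  also have "\<dots> \<le> 1 / (cmod (cis \<phi> - z))^2 / pi"
    using assms by (intro divide_right_mono) auto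
  also have "\<dots> = 2 / (1 - (cmod z)^2) * disc_kernel z \<phi>"
  proof -
    have "1 / D / pi = 2 / q * (q / (2 * pi * D))" if "q > 0" for q D :: real
      using that by simp
    from this[OF p] show ?thesis unfolding disc_kernel_def .
  qed
  finally show ?thesis .
qed

text \<open>Cauchy's formula for \<Gamma>(w) (1-|z|^2) / (1 - cnj z w): the extra factor is 1 at w =
  z and turns the Cauchy kernel into the Poisson kernel on the unit circle.\<close>

lemma Poisson_formula:
  assumes hol: "\<Gamma> holomorphic_on ball 0 \<rho>" and \<rho>: "\<rho> > 1" and z: "cmod z < 1"
  shows "((\<lambda>\<phi>. Re (\<Gamma> (cis \<phi>)) * disc_kernel z \<phi>) has_integral Re (\<Gamma> z)) {-pi..pi}"
proof -
  \<comment> \<open>The circle path has angles in [0, 2 pi]. Moving them to [-pi, pi] replaces cis t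
    by -cis t, so everything is set up reflected in the origin.\<close>
  define p where "p = - z"
  have p: "cmod p < 1" using z by (simp add: p_def)
  have ne: "1 - cnj p * w \<noteq> 0" if "w \<in> cball 0 1" for w
  proof
    assume "1 - cnj p * w = 0"
    then have "cmod (cnj p * w) = 1" by (metis eq_iff_diff_eq_0 norm_one)
    moreover have "cmod (cnj p * w) \<le> cmod p * 1"
      unfolding norm_mult complex_mod_cnj using that by (intro mult_left_mono) auto
    ultimately show False using p by simp
  qed
  have holm: "(\<lambda>w. \<Gamma> (- w)) holomorphic_on cball 0 1"
    by (rule holomorphic_on_compose_gen[of uminus _ \<Gamma>, unfolded o_def, OF _ hol])
       (use \<rho> in \<open>auto intro!: holomorphic_intros\<close>)
  define f where "f = (\<lambda>w. \<Gamma> (- w) * of_real (1 - (cmod p)^2) / (1 - cnj p * w))"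
  have "((\<lambda>u. f u / (u - p)) has_contour_integral (2 * of_real pi * \<i> * f p)) (circlepath 0 1)"
    unfolding f_def using ne p by (intro Cauchy_integral_circlepath_simple holomorphic_intros holm) auto
  then have "((\<lambda>t. f (cis t) / (cis t - p) * \<i> * cis t) has_integral 2 * of_real pi * \<i> * f p) {0..2*pi}"
    unfolding circlepath_def by (subst (asm) has_contour_integral_part_circlepath_iff) auto
  then have "((\<lambda>t. f (cis (t + pi)) / (cis (t + pi) - p) * \<i> * cis (t + pi)) has_integral 2 * of_real pi * \<i> * f p) {0-pi..2*pi-pi}"
    by (rule has_integral_shift_real_ivl)
  then have "((\<lambda>t. f (- cis t) / (- cis t - p) * \<i> * (- cis t) / (2 * of_real pi * \<i>)) has_integral 2 * of_real pi * \<i> * f p / (2 * of_real pi * \<i>)) {-pi..pi}"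
    by (intro has_integral_divide) (simp add: cis_mult[symmetric])
  moreover have "f (- cis t) / (- cis t - p) * \<i> * (- cis t) / (2 * of_real pi * \<i>) = \<Gamma> (cis t) * of_real (disc_kernel z t)" for t
  proof -
    have ee: "cis t * cnj (cis t) = 1" by (simp add: complex_norm_square[symmetric])
    have n1: "cis t - z \<noteq> 0" using z by (rule cis_neq_disc)
    have n2: "cnj (cis t) - cnj z \<noteq> 0" using n1 by (metis complex_cnj_diff complex_cnj_zero_iff)
    have n3: "1 - cnj z * cis t \<noteq> 0"
      using ne[of "- cis t"] by (simp add: p_def)
    have q: "1 - cnj z * cis t = cis t * (cnj (cis t) - cnj z)"
      using ee by (simp add: algebra_simps)
    have "of_real ((cmod (cis t - z))^2) = (cis t - z) * (cnj (cis t) - cnj z)"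
      by (simp only: complex_norm_square complex_cnj_diff)
    then have "of_real (disc_kernel z t) = of_real (1 - (cmod z)^2) / (2 * of_real pi * ((cis t - z) * (cnj (cis t) - cnj z)))"
      unfolding disc_kernel_def by (simp del: of_real_power)
    moreover have "f (- cis t) = \<Gamma> (cis t) * of_real (1 - (cmod z)^2) / (cis t * (cnj (cis t) - cnj z))"
      unfolding f_def q[symmetric] by (simp add: p_def)
    moreover have "(G * m / (e * k)) / (- d) * \<i> * (- e) / (2 * of_real pi * \<i>) = G * (m / (2 * of_real pi * (d * k)))"
      if "e \<noteq> 0" "k \<noteq> 0" "d \<noteq> 0" for G m e k d :: complex
      using that by (simp add: divide_simps)
    from this[OF cis_neq_zero n2 n1] have "\<Gamma> (cis t) * of_real (1 - (cmod z)^2) / (cis t * (cnj (cis t) - cnj z)) / (- cis t - p) * \<i> * (- cis t) / (2 * of_real pi * \<i>)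
        = \<Gamma> (cis t) * (of_real (1 - (cmod z)^2) / (2 * of_real pi * ((cis t - z) * (cnj (cis t) - cnj z))))"
      unfolding p_def by simp
    ultimately show ?thesis by metis
  qed
  moreover have "2 * of_real pi * \<i> * f p / (2 * of_real pi * \<i>) = \<Gamma> z"
  proof -
    have "cnj p * p = of_real ((cmod p)^2)" by (metis complex_norm_square mult.commute)
    then have w: "1 - cnj p * p = of_real (1 - (cmod p)^2)" by (simp only: of_real_diff of_real_1)
    have "f p = \<Gamma> (- p) * (1 - cnj p * p) / (1 - cnj p * p)" unfolding f_def w ..
    moreover have "1 - cnj p * p \<noteq> 0" using ne[of p] p by simp
    ultimately have "f p = \<Gamma> z" by (simp add: p_def)
    then show ?thesis by simp
  qed
  ultimately have "((\<lambda>\<phi>. \<Gamma> (cis \<phi>) * of_real (disc_kernel z \<phi>)) has_integral \<Gamma> z) {-pi..pi}" by simp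
  from has_integral_Re[OF this] show ?thesis by simp
qed

lemma has_integral_disc_kernel:
  assumes "cmod z < 1" shows "(disc_kernel z has_integral 1) {-pi..pi}"
  using Poisson_formula[of "\<lambda>_. 1" 2 z] assms by simp

section \<open>Size and harmonicity of the Poisson-Stieltjes integral\<close>

lemma absolutely_integrable_mult_continuous:
  fixes M h :: "real \<Rightarrow> real"
  assumes M: "integrable (lebesgue_on {a..b}) M" and h: "continuous_on {a..b} h"
  shows "(\<lambda>x. M x * h x) integrable_on {a..b}"
proof -
  have "M absolutely_integrable_on {a..b}" using M by (simp add: integrable_restrict_space set_integrable_def)
  moreover have "h \<in> borel_measurable (lebesgue_on {a..b})" using h by (intro continuous_imp_measurable_on_sets_lebesgue) auto
  moreover have "bounded (h ` {a..b})" using h by (intro compact_imp_bounded compact_continuous_image) auto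
  ultimately have "(\<lambda>x. h x * M x) absolutely_integrable_on {a..b}"
    by (intro absolutely_integrable_bounded_measurable_product_real) auto
  then show ?thesis by (simp add: mult.commute set_lebesgue_integral_eq_integral(1))
qed

text \<open>The boundary term and the integral contribute 2B/(1-|z|) each: the kernel at pi is at
  most 1/(1-|z|), and the L1 norm of its derivative is at most 2/(1-|z|).\<close>

lemma abs_poisson_stieltjes_le:
  assumes M: "integrable (lebesgue_on {-pi..pi}) M" and B: "\<And>\<phi>. \<phi> \<in> {-pi..pi} \<Longrightarrow> \<bar>M \<phi>\<bar> \<le> B"
    and z: "cmod z < 1"
  shows "\<bar>poisson_stieltjes M z\<bar> \<le> 4 * B / (1 - cmod z)"
proof -
  define r where "r = cmod z"
  have r: "0 \<le> r" "r < 1" using z by (auto simp: r_def)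
  have B0: "0 \<le> B" using B[of pi] by simp
  have "1 - r \<le> cmod (cis pi - z)"
    unfolding r_def using norm_triangle_ineq2[of "cis pi" z] by simp
  then have "(1 - r)^2 \<le> (cmod (cis pi - z))^2" using r by (intro power_mono) auto
  then have "disc_kernel z pi \<le> (1 - r^2) / (2 * pi * (1 - r)^2)"
    unfolding disc_kernel_def r_def[symmetric] using r
    by (intro divide_left_mono mult_left_mono mult_pos_pos) (auto simp: abs_square_le_1 intro!: zero_less_power2[THEN iffD2] cis_neq_disc[OF z] simp del: cis_pi)
  also have "\<dots> = (1 + r) / (2 * pi) / (1 - r)"
  proof -
    have "1 - r^2 = (1 - r) * (1 + r)" by (simp add: power2_eq_square algebra_simps)
    then show ?thesis using r by (simp add: power2_eq_square[of "1 - r"])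
  qed
  also have "\<dots> \<le> 1 / (1 - r)"
    using r pi_gt3 by (intro divide_right_mono) (auto simp: divide_le_eq)
  finally have k: "disc_kernel z pi \<le> 1 / (1 - r)" .
  have "\<bar>M pi - M (-pi)\<bar> \<le> 2 * B" using B[of pi] B[of "-pi"] by simp
  then have t1: "\<bar>(M pi - M (-pi)) * disc_kernel z pi\<bar> \<le> (2 * B) * (1 / (1 - r))"
    unfolding abs_mult using k disc_kernel_nonneg[OF z] B0 by (intro mult_mono) auto
  have "norm (integral {-pi..pi} (\<lambda>\<phi>. M \<phi> * disc_kernel_deriv z \<phi>))
     \<le> integral {-pi..pi} (\<lambda>\<phi>. B * (2 / (1 - r^2)) * disc_kernel z \<phi>)"
  proof (rule integral_norm_bound_integral)
    show "(\<lambda>\<phi>. M \<phi> * disc_kernel_deriv z \<phi>) integrable_on {-pi..pi}"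
      by (intro absolutely_integrable_mult_continuous M continuous_on_disc_kernel_deriv z)
    show "(\<lambda>\<phi>. B * (2 / (1 - r^2)) * disc_kernel z \<phi>) integrable_on {-pi..pi}"
      by (intro integrable_continuous_interval continuous_intros continuous_on_disc_kernel z)
    fix \<phi> assume "\<phi> \<in> {-pi..pi}"
    then have "\<bar>M \<phi>\<bar> * \<bar>disc_kernel_deriv z \<phi>\<bar> \<le> B * (2 / (1 - r^2) * disc_kernel z \<phi>)"
      using B B0 abs_disc_kernel_deriv_le[OF z] by (intro mult_mono) (auto simp: r_def)
    then show "norm (M \<phi> * disc_kernel_deriv z \<phi>) \<le> B * (2 / (1 - r^2)) * disc_kernel z \<phi>"
      by (simp add: abs_mult)
  qed
  also have "\<dots> = B * (2 / (1 - r^2))"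
    using integral_unique[OF has_integral_disc_kernel[OF z]] by simp
  also have "\<dots> \<le> B * (2 / (1 - r))"
  proof -
    have "r^2 \<le> r" using r by (simp add: power2_eq_square mult_left_le)
    then show ?thesis using r B0 by (intro mult_left_mono divide_left_mono) (auto simp: abs_square_less_1)
  qed
  finally have "\<bar>integral {-pi..pi} (\<lambda>\<phi>. M \<phi> * disc_kernel_deriv z \<phi>)\<bar> \<le> 2 * B / (1 - r)"
    by (simp add: mult.commute)
  then have "\<bar>poisson_stieltjes M z\<bar> \<le> 2 * B / (1 - r) + 2 * B / (1 - r)"
    unfolding poisson_stieltjes_def using t1 by simp
  also have "\<dots> = 4 * B / (1 - r)" by simp
  finally show ?thesis by (simp add: r_def)
qed

lemma poisson_stieltjes_indefinite_integral:
  assumes f: "f integrable_on {-pi..pi}" and z: "cmod z < 1"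
  shows "((\<lambda>\<phi>. f \<phi> * disc_kernel z \<phi>) has_integral
     poisson_stieltjes (\<lambda>x. integral {-pi..x} f) z) {-pi..pi}"
  using HK_integration_by_parts[OF f _ disc_kernel_deriv[OF z] continuous_on_disc_kernel_deriv[OF z]]
  by (simp add: poisson_stieltjes_def)

text \<open>With q = z cis(-\<phi>), the kernel derivative is a multiple of the imaginary part of
  q/(1-q)^2, the sum of (n+1) q^(n+1). Termwise integration gives a power series in
  \<open>z\<close>, without differentiating under the integral sign.\<close>

lemma poisson_stieltjes_holomorphic:
  assumes M: "integrable (lebesgue_on {-pi..pi}) M"
  obtains A where "A holomorphic_on ball 0 1" "\<And>z. z \<in> ball 0 1 \<Longrightarrow> Re (A z) = poisson_stieltjes M z"
proof -
  define c where "c = (\<lambda>n. integral\<^sup>L (lebesgue_on {-pi..pi}) (\<lambda>\<phi>. of_real (M \<phi>) * cis (- \<phi>) ^ n))"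
  define h where "h = (\<lambda>z \<phi>. of_real (M \<phi>) * (z * cis \<phi> / (cis \<phi> - z)^2))"
  have meas[measurable]: "M \<in> borel_measurable (lebesgue_on {-pi..pi})" using M by auto
  have meas_cis[measurable]: "(\<lambda>\<phi>. cis (- \<phi>)) \<in> borel_measurable (lebesgue_on {-pi..pi})"
    by (intro continuous_imp_measurable_on_sets_lebesgue continuous_intros) auto
  have intn: "integrable (lebesgue_on {-pi..pi}) (\<lambda>\<phi>. of_real (M \<phi>) * cis (- \<phi>) ^ n)" for n
    by (rule Bochner_Integration.integrable_bound[OF M]) (auto simp: norm_mult norm_power)
  have inth_sums: "integrable (lebesgue_on {-pi..pi}) (h z)
     \<and> (\<lambda>n. (of_nat (Suc n) * c (Suc n)) * z ^ Suc n) sums integral\<^sup>L (lebesgue_on {-pi..pi}) (h z)"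
    if z: "cmod z < 1" for z
  proof -
    define g where "g = (\<lambda>n \<phi>. of_nat (Suc n) * z ^ Suc n * (of_real (M \<phi>) * cis (- \<phi>) ^ Suc n))"
    have sumr: "summable (\<lambda>n. real (Suc n) * cmod z ^ Suc n)"
    proof -
      have "summable (\<lambda>n. real (Suc n) * cmod z ^ n)"
        using geometric_deriv_sums[of "cmod z"] z by (auto simp: sums_iff)
      from summable_mult[OF this, of "cmod z"] show ?thesis by (simp add: ac_simps)
    qed
    have ng: "norm (g n \<phi>) = (real (Suc n) * cmod z ^ Suc n) * \<bar>M \<phi>\<bar>" for n \<phi>
      by (simp add: g_def norm_mult norm_power del: of_nat_Suc)
    have gint: "integrable (lebesgue_on {-pi..pi}) (g n)" for n
      unfolding g_def by (intro Bochner_Integration.integrable_mult_right intn)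
    have s1: "AE \<phi> in lebesgue_on {-pi..pi}. summable (\<lambda>n. norm (g n \<phi>))"
      unfolding ng by (intro AE_I2 summable_mult2 sumr)
    have s2: "summable (\<lambda>n. \<integral>\<phi>. norm (g n \<phi>) \<partial>lebesgue_on {-pi..pi})"
      unfolding ng by (simp only: integral_mult_right_zero) (intro summable_mult2 sumr)
    have "(\<lambda>n. g n \<phi>) sums h z \<phi>" for \<phi>
    proof -
      define q where "q = z * cis (- \<phi>)"
      have q: "norm q < 1" using z by (simp add: q_def norm_mult)
      have "(\<lambda>n. of_nat (Suc n) * q ^ n) sums (1 / (1 - q)^2)" using q by (rule geometric_deriv_sums)
      then have "(\<lambda>n. of_real (M \<phi>) * q * (of_nat (Suc n) * q ^ n)) sums (of_real (M \<phi>) * q * (1 / (1 - q)^2))"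
        by (rule sums_mult)
      moreover have "of_real (M \<phi>) * q * (of_nat (Suc n) * q ^ n) = g n \<phi>" for n
        by (simp add: g_def q_def power_mult_distrib del: of_nat_Suc)
      moreover have "of_real (M \<phi>) * q * (1 / (1 - q)^2) = h z \<phi>"
      proof -
        have zq: "z = q * cis \<phi>" by (simp add: q_def cis_mult)
        have q1: "1 - q \<noteq> 0" using q by auto
        have "cis \<phi> - z = cis \<phi> * (1 - q)" by (simp add: zq algebra_simps)
        moreover have "q * e * e / (e * (1 - q))^2 = q * (1 / (1 - q)^2)" if "e \<noteq> 0" for e :: complex
          using that by (simp add: power2_eq_square)
        ultimately show ?thesis unfolding h_def by (metis cis_neq_zero mult.assoc zq)
      qed
      ultimately show ?thesis by simp
    qed
    then have hs: "h z = (\<lambda>\<phi>. \<Sum>n. g n \<phi>)" by (auto simp: sums_iff)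
    have "(\<lambda>n. integral\<^sup>L (lebesgue_on {-pi..pi}) (g n)) sums integral\<^sup>L (lebesgue_on {-pi..pi}) (h z)"
      unfolding hs by (rule sums_integral[OF gint s1 s2])
    moreover have "integral\<^sup>L (lebesgue_on {-pi..pi}) (g n) = (of_nat (Suc n) * c (Suc n)) * z ^ Suc n" for n
      unfolding g_def c_def by (subst integral_mult_right_zero) (simp only: ac_simps)
    moreover have "integrable (lebesgue_on {-pi..pi}) (h z)"
      unfolding hs by (rule integrable_suminf[OF gint s1 s2])
    ultimately show ?thesis by simp
  qed
  define S where "S = (\<lambda>z. integral\<^sup>L (lebesgue_on {-pi..pi}) (h z))"
  have "S holomorphic_on ball 0 1"
  proof (rule power_series_holomorphic)
    fix w :: complex assume "w \<in> ball 0 1"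
    then have "(\<lambda>n. (of_nat (Suc n) * c (Suc n)) * w ^ Suc n) sums S w"
      using inth_sums by (simp add: S_def)
    \<comment> \<open>The series starts at exponent 1; the term of index 0 can be added because of
      its factor n.\<close>
    from sums_Suc_iff[of "\<lambda>n. (of_nat n * c n) * w ^ n" "S w", THEN iffD1, OF this]
    show "(\<lambda>n. (of_nat n * c n) * (w - 0) ^ n) sums S w" by simp
  qed
  \<comment> \<open>The real part of i S/pi is -Im S/pi, which is the integral term of
    \<open>poisson_stieltjes\<close> with its sign.\<close>
  define A where "A = (\<lambda>z. of_real (M pi - M (- pi)) * ((cis pi + z) / (cis pi - z) / (2 * of_real pi)) + \<i> / of_real pi * S z)"
  show thesis
  proof (rule that[of A])
    show "A holomorphic_on ball 0 1"
      unfolding A_def by (intro holomorphic_intros \<open>S holomorphic_on ball 0 1\<close>) (auto dest: cis_neq_disc[of _ pi])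
    fix z :: complex assume "z \<in> ball 0 1"
    then have z: "cmod z < 1" by simp
    have ih: "integrable (lebesgue_on {-pi..pi}) (h z)" using inth_sums[OF z] by simp
    have "Im (S z) = integral\<^sup>L (lebesgue_on {-pi..pi}) (\<lambda>\<phi>. Im (h z \<phi>))"
      unfolding S_def using integral_Im[OF ih] by simp
    also have "\<dots> = integral {-pi..pi} (\<lambda>\<phi>. Im (h z \<phi>))"
      using ih by (intro lebesgue_integral_eq_integral) auto
    also have "\<dots> = integral {-pi..pi} (\<lambda>\<phi>. M \<phi> * disc_kernel_deriv z \<phi> * pi)"
    proof -
      have "Im (of_real a * X) = a * (Im X / pi) * pi" for a X by simp
      then show ?thesis unfolding h_def disc_kernel_deriv_def by presburger
    qed
    also have "\<dots> = integral {-pi..pi} (\<lambda>\<phi>. M \<phi> * disc_kernel_deriv z \<phi>) * pi" by simp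
    finally have "Re (\<i> / of_real pi * S z) = - integral {-pi..pi} (\<lambda>\<phi>. M \<phi> * disc_kernel_deriv z \<phi>)"
      by simp
    moreover have "Re ((cis pi + z) / (cis pi - z) / (2 * of_real pi)) = disc_kernel z pi"
      unfolding disc_kernel_eq_Re by (metis Re_divide_of_real of_real_mult of_real_numeral)
    moreover have "Re (of_real a * X + Y) = a * Re X + Re Y" for a X Y by simp
    ultimately show "Re (A z) = poisson_stieltjes M z"
      unfolding A_def poisson_stieltjes_def by (simp only: diff_conv_add_uminus)
  qed
qed

section \<open>Radial lower limits\<close>

lemma cmod_cis_diff_rcis_squared: "(cmod (cis \<phi> - rcis r \<theta>))^2 = 1 - 2 * r * cos (\<phi> - \<theta>) + r^2"
proof -
  have "(cmod (cis \<phi> - rcis r \<theta>))^2 = (cos \<phi> - r * cos \<theta>)^2 + (sin \<phi> - r * sin \<theta>)^2"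
    by (simp add: cmod_power2)
  also have "\<dots> = ((sin \<phi>)^2 + (cos \<phi>)^2) - 2 * r * cos (\<phi> - \<theta>) + r^2 * ((sin \<theta>)^2 + (cos \<theta>)^2)"
    unfolding cos_diff by algebra
  finally show ?thesis by simp
qed

lemma disc_kernel_rcis: "0 \<le> r \<Longrightarrow> disc_kernel (rcis r \<theta>) \<phi> = poisson_kernel r (\<phi> - \<theta>)"
  unfolding disc_kernel_def poisson_kernel_def cmod_cis_diff_rcis_squared by simp

text \<open>In this form the sign of the derivative is seen to be opposite to that of the sine, and
  its decay away from \<theta> is visible.\<close>

lemma disc_kernel_deriv_rcis:
  assumes r: "0 \<le> r" "r < 1"
  shows "disc_kernel_deriv (rcis r \<theta>) \<phi> =
    - ((1 - r^2) * r * sin (\<phi> - \<theta>) / (pi * (1 - 2 * r * cos (\<phi> - \<theta>) + r^2)^2))"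
proof (rule DERIV_unique)
  have z: "cmod (rcis r \<theta>) < 1" using r by simp
  show "(disc_kernel (rcis r \<theta>) has_real_derivative disc_kernel_deriv (rcis r \<theta>) \<phi>) (at \<phi>)"
    using z by (rule disc_kernel_deriv)
  have D: "1 - 2 * r * cos (\<phi> - \<theta>) + r^2 \<noteq> 0"
    using cis_neq_disc[OF z] by (metis cmod_cis_diff_rcis_squared norm_eq_zero power_eq_0_iff)
  have E: "disc_kernel (rcis r \<theta>) = (\<lambda>\<phi>. (1 - r^2) / (2 * pi * (1 - 2 * r * cos (\<phi> - \<theta>) + r^2)))"
    by (auto simp: disc_kernel_rcis[OF r(1)] poisson_kernel_def)
  have alg: "- (a * (2 * pi * (2 * r * s))) / (2 * pi * D)^2 = - (a * r * s / (pi * D^2))" if "D \<noteq> 0" for a s D :: real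
    using that by (simp add: power2_eq_square field_simps)
  have "(disc_kernel (rcis r \<theta>) has_real_derivative
      - ((1 - r^2) * (2 * pi * (2 * r * sin (\<phi> - \<theta>)))) / (2 * pi * (1 - 2 * r * cos (\<phi> - \<theta>) + r^2))^2) (at \<phi>)"
    unfolding E using D by (auto intro!: derivative_eq_intros simp: power2_eq_square)
  then show "(disc_kernel (rcis r \<theta>) has_real_derivative
    - ((1 - r^2) * r * sin (\<phi> - \<theta>) / (pi * (1 - 2 * r * cos (\<phi> - \<theta>) + r^2)^2))) (at \<phi>)"
    unfolding alg[OF D] .
qed

lemma cos_le_cos_of_far:
  assumes "0 \<le> d" "d \<le> \<bar>s\<bar>" "\<bar>s\<bar> \<le> 2 * pi - d"
  shows "cos s \<le> cos d"
proof (cases "\<bar>s\<bar> \<le> pi")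
  case True
  then have "cos \<bar>s\<bar> \<le> cos d" using assms by (intro cos_monotone_0_pi_le) auto
  then show ?thesis by simp
next
  case False
  then have "cos (2 * pi - \<bar>s\<bar>) \<le> cos d" using assms by (intro cos_monotone_0_pi_le) auto
  then show ?thesis by (simp add: cos_diff)
qed

text \<open>\<open>N\<close> is \<open>M\<close> minus a line of slope \<open>l\<close> through its value at \<open>\<theta>\<close>. Near \<open>\<theta>\<close> the product
  of \<open>N\<close> and the kernel derivative is nonpositive; away from \<open>\<theta>\<close> the kernel derivative tends to
  0 uniformly.\<close>
lemma radial_lower_bound_of_split:
  assumes d: "0 < d" "d \<le> pi"
    and B: "\<And>\<phi>. \<phi> \<in> {-pi..pi} \<Longrightarrow> \<bar>N \<phi>\<bar> \<le> B"
    and sgn: "\<And>\<phi>. \<phi> \<in> {-pi..pi} \<Longrightarrow> \<bar>\<phi> - \<theta>\<bar> < d \<or> 2 * pi - d < \<bar>\<phi> - \<theta>\<bar> \<Longrightarrow> 0 \<le> N \<phi> * sin (\<phi> - \<theta>)"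
    and p: "cos (p - \<theta>) \<le> cos d"
    and split: "\<And>r. 0 < r \<Longrightarrow> r < 1 \<Longrightarrow> ((\<lambda>\<phi>. N \<phi> * disc_kernel_deriv (rcis r \<theta>) \<phi>) has_integral
        (l + c * disc_kernel (rcis r \<theta>) p - P r)) {-pi..pi}"
    and \<epsilon>: "\<epsilon> > 0"
  shows "\<forall>\<^sub>F r in at_left (1::real). l - \<epsilon> \<le> P r"
proof -
  define \<kappa> where "\<kappa> = 1 - cos d"
  have "cos d < cos 0" using d by (intro cos_monotone_0_pi) auto
  then have \<kappa>: "\<kappa> > 0" by (simp add: \<kappa>_def)
  have B0: "0 \<le> B" using B[of pi] by simp
  \<comment> \<open>The first summand bounds the leftover kernel value at \<open>p\<close>. The
    second is the far bound B/(pi \<kappa>^2) times the length 2 pi.\<close>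
  define Q where "Q = \<bar>c\<bar> / (2 * pi * \<kappa>) + 2 * B / \<kappa>^2"
  have lower: "l - (1 - r^2) * Q \<le> P r" if r: "1/2 \<le> r" "r < 1" for r
  proof -
    define D where "D = (\<lambda>s. 1 - 2 * r * cos s + r^2)"
    have r2: "0 \<le> 1 - r^2" using r by (simp add: abs_square_le_1)
    have Dge: "\<kappa> \<le> D s" if "cos s \<le> cos d" for s
    proof -
      have "D s = (1 - r)^2 + 2 * r * (1 - cos s)" by (simp add: D_def power2_eq_square algebra_simps)
      \<comment> \<open>The restriction r >= 1/2 enters here: it makes the lower bound \<kappa> for
        the denominator independent of r.\<close>
      moreover have "1 * (1 - cos d) \<le> 2 * r * (1 - cos s)"
        using that r by (intro mult_mono) auto
      then have "0 + (1 - cos d) \<le> (1 - r)^2 + 2 * r * (1 - cos s)" by (intro add_mono) auto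
      ultimately show ?thesis by (simp only: \<kappa>_def add_0)
    qed
    have kp: "disc_kernel (rcis r \<theta>) p \<le> (1 - r^2) / (2 * pi * \<kappa>)"
      using Dge[OF p] r r2 \<kappa> unfolding D_def
      by (auto simp: disc_kernel_rcis poisson_kernel_def intro!: divide_left_mono mult_left_mono mult_pos_pos)
    have k0: "0 \<le> disc_kernel (rcis r \<theta>) p" using r by (intro disc_kernel_nonneg) simp
    have "\<bar>c * disc_kernel (rcis r \<theta>) p\<bar> \<le> \<bar>c\<bar> * ((1 - r^2) / (2 * pi * \<kappa>))"
      unfolding abs_mult using kp k0 by (intro mult_left_mono) auto
    then have ck: "- (\<bar>c\<bar> * ((1 - r^2) / (2 * pi * \<kappa>))) \<le> c * disc_kernel (rcis r \<theta>) p" by linarith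
    have pw: "N \<phi> * disc_kernel_deriv (rcis r \<theta>) \<phi> \<le> B * ((1 - r^2) / (pi * \<kappa>^2))" if \<phi>: "\<phi> \<in> {-pi..pi}" for \<phi>
    proof -
      have kd: "disc_kernel_deriv (rcis r \<theta>) \<phi> = - ((1 - r^2) * r * sin (\<phi> - \<theta>) / (pi * (D (\<phi> - \<theta>))^2))"
        unfolding D_def using r by (intro disc_kernel_deriv_rcis) auto
      show ?thesis
      proof (cases "\<bar>\<phi> - \<theta>\<bar> < d \<or> 2 * pi - d < \<bar>\<phi> - \<theta>\<bar>")
        case True
        have "N \<phi> * disc_kernel_deriv (rcis r \<theta>) \<phi> = - ((1 - r^2) * r / (pi * (D (\<phi> - \<theta>))^2) * (N \<phi> * sin (\<phi> - \<theta>)))"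
          unfolding kd by simp
        also have "\<dots> \<le> 0" using sgn[OF \<phi> True] r2 r by simp
        also have "0 \<le> B * ((1 - r^2) / (pi * \<kappa>^2))" using B0 r2 by simp
        finally show ?thesis .
      next
        case False
        then have "\<kappa> \<le> D (\<phi> - \<theta>)" using d by (intro Dge cos_le_cos_of_far) auto
        then have D2: "\<kappa>^2 \<le> (D (\<phi> - \<theta>))^2" using \<kappa> by (intro power_mono) auto
        have "\<bar>disc_kernel_deriv (rcis r \<theta>) \<phi>\<bar> = (1 - r^2) * (r * \<bar>sin (\<phi> - \<theta>)\<bar>) / (pi * (D (\<phi> - \<theta>))^2)"
          unfolding kd using r r2 by (simp add: abs_mult)
        also have "\<dots> \<le> (1 - r^2) * 1 / (pi * \<kappa>^2)"
          using r r2 D2 \<kappa> by (intro frac_le mult_left_mono mult_le_one) auto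
        finally have "\<bar>N \<phi>\<bar> * \<bar>disc_kernel_deriv (rcis r \<theta>) \<phi>\<bar> \<le> B * ((1 - r^2) / (pi * \<kappa>^2))"
          using B[OF \<phi>] B0 by (intro mult_mono) auto
        then show ?thesis unfolding abs_mult[symmetric] by linarith
      qed
    qed
    have "l + c * disc_kernel (rcis r \<theta>) p - P r \<le> B * ((1 - r^2) / (pi * \<kappa>^2)) * (pi - (- pi))"
    proof (rule has_integral_le[OF split])
      show "((\<lambda>_. B * ((1 - r^2) / (pi * \<kappa>^2))) has_integral B * ((1 - r^2) / (pi * \<kappa>^2)) * (pi - (- pi))) {-pi..pi}"
        using has_integral_const_real[of "B * ((1 - r^2) / (pi * \<kappa>^2))" "-pi" pi] by (simp add: mult.commute)
    qed (use r pw in auto)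
    also have "\<dots> = (1 - r^2) * (2 * B / \<kappa>^2)" by simp
    finally have "l + c * disc_kernel (rcis r \<theta>) p - P r \<le> (1 - r^2) * (2 * B / \<kappa>^2)" .
    moreover have "\<bar>c\<bar> * ((1 - r^2) / (2 * pi * \<kappa>)) = (1 - r^2) * (\<bar>c\<bar> / (2 * pi * \<kappa>))" by simp
    ultimately show ?thesis using ck unfolding Q_def distrib_left by linarith
  qed
  have "((\<lambda>r. (1 - r^2) * Q) \<longlongrightarrow> (1 - 1^2) * Q) (at_left 1)" by (intro tendsto_intros)
  then have "\<forall>\<^sub>F r in at_left 1. (1 - r^2) * Q < \<epsilon>" using \<epsilon> by (intro order_tendstoD(2)) auto
  moreover have "\<forall>\<^sub>F r in at_left 1. r \<in> {1/2<..<(1::real)}" by (intro eventually_at_left_real) simp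
  ultimately show ?thesis
  proof eventually_elim
    case (elim r)
    then show ?case using lower[of r] by auto
  qed
qed

lemma has_integral_affine_times_kernel_deriv:
  assumes z: "cmod z < 1" and pq: "p \<le> q"
  shows "((\<lambda>\<phi>. (\<alpha> + \<beta> * \<phi>) * disc_kernel_deriv z \<phi>) has_integral
    ((\<alpha> + \<beta> * q) * disc_kernel z q - (\<alpha> + \<beta> * p) * disc_kernel z p - \<beta> * integral {p..q} (disc_kernel z))) {p..q}"
proof -
  have "((\<lambda>\<phi>. (\<alpha> + \<beta> * \<phi>) * disc_kernel_deriv z \<phi> + \<beta> * disc_kernel z \<phi>) has_integral
      ((\<alpha> + \<beta> * q) * disc_kernel z q - (\<alpha> + \<beta> * p) * disc_kernel z p)) {p..q}"
  proof (rule fundamental_theorem_of_calculus[OF pq])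
    fix \<phi>
    have "((\<lambda>\<phi>. \<alpha> + \<beta> * \<phi>) has_real_derivative \<beta>) (at \<phi> within {p..q})"
      by (auto intro!: derivative_eq_intros)
    from DERIV_mult[OF this disc_kernel_deriv[OF z]]
    show "((\<lambda>\<phi>. (\<alpha> + \<beta> * \<phi>) * disc_kernel z \<phi>) has_vector_derivative
        (\<alpha> + \<beta> * \<phi>) * disc_kernel_deriv z \<phi> + \<beta> * disc_kernel z \<phi>) (at \<phi> within {p..q})"
      unfolding has_real_derivative_iff_has_vector_derivative by (simp add: ac_simps)
  qed
  moreover have "((\<lambda>\<phi>. \<beta> * disc_kernel z \<phi>) has_integral \<beta> * integral {p..q} (disc_kernel z)) {p..q}"
    by (intro has_integral_mult_right integrable_integral integrable_continuous_interval continuous_on_disc_kernel z)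
  ultimately have "((\<lambda>\<phi>. (\<alpha> + \<beta> * \<phi>) * disc_kernel_deriv z \<phi> + \<beta> * disc_kernel z \<phi> - \<beta> * disc_kernel z \<phi>) has_integral
    ((\<alpha> + \<beta> * q) * disc_kernel z q - (\<alpha> + \<beta> * p) * disc_kernel z p - \<beta> * integral {p..q} (disc_kernel z))) {p..q}"
    by (rule has_integral_diff)
  then show ?thesis by simp
qed

text \<open>Subtracting from \<open>M\<close> a line of slope \<open>f \<theta>\<close> splits off
  exactly \<open>f \<theta>\<close>, since the kernel has integral 1, up to a kernel value far from
  \<theta>. The remainder has the sign of \<phi> - \<theta> near \<theta> because \<open>M\<close>
  is a major function. At \<theta> = -pi the neighbourhood on the circle consists of both ends of
  the interval, so that case needs its own splitting.\<close>

lemma poisson_stieltjes_radial_liminf: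
  fixes M f :: "real \<Rightarrow> real"
  assumes M: "integrable (lebesgue_on {-pi..pi}) M" and B: "\<And>\<phi>. \<phi> \<in> {-pi..pi} \<Longrightarrow> \<bar>M \<phi>\<bar> \<le> B"
    and major: "\<And>t. t \<in> {-pi..pi} \<Longrightarrow> \<exists>d>0. \<forall>x y. -pi \<le> x \<longrightarrow> x \<le> t \<longrightarrow> t \<le> y \<longrightarrow> y \<le> pi \<longrightarrow> t - d < x \<longrightarrow> y < t + d \<longrightarrow>
        (y - x) * f t \<le> M y - M x"
    and per: "f (-pi) = f pi" and \<theta>: "\<theta> \<in> {-pi..<pi}" and \<epsilon>: "\<epsilon> > 0"
  shows "\<forall>\<^sub>F r in at_left (1::real). f \<theta> - \<epsilon> \<le> poisson_stieltjes M (rcis r \<theta>)"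
proof -
  define C where "C = M pi - M (-pi)"
  have MI: "((\<lambda>\<phi>. M \<phi> * disc_kernel_deriv (rcis r \<theta>) \<phi>) has_integral
      (C * disc_kernel (rcis r \<theta>) pi - poisson_stieltjes M (rcis r \<theta>))) {-pi..pi}" if "0 < r" "r < 1" for r
  proof -
    have "(\<lambda>\<phi>. M \<phi> * disc_kernel_deriv (rcis r \<theta>) \<phi>) integrable_on {-pi..pi}"
      using that by (intro absolutely_integrable_mult_continuous M continuous_on_disc_kernel_deriv) auto
    then show ?thesis by (simp add: has_integral_iff poisson_stieltjes_def C_def)
  qed
  have B0: "0 \<le> B" using B[of pi] by simp
  show ?thesis
  proof (cases "\<theta> = - pi")
    case False
    then have \<theta>: "-pi < \<theta>" "\<theta> < pi" using \<theta> by auto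
    obtain d0 where d0: "d0 > 0" "\<And>x y. -pi \<le> x \<Longrightarrow> x \<le> \<theta> \<Longrightarrow> \<theta> \<le> y \<Longrightarrow> y \<le> pi \<Longrightarrow> \<theta> - d0 < x \<Longrightarrow> y < \<theta> + d0 \<Longrightarrow>
        (y - x) * f \<theta> \<le> M y - M x" using major[of \<theta>] \<theta> by auto
    \<comment> \<open>The last two bounds keep the neighbourhood inside the interval, so the
      wrap-around alternative 2 pi - d < |\<phi> - \<theta>| cannot occur.\<close>
    define d where "d = min d0 (min (\<theta> + pi) (pi - \<theta>))"
    have d: "0 < d" "d \<le> d0" "d \<le> \<theta> + pi" "d \<le> pi - \<theta>" using d0(1) \<theta> by (auto simp: d_def)
    define N where "N = (\<lambda>\<phi>. M \<phi> - (M \<theta> - f \<theta> * \<theta> + f \<theta> * \<phi>))"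
    show ?thesis
    proof (rule radial_lower_bound_of_split[where N = N and d = d and p = pi and \<theta> = \<theta>])
      show "0 < d" "d \<le> pi" using d by auto
      show "\<bar>N \<phi>\<bar> \<le> 2 * B + \<bar>f \<theta>\<bar> * (2 * pi)" if "\<phi> \<in> {-pi..pi}" for \<phi>
      proof -
        have "\<bar>f \<theta> * (\<phi> - \<theta>)\<bar> \<le> \<bar>f \<theta>\<bar> * (2 * pi)"
          unfolding abs_mult using that \<theta> by (intro mult_left_mono) auto
        moreover have "N \<phi> = M \<phi> - M \<theta> - f \<theta> * (\<phi> - \<theta>)" by (simp add: N_def algebra_simps)
        ultimately show ?thesis using B[OF that] B[of \<theta>] \<theta> by auto
      qed
      show "0 \<le> N \<phi> * sin (\<phi> - \<theta>)" if \<phi>: "\<phi> \<in> {-pi..pi}" "\<bar>\<phi> - \<theta>\<bar> < d \<or> 2 * pi - d < \<bar>\<phi> - \<theta>\<bar>" for \<phi>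
      proof -
        have near: "\<bar>\<phi> - \<theta>\<bar> < d" using \<phi> d by auto
        show ?thesis
        proof (cases "\<theta> \<le> \<phi>")
          case True
          then have "0 \<le> N \<phi>" using d0(2)[of \<theta> \<phi>] near d \<phi> \<theta> by (auto simp: N_def algebra_simps)
          moreover have "0 \<le> sin (\<phi> - \<theta>)" using True near d by (intro sin_ge_zero) auto
          ultimately show ?thesis by simp
        next
          case False
          then have "N \<phi> \<le> 0" using d0(2)[of \<phi> \<theta>] near d \<phi> \<theta> by (auto simp: N_def algebra_simps)
          moreover have "0 \<le> sin (- (\<phi> - \<theta>))" using False near d by (intro sin_ge_zero) auto
          then have "sin (\<phi> - \<theta>) \<le> 0" unfolding sin_minus by simp
          ultimately show ?thesis by (rule mult_nonpos_nonpos)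
        qed
      qed
      show "cos (pi - \<theta>) \<le> cos d" using d by (intro cos_le_cos_of_far) auto
      fix r :: real assume r: "0 < r" "r < 1"
      then have z: "cmod (rcis r \<theta>) < 1" by simp
      have "((\<lambda>\<phi>. (M \<theta> - f \<theta> * \<theta> + f \<theta> * \<phi>) * disc_kernel_deriv (rcis r \<theta>) \<phi>) has_integral
         (2 * pi * f \<theta> * disc_kernel (rcis r \<theta>) pi - f \<theta>)) {-pi..pi}"
        using has_integral_affine_times_kernel_deriv[OF z, of "-pi" pi "M \<theta> - f \<theta> * \<theta>" "f \<theta>"]
          integral_unique[OF has_integral_disc_kernel[OF z]]
        by (simp add: disc_kernel_minus_pi algebra_simps)
      from has_integral_diff[OF MI[OF r] this]
      show "((\<lambda>\<phi>. N \<phi> * disc_kernel_deriv (rcis r \<theta>) \<phi>) has_integral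
        (f \<theta> + (C - 2 * pi * f \<theta>) * disc_kernel (rcis r \<theta>) pi - poisson_stieltjes M (rcis r \<theta>))) {-pi..pi}"
        by (simp add: N_def algebra_simps)
    qed (fact \<epsilon>)
  next
    case True
    obtain d1 where d1: "d1 > 0" "\<And>y. -pi \<le> y \<Longrightarrow> y \<le> pi \<Longrightarrow> y < -pi + d1 \<Longrightarrow> (y + pi) * f \<theta> \<le> M y - M (-pi)"
      using major[of "-pi"] True by force
    obtain d2 where d2: "d2 > 0" "\<And>x. -pi \<le> x \<Longrightarrow> x \<le> pi \<Longrightarrow> pi - d2 < x \<Longrightarrow> (pi - x) * f \<theta> \<le> M pi - M x"
      using major[of pi] True per by force
    define d where "d = min pi (min d1 d2)"
    have d: "0 < d" "d \<le> d1" "d \<le> d2" "d \<le> pi" using d1(1) d2(1) by (auto simp: d_def)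
    \<comment> \<open>Two lines of slope \<open>f \<theta>\<close>, one through the value of
      \<open>M\<close> at each end. Their jump at 0, opposite to \<theta>, leaves the kernel value
      at 0; hence p = 0 below.\<close>
    define L where "L = (\<lambda>\<phi>. if \<phi> < 0 then M (-pi) + f \<theta> * pi + f \<theta> * \<phi> else M pi - f \<theta> * pi + f \<theta> * \<phi>)"
    define N where "N = (\<lambda>\<phi>. M \<phi> - L \<phi>)"
    show ?thesis
    proof (rule radial_lower_bound_of_split[where N = N and d = d and p = 0 and \<theta> = \<theta>])
      show "0 < d" "d \<le> pi" using d by auto
      show "\<bar>N \<phi>\<bar> \<le> 2 * B + \<bar>f \<theta>\<bar> * (2 * pi)" if "\<phi> \<in> {-pi..pi}" for \<phi>
      proof -
        have "\<bar>f \<theta> * (\<phi> + pi)\<bar> \<le> \<bar>f \<theta>\<bar> * (2 * pi)" "\<bar>f \<theta> * (\<phi> - pi)\<bar> \<le> \<bar>f \<theta>\<bar> * (2 * pi)"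
          unfolding abs_mult using that by (intro mult_left_mono; auto)+
        moreover have "N \<phi> = M \<phi> - M (-pi) - f \<theta> * (\<phi> + pi) \<or> N \<phi> = M \<phi> - M pi - f \<theta> * (\<phi> - pi)"
          by (simp add: N_def L_def algebra_simps)
        ultimately show ?thesis using B[OF that] B[of pi] B[of "-pi"] by (auto simp: abs_le_iff)
      qed
      show "0 \<le> N \<phi> * sin (\<phi> - \<theta>)" if \<phi>: "\<phi> \<in> {-pi..pi}" "\<bar>\<phi> - \<theta>\<bar> < d \<or> 2 * pi - d < \<bar>\<phi> - \<theta>\<bar>" for \<phi>
      proof (cases "\<bar>\<phi> - \<theta>\<bar> < d")
        case t: True
        then have lt: "\<phi> < 0" "\<phi> < - pi + d1" "\<phi> + pi < d" using d \<phi>(1) True by auto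
        then have "0 \<le> N \<phi>" using d1(2)[of \<phi>] \<phi>(1) by (auto simp: N_def L_def algebra_simps)
        moreover have "0 \<le> sin (\<phi> + pi)" using \<phi>(1) lt d by (intro sin_ge_zero) auto
        ultimately show ?thesis using True by (simp add: mult_nonneg_nonpos)
      next
        case f: False
        then have gt: "0 \<le> \<phi>" "pi - d2 < \<phi>" using d \<phi> True by auto
        then have "N \<phi> \<le> 0" using d2(2)[of \<phi>] \<phi>(1) by (auto simp: N_def L_def algebra_simps)
        moreover have "0 \<le> sin \<phi>" using \<phi>(1) gt by (intro sin_ge_zero) auto
        ultimately show ?thesis using True by (simp add: mult_nonpos_nonneg)
      qed
      show "cos (0 - \<theta>) \<le> cos d" using True by simp
      fix r :: real assume r: "0 < r" "r < 1"
      define z where "z = rcis r \<theta>"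
      have z: "cmod z < 1" using r by (simp add: z_def)
      have i1: "((\<lambda>\<phi>. L \<phi> * disc_kernel_deriv z \<phi>) has_integral
          ((M (-pi) + f \<theta> * pi) * disc_kernel z 0 - M (-pi) * disc_kernel z (-pi) - f \<theta> * integral {-pi..0} (disc_kernel z))) {-pi..0}"
      proof (rule has_integral_spike_finite[of "{0}"])
        show "((\<lambda>\<phi>. (M (-pi) + f \<theta> * pi + f \<theta> * \<phi>) * disc_kernel_deriv z \<phi>) has_integral
          ((M (-pi) + f \<theta> * pi) * disc_kernel z 0 - M (-pi) * disc_kernel z (-pi) - f \<theta> * integral {-pi..0} (disc_kernel z))) {-pi..0}"
          using has_integral_affine_times_kernel_deriv[OF z, of "-pi" 0 "M (-pi) + f \<theta> * pi" "f \<theta>"] by simp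
      qed (auto simp: L_def)
      have i2: "((\<lambda>\<phi>. L \<phi> * disc_kernel_deriv z \<phi>) has_integral
          (M pi * disc_kernel z pi - (M pi - f \<theta> * pi) * disc_kernel z 0 - f \<theta> * integral {0..pi} (disc_kernel z))) {0..pi}"
      proof (rule has_integral_eq)
        show "((\<lambda>\<phi>. (M pi - f \<theta> * pi + f \<theta> * \<phi>) * disc_kernel_deriv z \<phi>) has_integral
          (M pi * disc_kernel z pi - (M pi - f \<theta> * pi) * disc_kernel z 0 - f \<theta> * integral {0..pi} (disc_kernel z))) {0..pi}"
          using has_integral_affine_times_kernel_deriv[OF z, of 0 pi "M pi - f \<theta> * pi" "f \<theta>"] by simp
      qed (auto simp: L_def)
      have "integral {-pi..0} (disc_kernel z) + integral {0..pi} (disc_kernel z) = 1"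
        using Henstock_Kurzweil_Integration.integral_combine[of "-pi" 0 pi "disc_kernel z"] has_integral_disc_kernel[OF z]
        by (auto simp: has_integral_iff)
      then have one: "f \<theta> * integral {-pi..0} (disc_kernel z) = f \<theta> - f \<theta> * integral {0..pi} (disc_kernel z)"
        by (metis add_diff_cancel_right' mult.right_neutral right_diff_distrib)
      have "((\<lambda>\<phi>. L \<phi> * disc_kernel_deriv z \<phi>) has_integral
          (C * disc_kernel z pi + (2 * pi * f \<theta> - C) * disc_kernel z 0 - f \<theta>)) {-pi..pi}"
        using has_integral_combine[OF _ _ i1 i2] one by (simp add: disc_kernel_minus_pi C_def algebra_simps)
      from has_integral_diff[OF MI[OF r] this[unfolded z_def]]
      show "((\<lambda>\<phi>. N \<phi> * disc_kernel_deriv (rcis r \<theta>) \<phi>) has_integral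
        (f \<theta> + (C - 2 * pi * f \<theta>) * disc_kernel (rcis r \<theta>) 0 - poisson_stieltjes M (rcis r \<theta>))) {-pi..pi}"
        by (simp add: N_def algebra_simps)
    qed (fact \<epsilon>)
  qed
qed

section \<open>Uniqueness\<close>

lemma abs_integral_le_alexiewicz_norm:
  assumes f: "continuous_on UNIV f" and B: "\<And>x. \<bar>f x\<bar> \<le> B"
    and I: "is_interval I" "bounded I" "diameter I \<le> 2 * pi"
  shows "\<bar>integral I f\<bar> \<le> alexiewicz_norm f"
  unfolding alexiewicz_norm_def
proof (rule cSUP_upper)
  have B0: "0 \<le> B" using B[of 0] by linarith
  show "bdd_above ((\<lambda>I. \<bar>integral I f\<bar>) ` {I. is_interval I \<and> bounded I \<and> diameter I \<le> 2 * pi})"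
  proof (rule bdd_aboveI2)
    fix J :: "real set" assume "J \<in> {I. is_interval I \<and> bounded I \<and> diameter I \<le> 2 * pi}"
    then have J: "is_interval J" "bounded J" "diameter J \<le> 2 * pi" by auto
    show "\<bar>integral J f\<bar> \<le> B * (4 * pi)"
    \<comment> \<open>In the first case the integral is 0, for a non-integrable function by the
      default value.\<close>
    proof (cases "J = {} \<or> \<not> f integrable_on J")
      case True
      then show ?thesis using B0 by (auto simp: not_integrable_integral)
    next
      case False
      then obtain x where x: "x \<in> J" and int: "f integrable_on J" by blast
      have sub: "J \<subseteq> {x - 2 * pi..x + 2 * pi}"
      proof
        fix y assume "y \<in> J"
        then have "dist y x \<le> 2 * pi" using diameter_bounded_bound[OF J(2), of y x] x J(3) by simp
        then show "y \<in> {x - 2 * pi..x + 2 * pi}" by (auto simp: dist_real_def abs_le_iff)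
      qed
      have lm: "J \<in> lmeasurable"
        using J by (intro measurable_convex is_interval_convex) auto
      have "norm (integral J f) \<le> integral J (\<lambda>_. B)"
        using B int lm by (intro integral_norm_bound_integral) (auto intro: integrable_on_const)
      also have "\<dots> = B * measure lebesgue J"
        using lmeasure_integral[OF lm] lm integral_mult_right[of J B "\<lambda>_. 1"] by simp
      also have "\<dots> \<le> B * measure lebesgue {x - 2 * pi..x + 2 * pi}"
        using lm B0 sub by (intro mult_left_mono measure_mono_fmeasurable) (auto simp: fmeasurableD)
      finally show ?thesis by simp
    qed
  qed
qed (use I in auto)

text \<open>\<open>Arg\<close> takes values in (-pi, pi], while the radial hypothesis is stated on
  [-pi, pi); only the value pi has to be moved.\<close>

lemma cis_in_period:
  obtains \<theta> where "\<theta> \<in> {-pi..<pi}" "cis \<theta> = cis x"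
proof (cases "Arg (cis x) = pi")
  case True
  then have "cis pi = cis x" using cis_Arg[of "cis x"] by (simp add: sgn_eq)
  then show thesis by (intro that[of "-pi"]) (auto simp: cis.ctr)
next
  case False
  moreover have "cis (Arg (cis x)) = cis x" using cis_Arg[of "cis x"] by (simp add: sgn_eq)
  moreover have "- pi < Arg (cis x)" "Arg (cis x) \<le> pi" using Arg_bounded by auto
  ultimately show thesis by (intro that[of "Arg (cis x)"]) auto
qed

text \<open>On the circle of radius R = (1+r)/2 the primitive of \<open>u\<close> from -pi is
  bounded by the Alexiewicz norm. Poisson's formula, integrated by parts, costs a further factor of
  order 1/(1-r).\<close>

lemma growth_of_alexiewicz_growth:
  assumes G: "G holomorphic_on ball 0 1" and u: "\<And>z. z \<in> ball 0 1 \<Longrightarrow> u z = Re (G z)"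
    and o: "(\<lambda>r. alexiewicz_norm (\<lambda>\<theta>. u (rcis r \<theta>))) \<in> o[at_left 1](\<lambda>r. 1 / (1 - r))"
    and \<epsilon>: "\<epsilon> > 0"
  shows "\<exists>r0<1. \<forall>z. r0 < cmod z \<longrightarrow> cmod z < 1 \<longrightarrow> \<bar>Re (G z)\<bar> \<le> \<epsilon> / (1 - cmod z)^2"
proof -
  \<comment> \<open>The 16 is 2 * 4 * 2: 1 - R = (1-r)/2, the constant of
    \<open>abs_poisson_stieltjes_le\<close>, and 1 - r/R >= (1-r)/2.\<close>
  have "\<forall>\<^sub>F R in at_left 1. norm (alexiewicz_norm (\<lambda>\<theta>. u (rcis R \<theta>))) \<le> \<epsilon> / 16 * norm (1 / (1 - R))"
    using o \<epsilon> by (intro landau_o.smallD) auto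
  then obtain R0 where R0: "R0 < 1" "\<And>R. R0 < R \<Longrightarrow> R < 1 \<Longrightarrow>
      norm (alexiewicz_norm (\<lambda>\<theta>. u (rcis R \<theta>))) \<le> \<epsilon> / 16 * norm (1 / (1 - R))"
    unfolding eventually_at_left_field by blast
  have "\<bar>Re (G z)\<bar> \<le> \<epsilon> / (1 - cmod z)^2" if z: "max 0 R0 < cmod z" "cmod z < 1" for z
  proof -
    define r where "r = cmod z"
    define R where "R = (1 + r) / 2"
    have r: "0 < r" "R0 < r" "r < 1" using z by (auto simp: r_def)
    have R: "r < R" "R < 1" "0 < R" "R0 < R" using r by (auto simp: R_def)
    define N where "N = alexiewicz_norm (\<lambda>\<theta>. u (rcis R \<theta>))"
    have Nle: "N \<le> \<epsilon> / 8 / (1 - r)"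
    proof -
      have "N \<le> \<epsilon> / 16 * norm (1 / (1 - R))" using R0(2)[OF R(4,2)] unfolding N_def by simp
      also have "norm (1 / (1 - R)) = 2 / (1 - r)" using r by (simp add: R_def field_simps)
      finally show ?thesis by simp
    qed
    define f where "f = (\<lambda>\<phi>. u (rcis R \<phi>))"
    have fG: "f = (\<lambda>\<phi>. Re (G (rcis R \<phi>)))" using u R by (auto simp: f_def)
    have contG: "continuous_on (ball 0 1) G" using G by (rule holomorphic_on_imp_continuous_on)
    have contf: "continuous_on UNIV f"
      unfolding fG rcis_def by (intro continuous_intros continuous_on_compose2[OF contG]) (use R in \<open>auto simp: norm_mult\<close>)
    have "bounded (G ` cball 0 R)"
      by (intro compact_imp_bounded compact_continuous_image continuous_on_subset[OF contG]) (use R in auto)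
    then obtain B where B: "\<forall>w\<in>cball 0 R. norm (G w) \<le> B" unfolding bounded_iff by auto
    have fB: "\<bar>f \<phi>\<bar> \<le> B" for \<phi>
      using B[rule_format, of "rcis R \<phi>"] abs_Re_le_cmod[of "G (rcis R \<phi>)"] R by (auto simp: fG)
    have intf: "f integrable_on {-pi..pi}"
      using contf by (intro integrable_continuous_interval) (rule continuous_on_subset, auto)
    define F where "F = (\<lambda>x. integral {-pi..x} f)"
    have FN: "\<bar>F x\<bar> \<le> N" if "x \<in> {-pi..pi}" for x
      unfolding F_def N_def f_def[symmetric] using that
      by (intro abs_integral_le_alexiewicz_norm[OF contf fB]) auto
    have Fint: "integrable (lebesgue_on {-pi..pi}) F"
      unfolding F_def using intf by (intro continuous_imp_integrable_real indefinite_integral_continuous_1)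
    define w where "w = z / of_real R"
    have w: "cmod w = r / R" using R by (simp add: w_def r_def norm_divide)
    then have w1: "cmod w < 1" using R by simp
    have "(\<lambda>v. G (of_real R * v)) holomorphic_on ball 0 (1 / R)"
      by (rule holomorphic_on_compose_gen[of "\<lambda>v. of_real R * v" _ G, unfolded o_def, OF _ G])
         (use R in \<open>auto intro!: holomorphic_intros simp: norm_mult field_simps\<close>)
    from Poisson_formula[OF this _ w1]
    have "((\<lambda>\<phi>. f \<phi> * disc_kernel w \<phi>) has_integral Re (G z)) {-pi..pi}"
      using R unfolding fG rcis_def by (simp add: w_def)
    moreover have "((\<lambda>\<phi>. f \<phi> * disc_kernel w \<phi>) has_integral poisson_stieltjes F w) {-pi..pi}"
      unfolding F_def by (rule poisson_stieltjes_indefinite_integral[OF intf w1])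
    ultimately have "Re (G z) = poisson_stieltjes F w" by (rule has_integral_unique)
    then have "\<bar>Re (G z)\<bar> \<le> 4 * N / (1 - cmod w)"
      using abs_poisson_stieltjes_le[OF Fint FN w1] by simp
    also have "\<dots> \<le> 4 * N / ((1 - r) / 2)"
    proof (rule divide_left_mono)
      have "(1 - r) / 2 * R \<le> (1 - r) / 2 * 1" using R r by (intro mult_left_mono) auto
      also have "\<dots> = R - r" by (simp add: R_def field_simps)
      finally show "(1 - r) / 2 \<le> 1 - cmod w" using R unfolding w by (simp add: field_simps)
      show "0 \<le> 4 * N" using FN[of 0] by simp
      show "0 < (1 - cmod w) * ((1 - r) / 2)" using w1 r by simp
    qed
    also have "\<dots> \<le> 4 * (\<epsilon> / 8 / (1 - r)) / ((1 - r) / 2)"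
      using Nle r by (intro divide_right_mono mult_left_mono) auto
    also have "\<dots> = \<epsilon> / (1 - r)^2"
    proof -
      have "4 * (\<epsilon> / 8 / s) / (s / 2) = \<epsilon> / s^2" for s by (simp add: power2_eq_square)
      then show ?thesis .
    qed
    finally show ?thesis by (simp add: r_def)
  qed
  then show ?thesis using R0(1) by (intro exI[of _ "max 0 R0"]) auto
qed

section \<open>Transfer between disc and half-plane\<close>

lemma one_minus_exp_ge_half: "y / 2 \<le> 1 - exp (- y)" if "0 \<le> y" "y \<le> 1" for y :: real
proof -
  have "1 + y \<le> exp y" by (rule exp_ge_add_one_self)
  then have "exp (- y) \<le> 1 / (1 + y)" using that by (simp add: exp_minus field_simps)
  also have "1 / (1 + y) \<le> 1 - y / 2"
  proof -
    have "y * y \<le> y" using that by (simp add: mult_left_le)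
    then show ?thesis using that by (simp add: field_simps)
  qed
  finally show ?thesis by simp
qed

text \<open>Under \<omega> -> exp(i \<omega>) vertical lines become radii, so the half-plane result
  gives unrestricted lower limits. These are carried back to the disc by a local inverse, and the
  minimum principle is applied in the disc itself, which is bounded.\<close>

lemma Re_nonneg_on_disc:
  assumes hol: "H holomorphic_on ball 0 1"
    and growth: "\<And>\<epsilon>. \<epsilon> > 0 \<Longrightarrow> \<exists>r0<1. \<forall>z. r0 < cmod z \<longrightarrow> cmod z < 1 \<longrightarrow> - \<epsilon> / (1 - cmod z)^2 \<le> Re (H z)"
    and radial: "\<And>\<theta> \<epsilon>. \<theta> \<in> {-pi..<pi} \<Longrightarrow> \<epsilon> > 0 \<Longrightarrow> \<forall>\<^sub>F r in at_left (1::real). - \<epsilon> \<le> Re (H (rcis r \<theta>))"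
    and z: "z \<in> ball 0 1"
  shows "0 \<le> Re (H z)"
proof -
  define F where "F = (\<lambda>\<omega>. H (exp (\<i> * \<omega>)))"
  have expd: "cmod (exp (\<i> * \<omega>)) = exp (- Im \<omega>)" for \<omega> by (simp add: norm_exp_eq_Re)
  have near1: "\<exists>y0>0. \<forall>y. 0 < y \<longrightarrow> y < y0 \<longrightarrow> r0 < exp (- y)" if "r0 < 1" for r0 :: real
  proof (intro exI[of _ "1 - r0"] conjI allI impI)
    fix y assume "0 < y" "y < 1 - r0"
    then show "r0 < exp (- y)" using exp_ge_add_one_self[of "-y"] by linarith
  qed (use that in simp)
  have liminf: "\<forall>\<^sub>F \<omega> in at (of_real x) within {\<omega>. Im \<omega> > 0}. - e \<le> Re (F \<omega>)" if e: "e > 0" for x e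
  proof (rule unrestricted_liminf_nonneg[OF _ _ _ e])
    show "F holomorphic_on {z. 0 < Im z}"
      unfolding F_def
      by (rule holomorphic_on_compose_gen[of "\<lambda>\<omega>. exp (\<i> * \<omega>)" _ H, unfolded o_def, OF _ hol])
         (auto intro!: holomorphic_intros simp: expd)
  next
    fix \<epsilon> :: real assume \<epsilon>: "\<epsilon> > 0"
    \<comment> \<open>A point at height y is sent to distance 1 - exp(-y) >= y/2 from the circle;
      the square of this loss is the factor 4.\<close>
    then obtain r0 where r0: "r0 < 1" "\<And>z. r0 < cmod z \<Longrightarrow> cmod z < 1 \<Longrightarrow> - (\<epsilon> / 4) / (1 - cmod z)^2 \<le> Re (H z)"
      using growth[of "\<epsilon> / 4"] by auto
    obtain y0 where y0: "y0 > 0" "\<And>y. 0 < y \<Longrightarrow> y < y0 \<Longrightarrow> r0 < exp (- y)" using near1[OF r0(1)] by blast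
    have "- \<epsilon> / (Im \<omega>)^2 \<le> Re (F \<omega>)" if \<omega>: "0 < Im \<omega>" "Im \<omega> < min y0 1" for \<omega>
    proof -
      define y where "y = Im \<omega>"
      have y: "0 < y" "y < y0" "y \<le> 1" using \<omega> by (auto simp: y_def)
      have "- (\<epsilon> / 4) / (1 - exp (- y))^2 \<le> Re (F \<omega>)"
        using r0(2)[of "exp (\<i> * \<omega>)"] y0(2)[of y] y unfolding F_def expd y_def by simp
      moreover have "(\<epsilon> / 4) / (1 - exp (- y))^2 \<le> (\<epsilon> / 4) / (y / 2)^2"
        using \<epsilon> y one_minus_exp_ge_half[of y] by (intro divide_left_mono power_mono) auto
      moreover have "(\<epsilon> / 4) / (y / 2)^2 = \<epsilon> / y^2" by (simp add: power_divide)
      ultimately show ?thesis unfolding y_def minus_divide_left[symmetric] by linarith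
    qed
    then show "\<exists>y0>0. \<forall>z. 0 < Im z \<longrightarrow> Im z < y0 \<longrightarrow> - \<epsilon> / (Im z)\<^sup>2 \<le> Re (F z)"
      using y0(1) by (intro exI[of _ "min y0 1"]) auto
  next
    fix x \<epsilon> :: real assume \<epsilon>: "\<epsilon> > 0"
    obtain \<theta> where \<theta>: "\<theta> \<in> {-pi..<pi}" "cis \<theta> = cis x" by (rule cis_in_period)
    obtain r0 where r0: "r0 < 1" "\<And>r. r0 < r \<Longrightarrow> r < 1 \<Longrightarrow> - \<epsilon> \<le> Re (H (rcis r \<theta>))"
      using radial[OF \<theta>(1) \<epsilon>] unfolding eventually_at_left_field by blast
    obtain y0 where y0: "y0 > 0" "\<And>y. 0 < y \<Longrightarrow> y < y0 \<Longrightarrow> r0 < exp (- y)" using near1[OF r0(1)] by blast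
    have "exp (\<i> * Complex x y) = rcis (exp (- y)) \<theta>" for y
      by (simp add: exp_eq_polar rcis_def \<theta>(2) exp_of_real)
    then show "\<exists>y0>0. \<forall>y. 0 < y \<longrightarrow> y < y0 \<longrightarrow> - \<epsilon> \<le> Re (F (Complex x y))"
      using r0(2) y0 unfolding F_def by (intro exI[of _ y0]) auto
  qed
  show ?thesis
  proof (rule Re_min_principle[OF hol _ _ _ z])
    fix \<zeta> :: complex and e :: real assume "\<zeta> \<in> frontier (ball 0 1)" and e: "e > 0"
    then have \<zeta>: "cmod \<zeta> = 1" by simp
    define x where "x = Arg \<zeta>"
    have \<zeta>0: "\<zeta> \<noteq> 0" using \<zeta> by auto
    then have \<zeta>x: "\<zeta> = exp (\<i> * of_real x)"
      using \<zeta> Arg_eq[of \<zeta>] by (simp add: x_def)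
    \<comment> \<open>Dividing by \<zeta> centres the logarithm at 1, so its branch cut stays away
      for every boundary point \<zeta>.\<close>
    define \<omega> where "\<omega> = (\<lambda>z. of_real x - \<i> * Ln (z / \<zeta>))"
    have "isCont \<omega> \<zeta>" unfolding \<omega>_def using \<zeta>0 by (intro continuous_intros) auto
    moreover have \<omega>\<zeta>: "\<omega> \<zeta> = of_real x" using \<zeta>0 by (simp add: \<omega>_def)
    ultimately have lim: "(\<omega> \<longlongrightarrow> of_real x) (at \<zeta> within ball 0 1)"
      by (metis continuous_at_imp_continuous_at_within continuous_within)
    have ev: "\<forall>\<^sub>F z in at \<zeta> within ball 0 1. z \<in> ball 0 1 \<and> z \<noteq> 0"
    proof -
      have "\<forall>\<^sub>F z in at \<zeta> within ball 0 1. z \<noteq> 0"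
        using \<zeta>0 by (intro tendsto_imp_eventually_ne[OF tendsto_ident_at])
      moreover have "\<forall>\<^sub>F z in at \<zeta> within ball 0 1. z \<in> ball 0 1" by (simp add: eventually_at_filter)
      ultimately show ?thesis by eventually_elim simp
    qed
    have Im\<omega>: "0 < Im (\<omega> z)" if "z \<in> ball 0 1" "z \<noteq> 0" for z
      using that \<zeta> \<zeta>0 by (simp add: \<omega>_def norm_divide)
    have inv: "exp (\<i> * \<omega> z) = z" if "z \<noteq> 0" for z
    proof -
      have "\<i> * \<omega> z = \<i> * of_real x + Ln (z / \<zeta>)" by (simp add: \<omega>_def algebra_simps)
      then show ?thesis using that \<zeta>0 by (simp add: exp_add \<zeta>x[symmetric])
    qed
    have "filterlim \<omega> (at (of_real x) within {\<omega>. Im \<omega> > 0}) (at \<zeta> within ball 0 1)"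
      unfolding filterlim_at
    proof
      show "\<forall>\<^sub>F z in at \<zeta> within ball 0 1. \<omega> z \<in> {\<omega>. Im \<omega> > 0} \<and> \<omega> z \<noteq> of_real x"
        using ev
      proof eventually_elim
        case (elim z)
        then show ?case using Im\<omega>[of z] by auto
      qed
    qed (fact lim)
    then have "\<forall>\<^sub>F z in at \<zeta> within ball 0 1. - e \<le> Re (F (\<omega> z))"
      using liminf[OF e] by (rule eventually_compose_filterlim[rotated])
    with ev show "\<forall>\<^sub>F z in at \<zeta> within ball 0 1. - e \<le> Re (H z)"
    proof eventually_elim
      case (elim z)
      then show ?case using inv[of z] by (simp add: F_def)
    qed
  qed auto
qed

section \<open>Comparison with the Poisson integral\<close>

lemma poisson_integral_eq_poisson_stieltjes:
  assumes f: "f integrable_on {-pi..pi}" and z: "cmod z < 1"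
  shows "poisson_integral f z = poisson_stieltjes (\<lambda>x. integral {-pi..x} f) z"
proof -
  have "disc_kernel z \<phi> = poisson_kernel (cmod z) (\<phi> - Arg z)" for \<phi>
    using disc_kernel_rcis[of "cmod z" "Arg z" \<phi>] by (simp add: rcis_cmod_Arg)
  then show ?thesis
    using integral_unique[OF poisson_stieltjes_indefinite_integral[OF f z]] by (simp add: poisson_integral_def)
qed

lemma harmonic_le_poisson_integral:
  assumes G: "G holomorphic_on ball 0 1" and f: "f \<in> HK"
    and lim: "\<And>\<theta>. \<theta> \<in> {-pi..<pi} \<Longrightarrow> ((\<lambda>r. Re (G (rcis r \<theta>))) \<longlongrightarrow> f \<theta>) (at_left 1)"
    and growth: "\<And>\<epsilon>. \<epsilon> > 0 \<Longrightarrow> \<exists>r0<1. \<forall>z. r0 < cmod z \<longrightarrow> cmod z < 1 \<longrightarrow> Re (G z) \<le> \<epsilon> / (1 - cmod z)^2"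
    and z: "z \<in> ball 0 1"
  shows "Re (G z) \<le> poisson_integral f z"
proof (rule field_le_epsilon)
  fix \<epsilon> :: real assume \<epsilon>: "\<epsilon> > 0"
  have z1: "cmod z < 1" using z by simp
  \<comment> \<open>The point \<open>z\<close> is fixed before the major function is chosen, so the
    error 4e/(1-|z|) can be made exactly \<epsilon>.\<close>
  define e where "e = \<epsilon> * (1 - cmod z) / 4"
  have e: "e > 0" using \<epsilon> z1 by (simp add: e_def)
  have fi: "f integrable_on {-pi..pi}" and fp: "f (-pi) = f pi"
  proof -
    show "f integrable_on {-pi..pi}" using f by (simp add: HK_def)
    have "f (-pi + 2 * pi) = f (-pi)" using f unfolding HK_def by blast
    then show "f (-pi) = f pi" by simp
  qed
  obtain g where g: "mono_on {-pi..pi} g" "\<And>x. x \<in> {-pi..pi} \<Longrightarrow> 0 \<le> g x \<and> g x \<le> e"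
    and gt: "\<And>t. t \<in> {-pi..pi} \<Longrightarrow> \<exists>d>0. \<forall>x y. -pi \<le> x \<longrightarrow> x \<le> t \<longrightarrow> t \<le> y \<longrightarrow> y \<le> pi \<longrightarrow> t - d < x \<longrightarrow> y < t + d \<longrightarrow>
        \<bar>(y - x) * f t - integral {x..y} f\<bar> \<le> g y - g x"
    by (rule HK_monotone_error_function[OF fi e]) blast
  define F where "F = (\<lambda>x. integral {-pi..x} f)"
  define M where "M = (\<lambda>x. F x + g x)"
  have contF: "continuous_on {-pi..pi} F"
    unfolding F_def using fi by (rule indefinite_integral_continuous_1)
  have Fint: "integrable (lebesgue_on {-pi..pi}) F" using contF by (rule continuous_imp_integrable_real)
  have gint: "integrable (lebesgue_on {-pi..pi}) g" using g(1) by (rule integrable_mono_on)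
  have Mint: "integrable (lebesgue_on {-pi..pi}) M"
    unfolding M_def by (intro Bochner_Integration.integrable_add Fint gint)
  obtain B where B: "\<And>x. x \<in> {-pi..pi} \<Longrightarrow> \<bar>M x\<bar> \<le> B"
  proof -
    have "bounded (F ` {-pi..pi})" by (intro compact_imp_bounded compact_continuous_image contF) simp
    then obtain B where "\<forall>x\<in>{-pi..pi}. \<bar>F x\<bar> \<le> B" unfolding bounded_iff by auto
    then have "\<bar>M x\<bar> \<le> B + e" if "x \<in> {-pi..pi}" for x
      using that g(2)[OF that] unfolding M_def by fastforce
    then show thesis by (rule that)
  qed
  have B0: "0 \<le> B" using B[of pi] by simp
  have major: "\<exists>d>0. \<forall>x y. -pi \<le> x \<longrightarrow> x \<le> t \<longrightarrow> t \<le> y \<longrightarrow> y \<le> pi \<longrightarrow> t - d < x \<longrightarrow> y < t + d \<longrightarrow>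
        (y - x) * f t \<le> M y - M x" if t: "t \<in> {-pi..pi}" for t
  proof -
    obtain d where d: "d > 0" "\<And>x y. -pi \<le> x \<Longrightarrow> x \<le> t \<Longrightarrow> t \<le> y \<Longrightarrow> y \<le> pi \<Longrightarrow> t - d < x \<Longrightarrow> y < t + d \<Longrightarrow>
        \<bar>(y - x) * f t - integral {x..y} f\<bar> \<le> g y - g x" using gt[OF t] by blast
    have "(y - x) * f t \<le> M y - M x"
      if xy: "-pi \<le> x" "x \<le> t" "t \<le> y" "y \<le> pi" "t - d < x" "y < t + d" for x y
    proof -
      have "F x + integral {x..y} f = F y"
        unfolding F_def using xy integrable_on_subinterval[OF fi, of "-pi" y]
        by (intro Henstock_Kurzweil_Integration.integral_combine) auto
      then show ?thesis using d(2)[OF xy] unfolding M_def by linarith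
    qed
    then show ?thesis using d(1) by blast
  qed
  obtain A where A: "A holomorphic_on ball 0 1" "\<And>z. z \<in> ball 0 1 \<Longrightarrow> Re (A z) = poisson_stieltjes M z"
    by (rule poisson_stieltjes_holomorphic[OF Mint]) blast
  have "0 \<le> Re (A z - G z)"
  proof (rule Re_nonneg_on_disc[where H = "\<lambda>z. A z - G z"])
    show "(\<lambda>z. A z - G z) holomorphic_on ball 0 1" by (intro holomorphic_intros A(1) G)
  next
    fix \<epsilon> :: real assume \<epsilon>: "\<epsilon> > 0"
    then obtain r0 where r0: "r0 < 1" "\<And>z. r0 < cmod z \<Longrightarrow> cmod z < 1 \<Longrightarrow> Re (G z) \<le> (\<epsilon> / 2) / (1 - cmod z)^2"
      using growth[of "\<epsilon> / 2"] by auto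
    \<comment> \<open>Beyond this radius 4B/s is at most (\<epsilon>/2)/s^2 with s = 1 - |z|: the
      bounded function \<open>M\<close> contributes one order less than the critical growth. The 1
      in B + 1 avoids a zero denominator.\<close>
    define r1 where "r1 = 1 - \<epsilon> / (8 * (B + 1))"
    have r1: "r1 < 1" using \<epsilon> B0 by (simp add: r1_def)
    have "- \<epsilon> / (1 - cmod z)^2 \<le> Re (A z - G z)" if z: "max r0 r1 < cmod z" "cmod z < 1" for z
    proof -
      define s where "s = 1 - cmod z"
      have s: "0 < s" "s < \<epsilon> / (8 * (B + 1))" using z by (auto simp: s_def r1_def)
      have "Re (A z) = poisson_stieltjes M z" using z by (intro A(2)) simp
      moreover have "\<bar>poisson_stieltjes M z\<bar> \<le> 4 * B / s"
        unfolding s_def using abs_poisson_stieltjes_le[OF Mint B z(2)] by simp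
      moreover have "4 * B / s \<le> (\<epsilon> / 2) / s^2"
      proof -
        have "s * (8 * (B + 1)) < \<epsilon>" using s B0 by (simp add: field_simps)
        then have "4 * B * s \<le> \<epsilon> / 2" using s B0 by (simp add: algebra_simps)
        then have "4 * B * s / s^2 \<le> (\<epsilon> / 2) / s^2" by (intro divide_right_mono) auto
        then show ?thesis using s by (simp add: power2_eq_square)
      qed
      moreover have "Re (G z) \<le> (\<epsilon> / 2) / s^2" unfolding s_def using z by (intro r0(2)) auto
      moreover have "- \<epsilon> / s^2 = - ((\<epsilon> / 2) / s^2) - (\<epsilon> / 2) / s^2" by (simp add: field_simps)
      ultimately have "- \<epsilon> / s^2 \<le> Re (A z - G z)" by simp
      then show ?thesis by (simp add: s_def)
    qed
    then show "\<exists>r0<1. \<forall>z. r0 < cmod z \<longrightarrow> cmod z < 1 \<longrightarrow> - \<epsilon> / (1 - cmod z)^2 \<le> Re (A z - G z)"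
      using r0(1) r1 by (intro exI[of _ "max r0 r1"]) auto
  next
    fix \<theta> \<epsilon> :: real assume \<theta>: "\<theta> \<in> {-pi..<pi}" and \<epsilon>: "\<epsilon> > 0"
    have "\<forall>\<^sub>F r in at_left 1. f \<theta> - \<epsilon> / 2 \<le> poisson_stieltjes M (rcis r \<theta>)"
      using poisson_stieltjes_radial_liminf[OF Mint B major fp \<theta>, of "\<epsilon> / 2"] \<epsilon> by simp
    moreover have "\<forall>\<^sub>F r in at_left 1. Re (G (rcis r \<theta>)) < f \<theta> + \<epsilon> / 2"
      using \<epsilon> by (intro order_tendstoD(2)[OF lim[OF \<theta>]]) auto
    moreover have "\<forall>\<^sub>F r in at_left 1. r \<in> {0<..<(1::real)}" by (intro eventually_at_left_real) simp
    ultimately show "\<forall>\<^sub>F r in at_left 1. - \<epsilon> \<le> Re (A (rcis r \<theta>) - G (rcis r \<theta>))"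
    proof eventually_elim
      case (elim r)
      then show ?case using A(2)[of "rcis r \<theta>"] by simp
    qed
  qed (fact z)
  then have "Re (G z) \<le> poisson_stieltjes M z" using A(2)[OF z] by simp
  also have "\<dots> = poisson_stieltjes F z + poisson_stieltjes g z"
  proof -
    have "integral {-pi..pi} (\<lambda>\<phi>. F \<phi> * disc_kernel_deriv z \<phi> + g \<phi> * disc_kernel_deriv z \<phi>)
      = integral {-pi..pi} (\<lambda>\<phi>. F \<phi> * disc_kernel_deriv z \<phi>) + integral {-pi..pi} (\<lambda>\<phi>. g \<phi> * disc_kernel_deriv z \<phi>)"
      by (intro integral_add absolutely_integrable_mult_continuous Fint gint continuous_on_disc_kernel_deriv z1)
    then show ?thesis by (simp add: poisson_stieltjes_def M_def distrib_right algebra_simps)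
  qed
  also have "poisson_stieltjes F z = poisson_integral f z"
    unfolding F_def using poisson_integral_eq_poisson_stieltjes[OF fi z1] by simp
  also have "poisson_stieltjes g z \<le> 4 * e / (1 - cmod z)"
    using abs_poisson_stieltjes_le[OF gint _ z1, of e] g(2) by (auto simp: abs_le_iff)
  also have "4 * e / (1 - cmod z) = \<epsilon>" using z1 by (simp add: e_def)
  finally show "Re (G z) \<le> poisson_integral f z + \<epsilon>" by simp
qed

theorem theorem11:
  fixes u :: "complex \<Rightarrow> real" and f :: "real \<Rightarrow> real"
  assumes "harmonic_on (ball 0 1) u"
    and "f \<in> HK"
    and "\<And>\<theta>. \<theta> \<in> {-pi..<pi} \<Longrightarrow> ((\<lambda>r. u (rcis r \<theta>)) \<longlongrightarrow> f \<theta>) (at_left 1)"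
    and "(\<lambda>r. alexiewicz_norm (\<lambda>\<theta>. u (rcis r \<theta>))) \<in> o[at_left 1](\<lambda>r. 1 / (1 - r))"
  shows "\<forall>z\<in>ball 0 1. u z = poisson_integral f z"
proof
  fix z :: complex assume z: "z \<in> ball 0 1"
  obtain G where G: "G holomorphic_on ball 0 1" and u: "\<And>z. z \<in> ball 0 1 \<Longrightarrow> u z = Re (G z)"
    using harmonic_on_ball_eq_Re_holomorphic[OF assms(1)] by blast
  have lim: "((\<lambda>r. Re (G (rcis r \<theta>))) \<longlongrightarrow> f \<theta>) (at_left 1)" if "\<theta> \<in> {-pi..<pi}" for \<theta>
  proof (rule Lim_transform_eventually[OF assms(3)[OF that]])
    have "\<forall>\<^sub>F r in at_left 1. r \<in> {0<..<(1::real)}" by (intro eventually_at_left_real) simp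
    then show "\<forall>\<^sub>F r in at_left 1. u (rcis r \<theta>) = Re (G (rcis r \<theta>))"
      by eventually_elim (simp add: u)
  qed
  have growth: "\<exists>r0<1. \<forall>z. r0 < cmod z \<longrightarrow> cmod z < 1 \<longrightarrow> \<bar>Re (G z)\<bar> \<le> \<epsilon> / (1 - cmod z)^2"
    if "\<epsilon> > 0" for \<epsilon>
    using G u assms(4) that by (rule growth_of_alexiewicz_growth)
  have "Re (G z) \<le> poisson_integral f z"
  proof (rule harmonic_le_poisson_integral[OF G assms(2) lim _ z])
    fix \<epsilon> :: real assume "\<epsilon> > 0"
    then show "\<exists>r0<1. \<forall>z. r0 < cmod z \<longrightarrow> cmod z < 1 \<longrightarrow> Re (G z) \<le> \<epsilon> / (1 - cmod z)^2"
      using growth by (meson abs_le_iff)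
  qed
  moreover have "Re (- G z) \<le> poisson_integral (\<lambda>x. - f x) z"
  proof (rule harmonic_le_poisson_integral[where G = "\<lambda>z. - G z"])
    show "(\<lambda>z. - G z) holomorphic_on ball 0 1" by (intro holomorphic_intros G)
    show "(\<lambda>x. - f x) \<in> HK" using assms(2) by (auto simp: HK_def integrable_neg)
    show "((\<lambda>r. Re (- G (rcis r \<theta>))) \<longlongrightarrow> - f \<theta>) (at_left 1)" if "\<theta> \<in> {-pi..<pi}" for \<theta>
      using tendsto_minus[OF lim[OF that]] by simp
    fix \<epsilon> :: real assume "\<epsilon> > 0"
    then show "\<exists>r0<1. \<forall>z. r0 < cmod z \<longrightarrow> cmod z < 1 \<longrightarrow> Re (- G z) \<le> \<epsilon> / (1 - cmod z)^2"
      unfolding uminus_complex.sel using growth by (meson abs_le_iff)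
  qed (fact z)
  moreover have "poisson_integral (\<lambda>x. - f x) z = - poisson_integral f z"
    by (simp add: poisson_integral_def)
  ultimately show "u z = poisson_integral f z" using u[OF z] by simp
qed

end
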